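(* Let $K$ be a field, let $n\geq 3$ be an integer, let $S=K[x_1,\ldots,x_n]$, and let $I_n=(x_1x_2,\,x_2x_3,\ldots,x_{n-1}x_n)\subset S$ and $J_n=I_n+(x_nx_1)\subset S$. Then $$\operatorname{sdepth}(I_n)\geq 1+\frac{n-1}{2}\quad\text{and}\quad \operatorname{sdepth}(J_n)\geq \frac{n}{2}.$$ In particular, $I_n$ and $J_n$ satisfy the Stanley conjecture, i.e. $\operatorname{sdepth}(I_n)\geq \operatorname{depth}(I_n)$ and $\operatorname{sdepth}(J_n)\geq\operatorname{depth}(J_n)$.
   Context: Let $M$ be a nonzero $\mathbb Z^n$-graded $S$-module. A Stanley decomposition of $M$ is a direct sum $\mathcal D: M=\bigoplus_{i=1}^r m_iK[Z_i]$ as $\mathbb Z^n$-graded $K$-vector spaces, where each $m_i\in M$ is homogeneous with respect to the $\mathbb Z^n$-grading, $Z_i\subset\{x_1,\ldots,x_n\}$, and $m_iK[Z_i]=\{um_i:\ u\in K[Z_i]\}\subset M$ is a free $K[Z_i]$-submodule of $M$. Put $\operatorname{sdepth}(\mathcal D)=\min_{i}|Z_i|$. The Stanley depth $\operatorname{sdepth}(M)$ is the maximum of $\operatorname{sdepth}(\mathcal D)$ over all Stanley decompositions $\mathcal D$ of $M$. The depth $\operatorname{depth}(M)$ is taken with respect to the graded maximal ideal $(x_1,\ldots,x_n)$. *)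

theory Defs
  imports
    "HOL-Library.Poly_Mapping"
    "HOL-Library.Extended_Nat"
    "HOL-Algebra.Ideal"
    "HOL-Algebra.Module"
    Complex_Main
begin

section \<open>The polynomial ring in \<open>n\<close> variables\<close>

text \<open>
  Polynomials in the variables \<open>x\<^sub>0, x\<^sub>1, \<dots>\<close>: finitely supported maps from exponent vectors to
  coefficients, with the convolution product of \<^theory>\<open>HOL-Library.Poly_Mapping\<close>.
\<close>
type_synonym 'a mpoly = "(nat \<Rightarrow>\<^sub>0 nat) \<Rightarrow>\<^sub>0 'a"

definition var :: "nat \<Rightarrow> 'a::field mpoly"
  where "var i = Poly_Mapping.single (Poly_Mapping.single i 1) 1"

text \<open>\<open>polys Z\<close> is \<open>K[Z]\<close>, where a set of variables is represented by the set of its indices.\<close>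
definition polys :: "nat set \<Rightarrow> 'a::field mpoly set"
  where "polys Z = {p. \<forall>u \<in> Poly_Mapping.keys p. Poly_Mapping.keys u \<subseteq> Z}"

text \<open>\<open>S = K[x\<^sub>1, \<dots>, x\<^sub>n]\<close>, with indices running from \<open>1\<close> to \<open>n\<close>.\<close>
definition poly_ring :: "nat \<Rightarrow> 'a::field mpoly ring"
  where "poly_ring n =
    \<lparr>carrier = polys {1..n}, mult = (*), one = 1, zero = 0, add = (+)\<rparr>"

definition max_ideal :: "nat \<Rightarrow> 'a::field mpoly set"
  where "max_ideal n = Idl\<^bsub>poly_ring n\<^esub> (var ` {1..n})"


section \<open>\<open>\<int>\<^sup>n\<close>-graded modules\<close>

text \<open>\<open>\<int>\<^sup>n\<close>, as the integer sequences that vanish outside \<open>{1..n}\<close>.\<close>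
definition Zn :: "nat \<Rightarrow> (nat \<Rightarrow> int) set"
  where "Zn n = {a. \<forall>i. i \<notin> {1..n} \<longrightarrow> a i = 0}"

locale Zn_graded_module = module "poly_ring n" M
  for n :: nat and M :: "('a::field mpoly, 'm, 'e) module_scheme" (structure) +
  fixes gr :: "(nat \<Rightarrow> int) \<Rightarrow> 'm set"
  assumes gr_subgroup: "a \<in> Zn n \<Longrightarrow> subgroup (gr a) (add_monoid M)"
    and gr_scale: "\<lbrakk>a \<in> Zn n; m \<in> gr a\<rbrakk> \<Longrightarrow> Poly_Mapping.single 0 c \<odot>\<^bsub>M\<^esub> m \<in> gr a"
    and gr_direct_sum: "x \<in> carrier M \<Longrightarrow>
      \<exists>!f. f \<in> (\<Pi>\<^sub>E a\<in>Zn n. gr a) \<and> finite {a \<in> Zn n. f a \<noteq> \<zero>\<^bsub>M\<^esub>} \<and>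
           x = (\<Oplus>\<^bsub>M\<^esub>a\<in>{a \<in> Zn n. f a \<noteq> \<zero>\<^bsub>M\<^esub>}. f a)"
    and gr_mult: "\<lbrakk>a \<in> Zn n; m \<in> gr a; Poly_Mapping.keys u \<subseteq> {1..n}\<rbrakk> \<Longrightarrow>
      Poly_Mapping.single u 1 \<odot>\<^bsub>M\<^esub> m \<in> gr (\<lambda>i. a i + int (Poly_Mapping.lookup u i))"


section \<open>Stanley decompositions and Stanley depth\<close>

definition stanley_space ::
    "('a::field mpoly, 'm, 'e) module_scheme \<Rightarrow> 'm \<Rightarrow> nat set \<Rightarrow> 'm set"
  where "stanley_space M m Z = (\<lambda>u. u \<odot>\<^bsub>M\<^esub> m) ` polys Z"

text \<open>
  \<open>D\<close> lists the pairs \<open>(m\<^sub>i, Z\<^sub>i)\<close>. The \<open>K[Z]\<close>-module \<open>m K[Z]\<close> is free (on \<open>m\<close>) iff \<open>u \<mapsto> u m\<close> is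
  injective on \<open>K[Z]\<close>; in particular \<open>m \<noteq> 0\<close>. Since each \<open>m\<^sub>i\<close> is homogeneous, each \<open>m\<^sub>i K[Z\<^sub>i]\<close> is a
  graded subspace, so that a direct sum decomposition of \<open>M\<close> into these subspaces is automatically
  one of graded vector spaces.
\<close>
definition stanley_decomposition ::
    "nat \<Rightarrow> ('a::field mpoly, 'm, 'e) module_scheme \<Rightarrow> ((nat \<Rightarrow> int) \<Rightarrow> 'm set) \<Rightarrow>
     ('m \<times> nat set) list \<Rightarrow> bool"
  where "stanley_decomposition n M gr D \<longleftrightarrow>
    (\<forall>(m, Z) \<in> set D.
       (\<exists>a \<in> Zn n. m \<in> gr a) \<and> Z \<subseteq> {1..n} \<and> inj_on (\<lambda>u. u \<odot>\<^bsub>M\<^esub> m) (polys Z)) \<and>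
    (\<forall>x \<in> carrier M.
       \<exists>!y. y \<in> (\<Pi>\<^sub>E i\<in>{..<length D}. stanley_space M (fst (D ! i)) (snd (D ! i))) \<and>
            x = (\<Oplus>\<^bsub>M\<^esub>i\<in>{..<length D}. y i))"

definition sdepth_decomposition :: "('m \<times> nat set) list \<Rightarrow> nat"
  where "sdepth_decomposition D = Min ((\<lambda>(m, Z). card Z) ` set D)"

text \<open>
  Only meant for \<open>M \<noteq> 0\<close>: then \<open>D\<close> is never empty, so the values are at most \<open>n\<close>. The value is
  meaningful only if \<open>M\<close> has a Stanley decomposition; if there is none, \<open>Max {}\<close> is unspecified.
\<close>
definition sdepth ::
    "nat \<Rightarrow> ('a::field mpoly, 'm, 'e) module_scheme \<Rightarrow> ((nat \<Rightarrow> int) \<Rightarrow> 'm set) \<Rightarrow> nat"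
  where "sdepth n M gr = Max (sdepth_decomposition ` {D. stanley_decomposition n M gr D})"


section \<open>Depth\<close>

text \<open>\<open>(f\<^sub>1, \<dots>, f\<^sub>k) M = f\<^sub>1 M + \<dots> + f\<^sub>k M\<close>\<close>
definition seq_smult :: "('r, 'm, 'e) module_scheme \<Rightarrow> 'r list \<Rightarrow> 'm set"
  where "seq_smult M fs =
    {\<Oplus>\<^bsub>M\<^esub>i\<in>{..<length fs}. fs ! i \<odot>\<^bsub>M\<^esub> y i | y. y \<in> {..<length fs} \<rightarrow> carrier M}"

text \<open>
  \<open>f\<^sub>i\<close> is a non-zero-divisor on \<open>M / (f\<^sub>1, \<dots>, f\<^sub>i\<^sub>-\<^sub>1) M\<close> for every \<open>i\<close>, and \<open>M / (f\<^sub>1, \<dots>, f\<^sub>k) M \<noteq> 0\<close>.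
\<close>
definition regular_sequence ::
    "('r, 's) ring_scheme \<Rightarrow> ('r, 'm, 'e) module_scheme \<Rightarrow> 'r list \<Rightarrow> bool"
  where "regular_sequence R M fs \<longleftrightarrow>
    set fs \<subseteq> carrier R \<and>
    (\<forall>i < length fs. \<forall>x \<in> carrier M.
       fs ! i \<odot>\<^bsub>M\<^esub> x \<in> seq_smult M (take i fs) \<longrightarrow> x \<in> seq_smult M (take i fs)) \<and>
    seq_smult M fs \<noteq> carrier M"

text \<open>
  The supremum of the lengths of the regular sequences in \<open>P\<close>, taken in \<^typ>\<open>enat\<close> so that no
  boundedness is presupposed. Only meant for \<open>M \<noteq> 0\<close>.
\<close>
definition module_depth ::
    "('r, 's) ring_scheme \<Rightarrow> 'r set \<Rightarrow> ('r, 'm, 'e) module_scheme \<Rightarrow> enat"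
  where "module_depth R P M =
    (SUP fs \<in> {fs. set fs \<subseteq> P \<and> regular_sequence R M fs}. enat (length fs))"


section \<open>Ideals as \<open>\<int>\<^sup>n\<close>-graded modules\<close>

definition self_module :: "('r, 's) ring_scheme \<Rightarrow> ('r, 'r) module"
  where "self_module R =
    \<lparr>carrier = carrier R, mult = mult R, one = one R, zero = zero R, add = add R, smult = mult R\<rparr>"

definition ideal_module :: "nat \<Rightarrow> 'a::field mpoly set \<Rightarrow> ('a mpoly, 'a mpoly) module"
  where "ideal_module n I = (self_module (poly_ring n))\<lparr>carrier := I\<rparr>"

text \<open>The elements of \<open>I\<close> of degree \<open>a\<close>, i.e. those of the form \<open>c x\<^sup>a\<close>.\<close>
definition ideal_grading :: "'a::field mpoly set \<Rightarrow> (nat \<Rightarrow> int) \<Rightarrow> 'a mpoly set"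
  where "ideal_grading I a =
    {p \<in> I. \<forall>u \<in> Poly_Mapping.keys p. \<forall>i. int (Poly_Mapping.lookup u i) = a i}"

definition ideal_sdepth :: "nat \<Rightarrow> 'a::field mpoly set \<Rightarrow> nat"
  where "ideal_sdepth n I = sdepth n (ideal_module n I) (ideal_grading I)"

definition ideal_depth :: "nat \<Rightarrow> 'a::field mpoly set \<Rightarrow> enat"
  where "ideal_depth n I = module_depth (poly_ring n) (max_ideal n) (ideal_module n I)"


section \<open>Edge ideals of paths and cycles\<close>

definition path_ideal :: "nat \<Rightarrow> 'a::field mpoly set"
  where "path_ideal n = Idl\<^bsub>poly_ring n\<^esub> {var i * var (i + 1) | i. i \<in> {1..<n}}"

definition cycle_ideal :: "nat \<Rightarrow> 'a::field mpoly set"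
  where "cycle_ideal n = path_ideal n <+>\<^bsub>poly_ring n\<^esub> Idl\<^bsub>poly_ring n\<^esub> {var n * var 1}"


section \<open>Well-formedness\<close>

lemma polys_mult:
  assumes "p \<in> polys Z" "q \<in> polys Z" shows "p * q \<in> polys Z"
proof -
  have "Poly_Mapping.keys u \<subseteq> Z" if u: "u \<in> Poly_Mapping.keys (p * q)" for u
  proof -
    obtain a b where ab: "u = a + b" "a \<in> Poly_Mapping.keys p" "b \<in> Poly_Mapping.keys q"
      using u keys_mult[of p q] by blast
    then show ?thesis using assms keys_add[of a b] unfolding polys_def by blast
  qed
  then show ?thesis by (simp add: polys_def)
qed

lemma polys_add: "p \<in> polys Z \<Longrightarrow> q \<in> polys Z \<Longrightarrow> p + q \<in> polys Z"
  unfolding polys_def using keys_add[of p q] by blast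

lemma polys_uminus: "p \<in> polys Z \<Longrightarrow> - p \<in> polys Z"
  unfolding polys_def by (simp add: in_keys_iff)

lemma polys_0 [simp]: "0 \<in> polys Z" and polys_1 [simp]: "1 \<in> polys Z"
  by (auto simp: polys_def)

lemma poly_ring_simps [simp]:
  "carrier (poly_ring n) = polys {1..n}" "mult (poly_ring n) = (*)" "one (poly_ring n) = 1"
  "zero (poly_ring n) = 0" "add (poly_ring n) = (+)"
  by (simp_all add: poly_ring_def)

lemma cring_poly_ring: "cring (poly_ring n)"
proof (rule cringI)
  show "abelian_group (poly_ring n :: 'a mpoly ring)"
    by (rule abelian_groupI)
       (auto intro: polys_add simp: algebra_simps intro!: bexI[OF _ polys_uminus])
  show "comm_monoid (poly_ring n :: 'a mpoly ring)"
    by (rule comm_monoidI) (auto intro: polys_mult simp: algebra_simps)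
qed (auto simp: algebra_simps)

lemma ideal_module_simps [simp]:
  "carrier (ideal_module n I) = I" "zero (ideal_module n I) = 0"
  "add (ideal_module n I) = (+)" "smult (ideal_module n I) = (*)"
  by (simp_all add: ideal_module_def self_module_def)

lemma ideal_closed:
  assumes "ideal I (poly_ring n)"
  shows "I \<subseteq> polys {1..n}" "0 \<in> I" "p \<in> I \<Longrightarrow> q \<in> I \<Longrightarrow> p + q \<in> I" "p \<in> I \<Longrightarrow> - p \<in> I"
    "r \<in> polys {1..n} \<Longrightarrow> p \<in> I \<Longrightarrow> r * p \<in> I"
proof -
  interpret ideal I "poly_ring n" by fact
  show sub: "I \<subseteq> polys {1..n}" using a_subset by simp
  show "0 \<in> I" using additive_subgroup.zero_closed[OF is_additive_subgroup] by simp
  show "p \<in> I \<Longrightarrow> q \<in> I \<Longrightarrow> p + q \<in> I" for p q using additive_subgroup.a_closed[OF is_additive_subgroup, of p q] by simp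
  show mul: "r \<in> polys {1..n} \<Longrightarrow> p \<in> I \<Longrightarrow> r * p \<in> I" for r p using I_l_closed[of p r] by simp
  have "(- 1) * p \<in> I" if "p \<in> I" using that by (intro mul polys_uminus) auto
  then show "p \<in> I \<Longrightarrow> - p \<in> I" by simp
qed

lemma module_ideal_module:
  assumes I: "ideal I (poly_ring n)"
  shows "module (poly_ring n) (ideal_module n I)"
proof (rule moduleI)
  show "cring (poly_ring n)" by (rule cring_poly_ring)
  show "abelian_group (ideal_module n I)"
    by (rule abelian_groupI)
       (use ideal_closed[OF I] in \<open>auto simp: algebra_simps intro!: bexI[of _ "- x" for x]\<close>)
qed (use ideal_closed[OF I] in \<open>auto simp: algebra_simps\<close>)

lemma finsum_ideal_module:
  assumes I: "ideal I (poly_ring n)" and f: "f \<in> A \<rightarrow> I"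
  shows "(\<Oplus>\<^bsub>ideal_module n I\<^esub>i\<in>A. f i) = sum f A"
proof -
  interpret module "poly_ring n" "ideal_module n I" by (rule module_ideal_module[OF I])
  show ?thesis using f
    by (induction A rule: infinite_finite_induct) (auto simp: finsum_infinite Pi_iff)
qed

definition monomial_ideal :: "nat \<Rightarrow> 'a::field mpoly set \<Rightarrow> bool"
  where "monomial_ideal n I \<longleftrightarrow> ideal I (poly_ring n) \<and>
    (\<forall>p \<in> I. \<forall>u. Poly_Mapping.single u (Poly_Mapping.lookup p u) \<in> I)"

lemma mpoly_eq_sum:
  "p = (\<Sum>u\<in>Poly_Mapping.keys p. Poly_Mapping.single u (Poly_Mapping.lookup p u))"
  by (rule poly_mapping_eqI)
     (auto simp: lookup_sum lookup_single when_def in_keys_iff sum.delta')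

lemma Zn_graded_module_ideal_module:
  fixes I :: "'a::field mpoly set"
  assumes mon: "monomial_ideal n I"
  shows "Zn_graded_module n (ideal_module n I) (ideal_grading I)"
proof -
  have I: "ideal I (poly_ring n)" using mon by (simp add: monomial_ideal_def)
  note cl = ideal_closed[OF I]
  interpret module "poly_ring n" "ideal_module n I" by (rule module_ideal_module[OF I])
  show ?thesis
  proof (intro Zn_graded_module.intro Zn_graded_module_axioms.intro)
    show "module (poly_ring n) (ideal_module n I)" by (rule module_ideal_module[OF I])
  next
    fix a assume a: "a \<in> Zn n"
    have gr0: "0 \<in> ideal_grading I a" by (simp add: ideal_grading_def cl)
    have gr_add: "p + q \<in> ideal_grading I a"
      if "p \<in> ideal_grading I a" "q \<in> ideal_grading I a" for p q
      using that keys_add[of p q] unfolding ideal_grading_def by (auto simp: cl)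
    have gr_neg: "- p \<in> ideal_grading I a" if "p \<in> ideal_grading I a" for p
      using that unfolding ideal_grading_def by (auto simp: cl in_keys_iff)
    show "subgroup (ideal_grading I a) (add_monoid (ideal_module n I))"
    proof (rule subgroup.intro)
      show "ideal_grading I a \<subseteq> carrier (add_monoid (ideal_module n I))"
        by (auto simp: ideal_grading_def)
      fix p assume p: "p \<in> ideal_grading I a"
      have "p \<in> I" using p by (simp add: ideal_grading_def)
      then have "\<ominus>\<^bsub>ideal_module n I\<^esub> p = - p"
        by (intro M.minus_equality) (auto simp: cl)
      then show "inv\<^bsub>add_monoid (ideal_module n I)\<^esub> p \<in> ideal_grading I a"
        using gr_neg[OF p] by (simp add: a_inv_def)
    qed (auto simp: gr0 gr_add)
    {
      fix m :: "'a mpoly" and u :: "nat \<Rightarrow>\<^sub>0 nat" and c :: 'a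
      assume m: "m \<in> ideal_grading I a" and u: "Poly_Mapping.keys u \<subseteq> {1..n}"
      have "Poly_Mapping.single u c \<in> polys {1..n}"
        using u by (auto simp: polys_def)
      then have "Poly_Mapping.single u c * m \<in> I"
        using m cl by (auto simp: ideal_grading_def)
      moreover have "int (Poly_Mapping.lookup v i) = a i + int (Poly_Mapping.lookup u i)"
        if v: "v \<in> Poly_Mapping.keys (Poly_Mapping.single u c * m)" for v i
      proof -
        obtain w where "v = u + w" "w \<in> Poly_Mapping.keys m"
          using v keys_mult[of "Poly_Mapping.single u c" m]
          by (auto split: if_splits)
        then show ?thesis using m by (auto simp: ideal_grading_def lookup_add)
      qed
      ultimately have "Poly_Mapping.single u c * m
          \<in> ideal_grading I (\<lambda>i. a i + int (Poly_Mapping.lookup u i))"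
        by (simp add: ideal_grading_def)
    } note gr_single = this
    show "Poly_Mapping.single 0 c \<odot>\<^bsub>ideal_module n I\<^esub> m \<in> ideal_grading I a"
      if "m \<in> ideal_grading I a" for m c
      using gr_single[OF that, of 0 c] by simp
    show "Poly_Mapping.single u 1 \<odot>\<^bsub>ideal_module n I\<^esub> m
        \<in> ideal_grading I (\<lambda>i. a i + int (Poly_Mapping.lookup u i))"
      if "m \<in> ideal_grading I a" "Poly_Mapping.keys u \<subseteq> {1..n}" for m u
      using gr_single[OF that, of 1] by simp
  next
    fix x assume "x \<in> carrier (ideal_module n I)"
    then have x: "x \<in> I" by simp
    define deg where "deg = (\<lambda>(u :: nat \<Rightarrow>\<^sub>0 nat) i. int (Poly_Mapping.lookup u i))"
    have inj: "inj deg"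
      by (rule injI) (auto simp: deg_def fun_eq_iff intro!: poly_mapping_eqI)
    have key: "Poly_Mapping.lookup (sum f {a \<in> Zn n. f a \<noteq> 0}) u =
        (if deg u \<in> Zn n then Poly_Mapping.lookup (f (deg u)) u else 0)"
      if f: "f \<in> (\<Pi>\<^sub>E a\<in>Zn n. ideal_grading I a)" and fin: "finite {a \<in> Zn n. f a \<noteq> 0}" for f u
    proof -
      have z: "Poly_Mapping.lookup (f a) u = (if a = deg u then Poly_Mapping.lookup (f (deg u)) u else 0)"
        if "a \<in> Zn n" for a
      proof (cases "a = deg u")
        case False
        have "f a \<in> ideal_grading I a" using f that by auto
        then have "u \<notin> Poly_Mapping.keys (f a)" using False
          by (auto simp: ideal_grading_def deg_def fun_eq_iff)
        then show ?thesis using False by (simp add: in_keys_iff)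
      qed simp
      have "Poly_Mapping.lookup (sum f {a \<in> Zn n. f a \<noteq> 0}) u =
          (\<Sum>a\<in>{a \<in> Zn n. f a \<noteq> 0}. if a = deg u then Poly_Mapping.lookup (f (deg u)) u else 0)"
        unfolding lookup_sum by (intro sum.cong refl z) simp
      also have "\<dots> = (if deg u \<in> Zn n then Poly_Mapping.lookup (f (deg u)) u else 0)"
        using fin by (auto simp: sum.delta)
      finally show ?thesis .
    qed
    have gr: "finsum (ideal_module n I) f A = sum f A"
      if f: "f \<in> (\<Pi>\<^sub>E a\<in>Zn n. ideal_grading I a)" and A: "A \<subseteq> Zn n" for f A
    proof -
      have "f \<in> A \<rightarrow> I"
      proof
        fix a assume "a \<in> A"
        then have "f a \<in> ideal_grading I a" using A f by auto
        then show "f a \<in> I" by (simp add: ideal_grading_def)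
      qed
      then show ?thesis by (rule finsum_ideal_module[OF I])
    qed
    have degZ: "deg u \<in> Zn n" if "u \<in> Poly_Mapping.keys x" for u
    proof -
      have "Poly_Mapping.keys u \<subseteq> {1..n}" using x cl(1) that by (auto simp: polys_def)
      then show ?thesis by (auto simp: Zn_def deg_def in_keys_iff)
    qed
    show "\<exists>!f. f \<in> (\<Pi>\<^sub>E a\<in>Zn n. ideal_grading I a) \<and>
        finite {a \<in> Zn n. f a \<noteq> \<zero>\<^bsub>ideal_module n I\<^esub>} \<and>
        x = (\<Oplus>\<^bsub>ideal_module n I\<^esub>a\<in>{a \<in> Zn n. f a \<noteq> \<zero>\<^bsub>ideal_module n I\<^esub>}. f a)"
    proof (rule ex1I)
      define f where "f = (\<lambda>a\<in>Zn n. if a \<in> range deg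
        then Poly_Mapping.single (inv_into UNIV deg a) (Poly_Mapping.lookup x (inv_into UNIV deg a)) else 0)"
      have fin: "f \<in> (\<Pi>\<^sub>E a\<in>Zn n. ideal_grading I a)"
      proof (rule PiE_I)
        fix a assume a: "a \<in> Zn n"
        show "f a \<in> ideal_grading I a"
        proof (cases "a \<in> range deg")
          case True
          then obtain u where u: "a = deg u" by auto
          then have "f a = Poly_Mapping.single u (Poly_Mapping.lookup x u)"
            using a inj by (simp add: f_def)
          then show ?thesis using mon x u
            by (auto simp: ideal_grading_def monomial_ideal_def deg_def)
        qed (use a in \<open>auto simp: f_def ideal_grading_def cl\<close>)
      qed (auto simp: f_def)
      have "{a \<in> Zn n. f a \<noteq> 0} \<subseteq> deg ` Poly_Mapping.keys x"
        using inj by (auto simp: f_def in_keys_iff split: if_splits intro!: imageI)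
      then have finf: "finite {a \<in> Zn n. f a \<noteq> 0}" by (rule finite_subset) simp
      have "x = sum f {a \<in> Zn n. f a \<noteq> 0}"
      proof (rule poly_mapping_eqI)
        fix u
        show "Poly_Mapping.lookup x u = Poly_Mapping.lookup (sum f {a \<in> Zn n. f a \<noteq> 0}) u"
          unfolding key[OF fin finf] using degZ[of u] inj
          by (auto simp: f_def in_keys_iff)
      qed
      then show "f \<in> (\<Pi>\<^sub>E a\<in>Zn n. ideal_grading I a) \<and>
          finite {a \<in> Zn n. f a \<noteq> \<zero>\<^bsub>ideal_module n I\<^esub>} \<and>
          x = (\<Oplus>\<^bsub>ideal_module n I\<^esub>a\<in>{a \<in> Zn n. f a \<noteq> \<zero>\<^bsub>ideal_module n I\<^esub>}. f a)"
        using fin finf by (simp add: gr)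
      fix g assume "g \<in> (\<Pi>\<^sub>E a\<in>Zn n. ideal_grading I a) \<and>
          finite {a \<in> Zn n. g a \<noteq> \<zero>\<^bsub>ideal_module n I\<^esub>} \<and>
          x = (\<Oplus>\<^bsub>ideal_module n I\<^esub>a\<in>{a \<in> Zn n. g a \<noteq> \<zero>\<^bsub>ideal_module n I\<^esub>}. g a)"
      then have g: "g \<in> (\<Pi>\<^sub>E a\<in>Zn n. ideal_grading I a)" "finite {a \<in> Zn n. g a \<noteq> 0}"
        "x = sum g {a \<in> Zn n. g a \<noteq> 0}"
        by (simp_all add: gr)
      have "g a = f a" if a: "a \<in> Zn n" for a
      proof (rule poly_mapping_eqI)
        fix u
        show "Poly_Mapping.lookup (g a) u = Poly_Mapping.lookup (f a) u"
        proof (cases "a = deg u")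
          case True
          have "Poly_Mapping.lookup x u = Poly_Mapping.lookup (g a) u"
            using a True by (subst g(3)) (simp add: key[OF g(1,2)])
          then show ?thesis using a True inj by (simp add: f_def)
        next
          case False
          have "g a \<in> ideal_grading I a" "f a \<in> ideal_grading I a" using g(1) fin a by auto
          then have "u \<notin> Poly_Mapping.keys (g a)" "u \<notin> Poly_Mapping.keys (f a)"
            using False by (auto simp: ideal_grading_def deg_def fun_eq_iff)
          then show ?thesis by (simp add: in_keys_iff)
        qed
      qed
      then show "g = f" using g(1) fin by (intro PiE_ext) auto
    qed
  qed
qed

lemma single_mult_coeff:
  "Poly_Mapping.single u (Poly_Mapping.lookup (r * p) u) =
    (\<Sum>v\<in>Poly_Mapping.keys r. \<Sum>w\<in>Poly_Mapping.keys p.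
      if v + w = u then Poly_Mapping.single v (Poly_Mapping.lookup r v) *
        Poly_Mapping.single w (Poly_Mapping.lookup p w) else 0)"
  for r p :: "'a::field mpoly"
proof -
  have "r * p = (\<Sum>v\<in>Poly_Mapping.keys r. \<Sum>w\<in>Poly_Mapping.keys p.
      Poly_Mapping.single v (Poly_Mapping.lookup r v) *
        Poly_Mapping.single w (Poly_Mapping.lookup p w))"
    by (subst (1) mpoly_eq_sum[of r], subst (1) mpoly_eq_sum[of p]) (simp add: sum_product)
  then show ?thesis
    by (intro poly_mapping_eqI)
       (auto simp: lookup_sum lookup_single mult_single when_def intro!: sum.cong sum.neutral)
qed

lemma monomial_ideal_genideal:
  fixes G :: "'a::field mpoly set"
  assumes G: "G \<subseteq> polys {1..n}" and mono: "\<And>g. g \<in> G \<Longrightarrow> \<exists>v c. g = Poly_Mapping.single v c"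
  shows "monomial_ideal n (Idl\<^bsub>poly_ring n\<^esub> G)"
proof -
  interpret cring "poly_ring n" by (rule cring_poly_ring)
  let ?I = "Idl\<^bsub>poly_ring n\<^esub> G"
  have I: "ideal ?I (poly_ring n)" using G by (intro genideal_ideal) simp
  note cl = ideal_closed[OF I]
  define J where "J = {p \<in> ?I. \<forall>u. Poly_Mapping.single u (Poly_Mapping.lookup p u) \<in> ?I}"
  have sum_in: "sum f A \<in> ?I" if "\<And>i. i \<in> A \<Longrightarrow> f i \<in> ?I" for f and A :: "(nat \<Rightarrow>\<^sub>0 nat) set"
    using that by (induction A rule: infinite_finite_induct) (auto simp: cl)
  have mulJ: "r * p \<in> J" if r: "r \<in> polys {1..n}" and p: "p \<in> J" for r p
  proof -
    have "Poly_Mapping.single u (Poly_Mapping.lookup (r * p) u) \<in> ?I" for u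
      unfolding single_mult_coeff
    proof (intro sum_in)
      fix v w assume "v \<in> Poly_Mapping.keys r" "w \<in> Poly_Mapping.keys p"
      then have "Poly_Mapping.single v (Poly_Mapping.lookup r v) \<in> polys {1..n}"
        using r by (auto simp: polys_def)
      then have "Poly_Mapping.single v (Poly_Mapping.lookup r v) *
          Poly_Mapping.single w (Poly_Mapping.lookup p w) \<in> ?I"
        using p by (intro cl) (auto simp: J_def)
      then show "(if v + w = u then Poly_Mapping.single v (Poly_Mapping.lookup r v) *
          Poly_Mapping.single w (Poly_Mapping.lookup p w) else 0) \<in> ?I"
        by (simp add: cl)
    qed
    then show ?thesis using r p cl by (auto simp: J_def)
  qed
  have J0: "0 \<in> J" by (simp add: J_def cl)
  have Jadd: "p + q \<in> J" if "p \<in> J" "q \<in> J" for p q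
    using that by (auto simp: J_def cl lookup_add single_add)
  have Jneg: "- p \<in> J" if "p \<in> J" for p
    using that by (auto simp: J_def cl single_uminus)
  have "ideal J (poly_ring n)"
  proof (rule idealI)
    show "ring (poly_ring n :: 'a mpoly ring)" by (rule ring_axioms)
    show "subgroup J (add_monoid (poly_ring n))"
    proof (rule subgroup.intro)
      show "J \<subseteq> carrier (add_monoid (poly_ring n))" using cl(1) by (auto simp: J_def)
      fix p assume p: "p \<in> J"
      have "\<ominus>\<^bsub>poly_ring n\<^esub> p = - p"
        using p cl(1) by (intro minus_equality) (auto simp: J_def intro: polys_uminus)
      then show "inv\<^bsub>add_monoid (poly_ring n)\<^esub> p \<in> J"
        using Jneg[OF p] by (simp add: a_inv_def)
    qed (auto simp: J0 Jadd)
  next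
    fix p r :: "'a mpoly" assume "p \<in> J" "r \<in> carrier (poly_ring n)"
    then show "r \<otimes>\<^bsub>poly_ring n\<^esub> p \<in> J" "p \<otimes>\<^bsub>poly_ring n\<^esub> r \<in> J"
      using mulJ[of r p] by (simp_all add: mult.commute)
  qed
  moreover have "G \<subseteq> J"
  proof
    fix g assume g: "g \<in> G"
    have gI: "g \<in> ?I" using genideal_self[of G] G g by auto
    obtain v c where "g = Poly_Mapping.single v c" using mono g by blast
    then show "g \<in> J" using gI by (auto simp: J_def lookup_single when_def cl)
  qed
  ultimately have "?I \<subseteq> J" by (rule genideal_minimal)
  then show ?thesis using I by (auto simp: monomial_ideal_def J_def)
qed

lemma var_in_polys: "i \<in> Z \<Longrightarrow> var i \<in> polys Z"
  by (auto simp: var_def polys_def)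

lemma monomial_path_ideal: "monomial_ideal n (path_ideal n)"
  unfolding path_ideal_def
proof (rule monomial_ideal_genideal)
  fix g :: "'a mpoly" assume "g \<in> {var i * var (i + 1) | i. i \<in> {1..<n}}"
  then show "\<exists>v c. g = Poly_Mapping.single v c" by (auto simp: var_def mult_single)
qed (auto intro!: polys_mult var_in_polys)

lemma monomial_cycle_ideal:
  assumes "n \<ge> 1" shows "monomial_ideal n (cycle_ideal n :: 'a::field mpoly set)"
proof -
  interpret cring "poly_ring n" by (rule cring_poly_ring)
  let ?E = "Idl\<^bsub>poly_ring n\<^esub> {var n * var 1} :: 'a mpoly set"
  have E: "monomial_ideal n ?E"
  proof (rule monomial_ideal_genideal)
    show "{var n * var 1} \<subseteq> (polys {1..n} :: 'a mpoly set)"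
      using assms by (auto intro!: polys_mult var_in_polys)
  qed (auto simp: var_def mult_single)
  have P: "monomial_ideal n (path_ideal n :: 'a mpoly set)" by (rule monomial_path_ideal)
  have "ideal (cycle_ideal n :: 'a mpoly set) (poly_ring n)"
    unfolding cycle_ideal_def using E P by (intro add_ideals) (auto simp: monomial_ideal_def)
  moreover have "Poly_Mapping.single u (Poly_Mapping.lookup p u) \<in> cycle_ideal n"
    if p: "p \<in> cycle_ideal n" for p :: "'a mpoly" and u
  proof -
    obtain a b where "p = a + b" "a \<in> path_ideal n" "b \<in> ?E"
      using p by (auto simp: cycle_ideal_def set_add_def')
    then have "Poly_Mapping.single u (Poly_Mapping.lookup p u) =
        Poly_Mapping.single u (Poly_Mapping.lookup a u) + Poly_Mapping.single u (Poly_Mapping.lookup b u)"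
      "Poly_Mapping.single u (Poly_Mapping.lookup a u) \<in> path_ideal n"
      "Poly_Mapping.single u (Poly_Mapping.lookup b u) \<in> ?E"
      using E P unfolding monomial_ideal_def by (auto simp: lookup_add single_add)
    then show ?thesis unfolding cycle_ideal_def set_add_def' poly_ring_simps by blast
  qed
  ultimately show ?thesis by (simp add: monomial_ideal_def)
qed

theorem path_ideal_graded:
  "Zn_graded_module n (ideal_module n (path_ideal n)) (ideal_grading (path_ideal n))"
  by (intro Zn_graded_module_ideal_module monomial_path_ideal)

theorem cycle_ideal_graded:
  "n \<ge> 1 \<Longrightarrow> Zn_graded_module n (ideal_module n (cycle_ideal n)) (ideal_grading (cycle_ideal n))"
  by (intro Zn_graded_module_ideal_module monomial_cycle_ideal)

end

theory Submission
  imports Defs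
begin

text \<open>
  A partition into intervals \<open>[C, D]\<close>, all with \<open>card D \<ge> t\<close>, of the family of supports of the monomials
  in a squarefree monomial ideal gives the Stanley decomposition into the spaces \<open>x\<^sup>C K[D]\<close>, so the
  Stanley depth is at least \<open>t\<close>. For edge ideals of paths such partitions arise by deciding on
  membership of the second vertex \<open>y\<close> of the path: if \<open>y\<close> is absent, its first neighbour is free; if \<open>y\<close>
  is present, its two neighbours become generators. For a cycle, one decides on one vertex first. This leads to the partition problem for the
  nonempty subsets of a set of even size \<open>2 t\<close>, which is solved with tops of size at least \<open>t\<close>.

  The depth is bounded by \<open>card A + 1\<close> for a maximal independent set \<open>A\<close>, that is, by \<open>1 + dim S/P\<close> for
  an associated prime \<open>P\<close> of \<open>S/I\<close>. Taking every third vertex gives \<open>\<lceil>n/3\<rceil> + 1\<close>, which is at most the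
  bound on the Stanley depth, except for the cycle of length \<open>4\<close>, where the Stanley depth is at least \<open>3\<close>.
\<close>

section \<open>Interval partitions\<close>

text \<open>Depth is a supremum over all regular sequences in the maximal ideal, whose members need
  not be homogeneous, and regularity is on \<open>I\<close> itself rather than on S/I. This shapes
  the depth bound. Modulo the variables outside \<open>A\<close>, any card A + 1 polynomials are
  algebraically dependent, and a relation p among members of the sequence gives p x^A in
  \<open>I\<close>. Since x^A itself is not an element of \<open>I\<close>, regularity on
  \<open>I\<close> cannot be applied to it directly. With card A + 2 members, each member can be
  left out in turn. This yields relations p_j whose leading power products have no variable in
  common. The elements a_j = p_j x^A of \<open>I\<close> satisfy p_i a_j = p_j a_i, and regularity
  turns such a proportional family into multiples of the p_j by a single q in \<open>I\<close>, up
  to any prescribed order. Then x^A - q has high order, although q has no monomial x^A. Making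
  "leading" and "order" precise for power products of arbitrary polynomials requires
  quasi-regularity and a filtration whose pieces are generated by one power product each.\<close>

inductive partitionable :: "nat \<Rightarrow> 'a set set \<Rightarrow> bool" for t where
  partitionable_empty: "partitionable t {}"
| partitionable_interval: "\<lbrakk>C \<subseteq> D; finite D; t \<le> card D; {C..D} \<inter> F = {}; partitionable t F\<rbrakk> \<Longrightarrow> partitionable t ({C..D} \<union> F)"

lemma partitionable_Icc:
  assumes "C \<subseteq> D" "finite D" "t \<le> card D"
  shows "partitionable t {C..D}"
  using partitionable_interval[OF assms _ partitionable_empty] by simp

lemma partitionable_Un:
  assumes "partitionable t F" "partitionable t G" "F \<inter> G = {}"
  shows "partitionable t (F \<union> G)"
  using assms
proof (induction F)
  case (partitionable_interval C D F)
  have "partitionable t ({C..D} \<union> (F \<union> G))"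
    using partitionable_interval by (intro partitionable.partitionable_interval) auto
  then show ?case by (simp add: Un_assoc)
qed simp

lemma partitionable_mono: "partitionable t F \<Longrightarrow> s \<le> t \<Longrightarrow> partitionable s F"
  by (induction rule: partitionable.induct) (auto intro: partitionable.intros)

text \<open>Inserting \<open>v\<close> into both ends of each interval raises every top by one
  element and keeps the intervals disjoint.\<close>

lemma partitionable_insert:
  assumes "partitionable t F" "\<And>A. A \<in> F \<Longrightarrow> v \<notin> A"
  shows "partitionable (Suc t) {A. v \<in> A \<and> A - {v} \<in> F}"
  using assms
proof (induction F)
  case (partitionable_interval C D F)
  have v: "v \<notin> C" "v \<notin> D" using partitionable_interval.hyps(1) partitionable_interval.prems[of D] by auto
  have "partitionable (Suc t) ({insert v C..insert v D} \<union> {A. v \<in> A \<and> A - {v} \<in> F})"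
  proof (rule partitionable.partitionable_interval)
    have "A - {v} \<in> {C..D}" if "A \<in> {insert v C..insert v D}" for A using that v by auto
    then show "{insert v C..insert v D} \<inter> {A. v \<in> A \<and> A - {v} \<in> F} = {}"
      using partitionable_interval.hyps(4) by blast
  qed (use partitionable_interval v in auto)
  moreover have "{A. v \<in> A \<and> A - {v} \<in> {C..D} \<union> F} =
      {insert v C..insert v D} \<union> {A. v \<in> A \<and> A - {v} \<in> F}"
    using v by auto
  ultimately show ?case by simp
qed (simp add: partitionable.partitionable_empty)

text \<open>Only the tops receive \<open>v\<close>: in terms of monomials, each Stanley space is
  multiplied by the free variable \<open>v\<close>.\<close>

lemma partitionable_free:
  assumes "partitionable t F" "\<And>A. A \<in> F \<Longrightarrow> v \<notin> A"
  shows "partitionable (Suc t) {A. A - {v} \<in> F}"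
  using assms
proof (induction F)
  case (partitionable_interval C D F)
  have v: "v \<notin> C" "v \<notin> D" using partitionable_interval.hyps(1) partitionable_interval.prems[of D] by auto
  have "partitionable (Suc t) ({C..insert v D} \<union> {A. A - {v} \<in> F})"
  proof (rule partitionable.partitionable_interval)
    have "A - {v} \<in> {C..D}" if "A \<in> {C..insert v D}" for A using that v by auto
    then show "{C..insert v D} \<inter> {A. A - {v} \<in> F} = {}"
      using partitionable_interval.hyps(4) by blast
  qed (use partitionable_interval v in auto)
  moreover have "{A. A - {v} \<in> {C..D} \<union> F} = {C..insert v D} \<union> {A. A - {v} \<in> F}"
    using v by auto
  ultimately show ?case by simp
qed (simp add: partitionable.partitionable_empty)

text \<open>The invariant of the induction on \<open>B\<close>: since both halves may be enlarged by the empty set, they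
  can be combined with two different new elements, which raises \<open>t\<close> by one.\<close>
definition splits :: "nat \<Rightarrow> 'a set \<Rightarrow> 'a set set \<Rightarrow> 'a set set \<Rightarrow> bool"
  where "splits t B P Q \<longleftrightarrow> P \<inter> Q = {} \<and> P \<union> Q = Pow B - {{}} \<and>
    partitionable t P \<and> partitionable t Q \<and> partitionable t (insert {} P) \<and> partitionable t (insert {} Q)"

text \<open>The sets containing \<open>a\<close> are shared out: those over \<open>P\<close> are
  absorbed by freeing \<open>a\<close> in the intervals of \<open>P\<close>, those over the
  complement of \<open>P\<close> get \<open>a\<close> inserted. Hence every top grows, although
  \<open>P\<close> itself is kept.\<close>

lemma partitionable_extend:
  assumes "partitionable t P" "partitionable t (Pow B - P)" "P \<subseteq> Pow B" "a \<notin> B"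
  shows "partitionable (Suc t) (P \<union> {A. a \<in> A \<and> A - {a} \<in> Pow B})"
proof -
  have "partitionable (Suc t) ({A. A - {a} \<in> P} \<union> {A. a \<in> A \<and> A - {a} \<in> Pow B - P})"
    using assms by (intro partitionable_Un partitionable_free partitionable_insert) auto
  moreover have "P \<union> {A. a \<in> A \<and> A - {a} \<in> Pow B} =
      {A. A - {a} \<in> P} \<union> {A. a \<in> A \<and> A - {a} \<in> Pow B - P}"
  proof (rule Set.set_eqI)
    fix A
    show "A \<in> P \<union> {A. a \<in> A \<and> A - {a} \<in> Pow B} \<longleftrightarrow>
        A \<in> {A. A - {a} \<in> P} \<union> {A. a \<in> A \<and> A - {a} \<in> Pow B - P}"
      using assms(3,4) by (cases "a \<in> A") auto
  qed
  ultimately show ?thesis by simp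
qed

lemma splits_step:
  assumes B: "finite B" "a \<notin> B" "b \<notin> B" "a \<noteq> b" and s: "splits t B P Q" and t: "t \<le> Suc (card B)"
  shows "splits (Suc t) (insert a (insert b B)) (P \<union> {A. a \<in> A \<and> A - {a} \<in> Pow B})
    ((Q \<union> {A. b \<in> A \<and> A - {b} \<in> Pow B}) \<union> {{a, b}..insert a (insert b B)})"
proof -
  have PQ: "P \<inter> Q = {}" "P \<union> Q = Pow B - {{}}" "partitionable t P" "partitionable t Q"
    "partitionable t (insert {} P)" "partitionable t (insert {} Q)" using s by (auto simp: splits_def)
  have sub: "P \<subseteq> Pow B - {{}}" "Q \<subseteq> Pow B - {{}}" using PQ by auto
  \<comment> \<open>The complement of each of the four families in \<open>Pow B\<close> is again one
    of the four, which is why the invariant speaks of the versions with the empty set.\<close>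
  have e: "Pow B - P = insert {} Q" "Pow B - insert {} P = Q" "Pow B - Q = insert {} P" "Pow B - insert {} Q = P"
    using PQ by auto
  let ?P = "{A. a \<in> A \<and> A - {a} \<in> Pow B}" and ?Q = "{A. b \<in> A \<and> A - {b} \<in> Pow B}"
    and ?T = "{{a, b}..insert a (insert b B)}"
  \<comment> \<open>The sets containing both new elements form one interval with a top of size card
    B + 2, whence the bound on \<open>t\<close>.\<close>
  have T: "partitionable (Suc t) ?T" using B t by (intro partitionable_Icc) auto
  have P: "partitionable (Suc t) (P \<union> ?P)" "partitionable (Suc t) (insert {} P \<union> ?P)"
    by (rule partitionable_extend; use e PQ sub B in force)+
  have Q: "partitionable (Suc t) (Q \<union> ?Q)" "partitionable (Suc t) (insert {} Q \<union> ?Q)"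
    by (rule partitionable_extend; use e PQ sub B in force)+
  have "A \<notin> insert {} Q \<union> ?Q" if "A \<in> ?T" for A using that B sub by auto
  then have "(Q \<union> ?Q) \<inter> ?T = {}" "(insert {} Q \<union> ?Q) \<inter> ?T = {}" by blast+
  then have "partitionable (Suc t) (Q \<union> ?Q \<union> ?T)" "partitionable (Suc t) (insert {} Q \<union> ?Q \<union> ?T)"
    by (simp_all only: partitionable_Un Q T)
  moreover have "(P \<union> ?P) \<inter> (Q \<union> ?Q \<union> ?T) = {}"
  proof -
    have "A \<notin> Q \<union> ?Q \<union> ?T" if "A \<in> P \<union> ?P" for A
      using that sub PQ(1) B by (cases "a \<in> A"; cases "b \<in> A") auto
    then show ?thesis by blast
  qed
  moreover have "(P \<union> ?P) \<union> (Q \<union> ?Q \<union> ?T) = Pow (insert a (insert b B)) - {{}}" (is "?L = ?R")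
  proof (rule Set.set_eqI)
    fix A
    have "A \<in> P \<union> Q \<longleftrightarrow> A \<in> Pow B - {{}}" using PQ(2) by blast
    then have "A \<in> ?L \<longleftrightarrow> A \<in> Pow B - {{}} \<or> A \<in> ?P \<or> A \<in> ?Q \<or> A \<in> ?T" by blast
    also have "\<dots> \<longleftrightarrow> A \<in> ?R"
      using B by (cases "a \<in> A"; cases "b \<in> A") (auto simp: subset_iff)
    finally show "A \<in> ?L \<longleftrightarrow> A \<in> ?R" .
  qed
  ultimately show ?thesis using P by (simp add: splits_def)
qed

lemma splits_exists:
  assumes "finite B" "card B = 2 * Suc t"
  shows "\<exists>P Q. splits (Suc t) B P Q"
  using assms
proof (induction t arbitrary: B)
  case 0
  then obtain a b where B: "B = {a, b}" "a \<noteq> b" by (auto simp: card_2_iff)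
  have "partitionable 0 {{}}" using partitionable_Icc[of "{}" "{}" 0] by simp
  then have "splits 0 {} {} {}" by (auto simp: splits_def partitionable_empty)
  from splits_step[OF _ _ _ B(2) this] B show ?case by auto
next
  case (Suc t)
  from Suc.prems obtain a B1 where a: "B = insert a B1" "a \<notin> B1" "card B1 = Suc (2 * Suc t)"
    using card_Suc_eq[of B "Suc (2 * Suc t)"] by auto
  then obtain b B2 where b: "B1 = insert b B2" "b \<notin> B2" "card B2 = 2 * Suc t"
    using card_Suc_eq[of B1 "2 * Suc t"] by auto
  have fin: "finite B2" using Suc.prems a b by auto
  obtain P Q where "splits (Suc t) B2 P Q" using Suc.IH[OF fin b(3)] by blast
  from splits_step[OF fin _ _ _ this, of a b] show ?case using a b by auto
qed

lemma partitionable_nonempty_subsets: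
  assumes "finite B" "even (card B)"
  shows "partitionable (card B div 2) (Pow B - {{}})"
proof (cases "card B = 0")
  case True
  then show ?thesis using assms by (simp add: partitionable_empty)
next
  case False
  then obtain t where t: "card B = 2 * Suc t" using assms(2) by (metis dvdE mult_eq_0_iff old.nat.exhaust)
  then obtain P Q where "splits (Suc t) B P Q" using splits_exists assms by blast
  then have "partitionable (Suc t) P" "partitionable (Suc t) Q" "P \<inter> Q = {}" "P \<union> Q = Pow B - {{}}"
    by (simp_all add: splits_def)
  then have "partitionable (Suc t) (Pow B - {{}})" using partitionable_Un by metis
  then show ?thesis using t by simp
qed

section \<open>Edge families of paths\<close>

fun has_edge :: "'a set \<Rightarrow> 'a list \<Rightarrow> bool" where
  "has_edge A (x # y # vs) \<longleftrightarrow> x \<in> A \<and> y \<in> A \<or> has_edge A (y # vs)"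
| "has_edge A _ \<longleftrightarrow> False"

text \<open>The supports of the monomials in the ideal generated by the edges of the path \<open>vs\<close> and by the
  variables in \<open>B\<close>.\<close>
definition path_family :: "'a list \<Rightarrow> 'a set \<Rightarrow> 'a set set"
  where "path_family vs B = {A. A \<subseteq> set vs \<union> B \<and> (A \<inter> B \<noteq> {} \<or> has_edge A vs)}"

lemma has_edge_cong: "A \<inter> set vs = A' \<inter> set vs \<Longrightarrow> has_edge A vs \<longleftrightarrow> has_edge A' vs"
  by (induction A vs rule: has_edge.induct) auto

lemma has_edge_Cons_notin: "z \<notin> A \<Longrightarrow> has_edge A (z # vs) \<longleftrightarrow> has_edge A vs"
  by (cases vs) auto

lemma path_family_split:
  assumes "distinct (x # y # z # vs)" "set (x # y # z # vs) \<inter> B = {}"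
  shows "path_family (x # y # z # vs) B = {A. A - {x} \<in> path_family (z # vs) B} \<union>
    {A. y \<in> A \<and> A - {y} \<in> path_family vs (insert x (insert z B))}" (is "?L = ?F \<union> ?G")
proof (rule Set.set_eqI)
  fix A
  show "A \<in> ?L \<longleftrightarrow> A \<in> ?F \<union> ?G"
  proof (cases "y \<in> A")
    case False
    have "has_edge (A - {x}) (z # vs) \<longleftrightarrow> has_edge A (z # vs)"
      using assms by (intro has_edge_cong) auto
    then show ?thesis using False assms by (auto simp: path_family_def)
  next
    case True
    have e: "has_edge (A - {y}) vs \<longleftrightarrow> has_edge A vs"
      using assms by (intro has_edge_cong) auto
    have "A \<notin> ?F" using True assms by (auto simp: path_family_def)
    \<comment> \<open>If \<open>z\<close> is in \<open>A\<close>, then A - {y} meets the new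
      generators and \<open>A\<close> contains the edge from \<open>y\<close> to \<open>z\<close>;
      otherwise dropping \<open>z\<close> from the path loses no edge.\<close>
    moreover have "A \<in> ?L \<longleftrightarrow> A \<in> ?G" using True assms has_edge_Cons_notin[of z A vs]
      by (cases "z \<in> A") (auto simp: path_family_def e)
    ultimately show ?thesis by blast
  qed
qed

lemma partitionable_path_family_step:
  assumes "distinct (x # y # z # vs)" "set (x # y # z # vs) \<inter> B = {}"
    "partitionable t (path_family (z # vs) B)" "partitionable t (path_family vs (insert x (insert z B)))"
  shows "partitionable (Suc t) (path_family (x # y # z # vs) B)"
proof -
  have "x \<notin> A" "y \<notin> A" if "A \<in> path_family (z # vs) B" for A
    using that assms(1,2) by (auto simp: path_family_def)
  moreover have "y \<notin> A" if "A \<in> path_family vs (insert x (insert z B))" for A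
    using that assms(1,2) by (auto simp: path_family_def)
  moreover have "{A. A - {x} \<in> path_family (z # vs) B} \<inter>
      {A. y \<in> A \<and> A - {y} \<in> path_family vs (insert x (insert z B))} = {}"
    using assms(1,2) by (auto simp: path_family_def)
  ultimately show ?thesis
    unfolding path_family_split[OF assms(1,2)] using assms(3,4)
    by (intro partitionable_Un partitionable_free partitionable_insert) auto
qed

lemma path_family_Nil: "path_family [] B = Pow B - {{}}"
  by (auto simp: path_family_def)

lemma path_family_single: "x \<notin> B \<Longrightarrow> path_family [x] B = {A. A - {x} \<in> Pow B - {{}}}"
  by (auto simp: path_family_def)

text \<open>The sets without \<open>x\<close> leave \<open>y\<close> free, those with
  \<open>x\<close> but without \<open>y\<close> come from inserting \<open>x\<close>, and those with
  both form one interval.\<close>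

lemma partitionable_path_family_double:
  assumes "x \<noteq> y" "x \<notin> B" "y \<notin> B" "finite B" "even (card B)"
  shows "partitionable (Suc (card B div 2)) (path_family [x, y] B)"
proof -
  let ?N = "Pow B - {{}}" and ?T = "{{x, y}..insert x (insert y B)}"
  let ?Y = "{A. A - {y} \<in> ?N}" and ?X = "{A. x \<in> A \<and> A - {x} \<in> ?N}"
  note N = partitionable_nonempty_subsets[OF assms(4,5)]
  have Y: "partitionable (Suc (card B div 2)) ?Y" using assms(3) by (intro partitionable_free N) auto
  have X: "partitionable (Suc (card B div 2)) ?X" using assms(2) by (intro partitionable_insert N) auto
  have T: "partitionable (Suc (card B div 2)) ?T" using assms by (intro partitionable_Icc) auto
  have "?Y \<inter> ?X = {}" "(?Y \<union> ?X) \<inter> ?T = {}" using assms(1-3) by auto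
  then have "partitionable (Suc (card B div 2)) (?Y \<union> ?X \<union> ?T)" by (simp only: partitionable_Un X Y T)
  moreover have "path_family [x, y] B = ?Y \<union> ?X \<union> ?T"
  proof (rule Set.set_eqI)
    fix A
    show "A \<in> path_family [x, y] B \<longleftrightarrow> A \<in> ?Y \<union> ?X \<union> ?T"
      using assms(1-3) by (cases "x \<in> A"; cases "y \<in> A") (auto simp: path_family_def)
  qed
  ultimately show ?thesis by simp
qed

text \<open>Generators are added in pairs, so their number stays even, as the base cases require.
  Without \<open>y\<close> the path loses two vertices and freeing \<open>x\<close> gains one in the
  tops, which preserves the bound exactly. With \<open>y\<close>, three vertices are traded for two
  generators and one inserted element, which leaves one half to spare.\<close>

lemma partitionable_path_family:
  assumes "distinct vs" "set vs \<inter> B = {}" "finite B" "even (card B)"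
  shows "partitionable ((length vs + card B + 1) div 2) (path_family vs B)"
  using assms
proof (induction vs arbitrary: B rule: length_induct)
  case (1 vs)
  note N = partitionable_nonempty_subsets[OF 1(4,5)]
  consider "vs = []" | x where "vs = [x]" | x y where "vs = [x, y]" | x y z us where "vs = x # y # z # us"
    by (metis neq_Nil_conv)
  then show ?case
  proof cases
    case 1
    then show ?thesis using N "1.prems" by (auto simp: path_family_Nil elim!: evenE)
  next
    case 2
    have "partitionable (Suc (card B div 2)) {A. A - {x} \<in> Pow B - {{}}}"
      using 2 "1.prems" by (intro partitionable_free N) auto
    moreover have "path_family vs B = {A. A - {x} \<in> Pow B - {{}}}"
      using 2 "1.prems" path_family_single[of x B] by simp
    ultimately show ?thesis using 2 "1.prems" by simp
  next
    case 3
    then have "partitionable (Suc (card B div 2)) (path_family vs B)"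
      using "1.prems" by (auto intro: partitionable_path_family_double)
    then show ?thesis using 3 "1.prems" by (auto elim!: evenE)
  next
    case 4
    have c: "card (insert x (insert z B)) = card B + 2" using 4 "1.prems" by auto
    have "partitionable ((length (z # us) + card B + 1) div 2) (path_family (z # us) B)"
      using 4 "1.prems" by (intro "1.IH"[rule_format]) auto
    moreover have "partitionable ((length us + card (insert x (insert z B)) + 1) div 2) (path_family us (insert x (insert z B)))"
      using 4 "1.prems" c by (intro "1.IH"[rule_format]) auto
    ultimately have "partitionable (Suc ((length us + card B + 2) div 2)) (path_family vs B)"
      unfolding 4 using 4 "1.prems" c by (intro partitionable_path_family_step) (auto elim!: partitionable_mono)
    then show ?thesis by (simp add: 4)
  qed
qed

text \<open>Without generators a path with at most one vertex has an empty family, which is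
  partitionable for every \<open>t\<close>. The base cases can therefore start one half higher, and
  the branch with \<open>y\<close> uses up the half that it has to spare in
  \<open>partitionable_path_family\<close>.\<close>

lemma partitionable_path_family_empty:
  assumes "distinct vs"
  shows "partitionable ((length vs + 2) div 2) (path_family vs {})"
  using assms
proof (induction vs rule: length_induct)
  case (1 vs)
  consider "vs = []" | x where "vs = [x]" | x y where "vs = [x, y]" | x y z us where "vs = x # y # z # us"
    by (metis neq_Nil_conv)
  then show ?case
  proof cases
    case 3
    then have "path_family vs {} = {{x, y}..{x, y}}" by (auto simp: path_family_def)
    moreover have "partitionable ((length vs + 2) div 2) {{x, y}..{x, y}}" using 3 "1.prems" by (intro partitionable_Icc) auto
    ultimately show ?thesis using 3 by simp
  next
    case 4
    have "partitionable ((length (z # us) + 2) div 2) (path_family (z # us) {})"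
      using 4 "1.prems" by (intro "1.IH"[rule_format]) auto
    moreover have "partitionable ((length us + card {x, z} + 1) div 2) (path_family us {x, z})"
      using 4 "1.prems" by (intro partitionable_path_family) auto
    ultimately have "partitionable (Suc ((length us + 3) div 2)) (path_family vs {})"
      unfolding 4 using 4 "1.prems" by (intro partitionable_path_family_step) (auto simp: numeral_3_eq_3)
    then show ?thesis by (simp add: 4 numeral_3_eq_3)
  qed (auto simp: path_family_def partitionable_empty)
qed


section \<open>Edge families of cycles\<close>

definition cycle_family :: "nat \<Rightarrow> nat set set"
  where "cycle_family n = {A. A \<subseteq> {1..n} \<and> (has_edge A [1..<Suc n] \<or> n \<in> A \<and> 1 \<in> A)}"

lemma has_edge_append_singleton:
  "has_edge A (vs @ [x, y]) \<longleftrightarrow> has_edge A (vs @ [x]) \<or> x \<in> A \<and> y \<in> A"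
  by (induction A vs rule: has_edge.induct) (auto simp: has_edge_Cons_notin)

lemma has_edge_upt:
  "has_edge A [i..<j] \<longleftrightarrow> (\<exists>k. i \<le> k \<and> Suc k < j \<and> k \<in> A \<and> Suc k \<in> A)"
proof (induction j)
  case (Suc j)
  consider "Suc j \<le> i" | "j = i" | "i < j" by linarith
  then show ?case
  proof cases
    case 3
    then obtain j' where j': "j = Suc j'" "i \<le> j'" by (cases j) auto
    have "has_edge A [i..<Suc j] \<longleftrightarrow> has_edge A [i..<j] \<or> j' \<in> A \<and> j \<in> A"
      using has_edge_append_singleton[of A "[i..<j']" j' j] j' by simp
    then show ?thesis unfolding Suc.IH using j' by (auto simp: less_Suc_eq)
  qed auto
qed simp

lemma path_family_upt:
  "path_family [1..<Suc n] {} = {A. A \<subseteq> {1..n} \<and> (\<exists>i\<in>{1..<n}. i \<in> A \<and> i + 1 \<in> A)}"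
  unfolding path_family_def has_edge_upt by fastforce

lemma cycle_family_eq:
  "cycle_family n = {A. A \<subseteq> {1..n} \<and> ((\<exists>i\<in>{1..<n}. i \<in> A \<and> i + 1 \<in> A) \<or> n \<in> A \<and> 1 \<in> A)}"
  unfolding cycle_family_def has_edge_upt by fastforce

text \<open>In the branch without \<open>n\<close> no vertex becomes free, since both neighbours of
  \<open>n\<close> remain on the path from 1 to n - 1; this branch determines the bound. In the
  branch with \<open>n\<close>, its neighbours 1 and n - 1 are generators for the path from 2 to n -
  2.\<close>

lemma partitionable_cycle_family:
  assumes "n \<ge> 3"
  shows "partitionable ((n + 1) div 2) (cycle_family n)"
proof -
  let ?P = "path_family [1..<n] {}" and ?Q = "path_family [2..<n - 1] {1, n - 1}"
  have len: "length [1..<n] = n - 1" "length [2..<n - 1] = n - 3" by auto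
  have c: "card {1, n - 1} = 2" using assms by auto
  have "partitionable ((n - 1 + 2) div 2) ?P"
    using partitionable_path_family_empty[of "[1..<n]"] len by simp
  moreover have "n - 1 + 2 = n + 1" "n - 3 + 2 + 1 = n" using assms by auto
  ultimately have P: "partitionable ((n + 1) div 2) ?P" by metis
  have "partitionable ((n - 3 + 2 + 1) div 2) ?Q"
    using partitionable_path_family[of "[2..<n - 1]" "{1, n - 1}"] len c by auto
  then have "partitionable (n div 2) ?Q" using \<open>n - 3 + 2 + 1 = n\<close> by metis
  then have "partitionable (Suc (n div 2)) {A. n \<in> A \<and> A - {n} \<in> ?Q}"
    using assms by (intro partitionable_insert) (auto simp: path_family_def)
  then have Q: "partitionable ((n + 1) div 2) {A. n \<in> A \<and> A - {n} \<in> ?Q}"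
    by (rule partitionable_mono) simp
  have "partitionable ((n + 1) div 2) (?P \<union> {A. n \<in> A \<and> A - {n} \<in> ?Q})"
    using assms by (intro partitionable_Un P Q) (auto simp: path_family_def)
  moreover have "cycle_family n = ?P \<union> {A. n \<in> A \<and> A - {n} \<in> ?Q}" (is "_ = ?R")
  proof (rule Set.set_eqI)
    fix A
    show "A \<in> cycle_family n \<longleftrightarrow> A \<in> ?R"
    proof (cases "n \<in> A")
      case False
      have "A \<subseteq> {1..n} \<longleftrightarrow> A \<subseteq> {1..<n}" using False by (auto simp: le_less)
      then show ?thesis using False assms
        unfolding cycle_family_def path_family_def has_edge_upt by (auto simp: less_Suc_eq)
    next
      case True
      have "{1..n} = insert n (set [2..<n - 1] \<union> {1, n - 1})" using assms by auto
      then have "A \<subseteq> {1..n} \<longleftrightarrow> A - {n} \<subseteq> set [2..<n - 1] \<union> {1, n - 1}" by blast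
      moreover have "has_edge A [1..<Suc n] \<or> n \<in> A \<and> 1 \<in> A \<longleftrightarrow>
          (A - {n}) \<inter> {1, n - 1} \<noteq> {} \<or> has_edge (A - {n}) [2..<n - 1]" (is "?l \<longleftrightarrow> ?r")
      proof
        assume ?l
        then consider "1 \<in> A" | k where "1 \<le> k" "k < n" "k \<in> A" "Suc k \<in> A"
          unfolding has_edge_upt by auto
        then show ?r
        proof cases
          case 2
          consider "k = 1" | "k = n - 1" | "Suc k = n - 1" | "2 \<le> k" "Suc k < n - 1"
            using 2(1,2) by linarith
          then show ?thesis using 2 assms unfolding has_edge_upt by cases auto
        qed (use assms in auto)
      next
        assume ?r
        then consider "1 \<in> A" | "n - 1 \<in> A" | k where "2 \<le> k" "Suc k < n - 1" "k \<in> A" "Suc k \<in> A"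
          unfolding has_edge_upt by auto
        then show ?l
        proof cases
          case 3
          then have "has_edge A [1..<Suc n]" unfolding has_edge_upt by (intro exI[of _ k]) auto
          then show ?thesis ..
        next
          case 2
          then have "has_edge A [1..<Suc n]"
            using True assms unfolding has_edge_upt by (intro exI[of _ "n - 1"]) auto
          then show ?thesis ..
        qed (use True in auto)
      qed
      moreover have "A \<notin> ?P" using True by (auto simp: path_family_def)
      ultimately show ?thesis using True by (auto simp: cycle_family_def path_family_def)
    qed
  qed
  ultimately show ?thesis by simp
qed

lemma Icc_disjoint: "\<not> (C \<subseteq> D' \<and> C' \<subseteq> D) \<Longrightarrow> {C..D} \<inter> {C'..D'} = {}" for C D :: "'a set"
  by force

text \<open>Each edge is a bottom whose top adds the next vertex in cyclic order. This assigns every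
  set of three vertices to exactly one edge, and the full set stands alone.\<close>

lemma partitionable_cycle_family_4: "partitionable 3 (cycle_family 4)"
proof -
  let ?I = "{{1, 2}..{1, 2, 3}} \<union> ({{2, 3}..{2, 3, 4}} \<union> ({{3, 4}..{1, 3, 4}} \<union>
    ({{1, 4}..{1, 2, 4}} \<union> {{1, 2, 3, 4}..{1, 2, 3, 4::nat}})))"
  have g: "partitionable 3 {{1, 2}..{1, 2, 3::nat}}" "partitionable 3 {{2, 3}..{2, 3, 4::nat}}" "partitionable 3 {{3, 4}..{1, 3, 4::nat}}"
    "partitionable 3 {{1, 4}..{1, 2, 4::nat}}" "partitionable 3 {{1, 2, 3, 4}..{1, 2, 3, 4::nat}}"
    by (rule partitionable_Icc, simp, simp, simp)+
  have "partitionable 3 ?I"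
    by (rule partitionable_Un[OF g(1) partitionable_Un[OF g(2) partitionable_Un[OF g(3) partitionable_Un[OF g(4,5)]]]])
       (unfold Int_Un_distrib Un_empty, (intro conjI Icc_disjoint; simp)+)
  moreover have "cycle_family 4 = ?I"
  proof (rule Set.set_eqI)
    fix A :: "nat set"
    have e: "{1..4} = {1, 2, 3, 4::nat}" "[1..<Suc 4] = [1, 2, 3, 4]" by (auto simp: upt_rec numeral_eq_Suc)
    show "A \<in> cycle_family 4 \<longleftrightarrow> A \<in> ?I" unfolding cycle_family_def e
      by (cases "1 \<in> A"; cases "2 \<in> A"; cases "3 \<in> A"; cases "4 \<in> A") (simp_all, blast+)
  qed
  ultimately show ?thesis by simp
qed

section \<open>Stanley decompositions of squarefree monomial ideals\<close>

lemma keys_add_nat: "Poly_Mapping.keys (u + v) = Poly_Mapping.keys u \<union> Poly_Mapping.keys v"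
  for u v :: "'a \<Rightarrow>\<^sub>0 nat"
  by (auto simp: in_keys_iff lookup_add)

text \<open>Positions in a list match the indexing in \<open>stanley_decomposition\<close>;
  uniqueness of the position encodes disjointness.\<close>

lemma partitionable_list:
  assumes "partitionable t F"
  shows "\<exists>L. (\<forall>p\<in>set L. fst p \<subseteq> snd p \<and> finite (snd p) \<and> t \<le> card (snd p) \<and> {fst p..snd p} \<subseteq> F) \<and>
    (\<forall>A\<in>F. \<exists>!i. i < length L \<and> A \<in> {fst (L ! i)..snd (L ! i)})"
  using assms
proof induction
  case partitionable_empty
  show ?case by (rule exI[of _ "[]"]) auto
next
  case (partitionable_interval C D F)
  then obtain L where L: "\<forall>p\<in>set L. fst p \<subseteq> snd p \<and> finite (snd p) \<and> t \<le> card (snd p) \<and> {fst p..snd p} \<subseteq> F"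
    "\<forall>A\<in>F. \<exists>!i. i < length L \<and> A \<in> {fst (L ! i)..snd (L ! i)}" by blast
  let ?L = "(C, D) # L"
  have LF: "{fst (L ! i)..snd (L ! i)} \<subseteq> F" if "i < length L" for i
    using L(1) nth_mem[OF that] by blast
  have "\<exists>!i. i < length ?L \<and> A \<in> {fst (?L ! i)..snd (?L ! i)}" if A: "A \<in> {C..D} \<union> F" for A
  proof (cases "A \<in> {C..D}")
    case True
    then have "A \<notin> F" using partitionable_interval by blast
    show ?thesis
    proof (rule ex1I[of _ 0])
      fix i assume i: "i < length ?L \<and> A \<in> {fst (?L ! i)..snd (?L ! i)}"
      show "i = 0"
      proof (cases i)
        case (Suc j)
        then have "A \<in> {fst (L ! j)..snd (L ! j)}" "j < length L" using i by simp_all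
        then show ?thesis using LF \<open>A \<notin> F\<close> by blast
      qed
    qed (use True in simp)
  next
    case False
    then have "A \<in> F" using A by blast
    then obtain i where i: "i < length L" "A \<in> {fst (L ! i)..snd (L ! i)}"
      "\<And>j. j < length L \<and> A \<in> {fst (L ! j)..snd (L ! j)} \<Longrightarrow> j = i" using L(2) by blast
    show ?thesis
    proof (rule ex1I[of _ "Suc i"])
      fix j assume j: "j < length ?L \<and> A \<in> {fst (?L ! j)..snd (?L ! j)}"
      then obtain j' where "j = Suc j'" using False by (cases j) auto
      then show "j = Suc i" using i(3)[of j'] j by simp
    qed (use i(1,2) in simp)
  qed
  moreover have "\<forall>p\<in>set ?L. fst p \<subseteq> snd p \<and> finite (snd p) \<and> t \<le> card (snd p) \<and>
      {fst p..snd p} \<subseteq> {C..D} \<union> F"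
  proof
    fix p assume "p \<in> set ?L"
    then consider "p = (C, D)" | "p \<in> set L" by auto
    then show "fst p \<subseteq> snd p \<and> finite (snd p) \<and> t \<le> card (snd p) \<and> {fst p..snd p} \<subseteq> {C..D} \<union> F"
    proof cases
      case 1
      then show ?thesis using partitionable_interval.hyps(1-3) by (simp only: fst_conv snd_conv) blast
    next
      case 2
      then show ?thesis using L(1) by blast
    qed
  qed
  ultimately show ?case by blast
qed

definition squarefree_exp :: "nat set \<Rightarrow> nat \<Rightarrow>\<^sub>0 nat"
  where "squarefree_exp C = (\<Sum>i\<in>C. Poly_Mapping.single i 1)"

lemma lookup_squarefree_exp:
  "finite C \<Longrightarrow> Poly_Mapping.lookup (squarefree_exp C) i = (if i \<in> C then 1 else 0)"
  by (simp add: squarefree_exp_def lookup_sum lookup_single when_def)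

lemma keys_squarefree_exp [simp]: "finite C \<Longrightarrow> Poly_Mapping.keys (squarefree_exp C) = C"
  by (auto simp: in_keys_iff lookup_squarefree_exp split: if_splits)

definition support_part :: "'a::field mpoly \<Rightarrow> nat set set \<Rightarrow> 'a mpoly"
  where "support_part p F =
    (\<Sum>u\<in>{u \<in> Poly_Mapping.keys p. Poly_Mapping.keys u \<in> F}. Poly_Mapping.single u (Poly_Mapping.lookup p u))"

lemma lookup_support_part:
  "Poly_Mapping.lookup (support_part p F) u =
    (if Poly_Mapping.keys u \<in> F then Poly_Mapping.lookup p u else 0)"
  by (auto simp: support_part_def lookup_sum lookup_single when_def in_keys_iff sum.delta')

lemma keys_support_part:
  "Poly_Mapping.keys (support_part p F) = {u \<in> Poly_Mapping.keys p. Poly_Mapping.keys u \<in> F}"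
  by (auto simp: in_keys_iff lookup_support_part split: if_splits)

text \<open>Membership is a condition on each monomial separately. The set is an ideal as soon as
  \<open>F\<close> is closed upwards within {1..n}.\<close>

definition squarefree_ideal :: "nat \<Rightarrow> nat set set \<Rightarrow> 'a::field mpoly set"
  where "squarefree_ideal n F = {p \<in> polys {1..n}. \<forall>u\<in>Poly_Mapping.keys p. Poly_Mapping.keys u \<in> F}"

text \<open>Divisibility of a monomial by a squarefree one depends on its support only, and the
  quotient involves only variables from that support. This is the dictionary between intervals and
  Stanley spaces.\<close>

lemma stanley_space_monomial:
  assumes "C \<subseteq> D" "finite D"
  shows "stanley_space (ideal_module n I) (Poly_Mapping.single (squarefree_exp C) (1::'a::field)) D =
    {p. \<forall>u\<in>Poly_Mapping.keys p. Poly_Mapping.keys u \<in> {C..D}}"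
proof (intro equalityI subsetI)
  have C: "finite C" using assms finite_subset by auto
  fix p assume "p \<in> stanley_space (ideal_module n I) (Poly_Mapping.single (squarefree_exp C) (1::'a)) D"
  then obtain q where q: "q \<in> polys D" "p = q * Poly_Mapping.single (squarefree_exp C) 1"
    by (auto simp: stanley_space_def)
  have "Poly_Mapping.keys u \<in> {C..D}" if "u \<in> Poly_Mapping.keys p" for u
  proof -
    obtain v where "u = v + squarefree_exp C" "v \<in> Poly_Mapping.keys q"
      using \<open>u \<in> Poly_Mapping.keys p\<close> q(2) keys_mult[of q "Poly_Mapping.single (squarefree_exp C) 1"] by auto
    then show ?thesis using q(1) assms C by (auto simp: keys_add_nat polys_def)
  qed
  then show "p \<in> {p. \<forall>u\<in>Poly_Mapping.keys p. Poly_Mapping.keys u \<in> {C..D}}" by blast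
next
  have C: "finite C" using assms finite_subset by auto
  fix p :: "'a mpoly" assume p: "p \<in> {p. \<forall>u\<in>Poly_Mapping.keys p. Poly_Mapping.keys u \<in> {C..D}}"
  \<comment> \<open>\<open>p\<close> divided termwise by the squarefree monomial; the truncated
    subtraction of exponents is exact because every support contains \<open>C\<close>.\<close>
  let ?q = "\<Sum>u\<in>Poly_Mapping.keys p. Poly_Mapping.single (u - squarefree_exp C) (Poly_Mapping.lookup p u)"
  have e: "u - squarefree_exp C + squarefree_exp C = u" if "u \<in> Poly_Mapping.keys p" for u
  proof (rule poly_mapping_eqI)
    have "C \<subseteq> Poly_Mapping.keys u" using p that by auto
    then have "Poly_Mapping.lookup u i \<ge> 1" if "i \<in> C" for i
      using that by (auto simp: in_keys_iff Suc_le_eq)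
    then show "Poly_Mapping.lookup (u - squarefree_exp C + squarefree_exp C) i = Poly_Mapping.lookup u i" for i
      using C by (simp add: lookup_add lookup_minus lookup_squarefree_exp)
  qed
  have "?q * Poly_Mapping.single (squarefree_exp C) 1 = p"
    unfolding sum_distrib_right mult_single by (subst (2) mpoly_eq_sum) (simp add: e)
  moreover have "?q \<in> polys D"
  proof -
    have "Poly_Mapping.keys u \<subseteq> D" if "u \<in> Poly_Mapping.keys ?q" for u
    proof -
      obtain v where v: "v \<in> Poly_Mapping.keys p" "u = v - squarefree_exp C"
        using subsetD[OF Poly_Mapping.keys_sum \<open>u \<in> Poly_Mapping.keys ?q\<close>] by (auto split: if_splits)
      then have "Poly_Mapping.keys u \<subseteq> Poly_Mapping.keys v" by (auto simp: in_keys_iff lookup_minus)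
      then show ?thesis using p v(1) by auto
    qed
    then show ?thesis by (simp add: polys_def)
  qed
  ultimately show "p \<in> stanley_space (ideal_module n I) (Poly_Mapping.single (squarefree_exp C) (1::'a)) D"
    by (force simp: stanley_space_def)
qed

lemma stanley_decomposition_squarefree_ideal:
  fixes n :: nat and F :: "nat set set"
  defines "I \<equiv> squarefree_ideal n F :: 'a::field mpoly set"
  assumes I: "ideal I (poly_ring n)" and F: "F \<subseteq> Pow {1..n}" and t: "partitionable t F"
  shows "\<exists>D. stanley_decomposition n (ideal_module n I) (ideal_grading I) D \<and> (\<forall>(m, Z) \<in> set D. t \<le> card Z)"
proof -
  obtain L where L: "\<forall>p\<in>set L. fst p \<subseteq> snd p \<and> finite (snd p) \<and> t \<le> card (snd p) \<and> {fst p..snd p} \<subseteq> F"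
    "\<forall>A\<in>F. \<exists>!i. i < length L \<and> A \<in> {fst (L ! i)..snd (L ! i)}" using partitionable_list[OF t] by blast
  define D where "D = map (\<lambda>(C, Z). (Poly_Mapping.single (squarefree_exp C) (1::'a), Z)) L"
  have len [simp]: "length D = length L" by (simp add: D_def)
  let ?V = "\<lambda>i. {fst (L ! i)..snd (L ! i)}"
  have VF: "?V i \<subseteq> F" if "i < length L" for i
    using L(1) nth_mem[OF that] by blast
  have sp: "stanley_space (ideal_module n I) (fst (D ! i)) (snd (D ! i)) =
      {p. \<forall>u\<in>Poly_Mapping.keys p. Poly_Mapping.keys u \<in> ?V i}" if i: "i < length L" for i
  proof -
    have "fst (L ! i) \<subseteq> snd (L ! i)" "finite (snd (L ! i))"
      using L(1) nth_mem[OF i] by blast+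
    from stanley_space_monomial[OF this] show ?thesis using i by (simp add: D_def split_beta)
  qed
  have sub: "{p. \<forall>u\<in>Poly_Mapping.keys p. Poly_Mapping.keys u \<in> ?V i} \<subseteq> I" if "i < length L" for i
    using VF[OF that] F unfolding I_def squarefree_ideal_def polys_def by fast
  have hom: "(\<exists>a \<in> Zn n. m \<in> ideal_grading I a) \<and> Z \<subseteq> {1..n} \<and> inj_on (\<lambda>u. u \<odot>\<^bsub>ideal_module n I\<^esub> m) (polys Z)"
    if "(m, Z) \<in> set D" for m Z
  proof -
    obtain C where C: "(C, Z) \<in> set L" "m = Poly_Mapping.single (squarefree_exp C) 1"
      using \<open>(m, Z) \<in> set D\<close> by (auto simp: D_def)
    then have CZ: "C \<subseteq> Z" "finite Z" "{C..Z} \<subseteq> F" using L(1) by fastforce+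
    then have "C \<in> F" "Z \<in> F" by auto
    note CZ = CZ(1,2) this
    have "finite C" "C \<subseteq> {1..n}" using CZ finite_subset F by auto
    then have "m \<in> ideal_grading I (\<lambda>i. int (Poly_Mapping.lookup (squarefree_exp C) i))"
      using CZ F C(2) by (auto simp: ideal_grading_def I_def squarefree_ideal_def polys_def)
    moreover have "(\<lambda>i. int (Poly_Mapping.lookup (squarefree_exp C) i)) \<in> Zn n"
      using \<open>finite C\<close> \<open>C \<subseteq> {1..n}\<close> by (auto simp: Zn_def lookup_squarefree_exp)
    moreover have "m \<noteq> 0" using C(2) by (metis lookup_single_eq lookup_zero zero_neq_one)
    ultimately show ?thesis using CZ F by (auto simp: inj_on_def)
  qed
  have uniq: "\<exists>!y. y \<in> (\<Pi>\<^sub>E i\<in>{..<length D}. stanley_space (ideal_module n I) (fst (D ! i)) (snd (D ! i))) \<and>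
      x = (\<Oplus>\<^bsub>ideal_module n I\<^esub>i\<in>{..<length D}. y i)" if "x \<in> carrier (ideal_module n I)" for x
  proof -
    have x: "x \<in> I" using that by simp
    let ?P = "\<Pi>\<^sub>E i\<in>{..<length L}. {p. \<forall>u\<in>Poly_Mapping.keys p. Poly_Mapping.keys u \<in> ?V i}"
    have P: "(\<Pi>\<^sub>E i\<in>{..<length D}. stanley_space (ideal_module n I) (fst (D ! i)) (snd (D ! i))) = ?P"
      unfolding len by (rule PiE_cong) (use sp in simp)
    have fs: "(\<Oplus>\<^bsub>ideal_module n I\<^esub>i\<in>{..<length D}. y i) = sum y {..<length L}" if "y \<in> ?P" for y
      using that sub by (subst finsum_ideal_module[OF I]) (force simp: Pi_iff PiE_iff)+
    \<comment> \<open>Each coefficient of the sum comes from the one summand whose interval contains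
      the support; so the sum determines its summands.\<close>
    have coeff: "Poly_Mapping.lookup (y i) u = (if Poly_Mapping.keys u \<in> ?V i then Poly_Mapping.lookup (sum y {..<length L}) u else 0)"
      if y: "y \<in> ?P" and i: "i < length L" for y i u
    proof (cases "Poly_Mapping.keys u \<in> ?V i")
      case True
      have "Poly_Mapping.lookup (y j) u = 0" if "j \<in> {..<length L} - {i}" for j
      proof (rule ccontr)
        assume "Poly_Mapping.lookup (y j) u \<noteq> 0"
        then have "u \<in> Poly_Mapping.keys (y j)" by (simp add: in_keys_iff)
        then have "Poly_Mapping.keys u \<in> ?V j" using y that by (auto simp: PiE_iff)
        then show False using L(2) True VF i that by blast
      qed
      then have "sum (\<lambda>j. Poly_Mapping.lookup (y j) u) {..<length L} = Poly_Mapping.lookup (y i) u"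
        using i by (subst sum.remove[of _ i]) auto
      then show ?thesis using True by (simp add: lookup_sum)
    next
      case False
      then have "u \<notin> Poly_Mapping.keys (y i)" using y i by (auto simp: PiE_iff)
      then have "Poly_Mapping.lookup (y i) u = 0" by (simp add: in_keys_iff)
      then show ?thesis by (simp only: False if_False)
    qed
    define y where "y = (\<lambda>i\<in>{..<length L}. support_part x (?V i))"
    have y: "y \<in> ?P" unfolding y_def
      by (auto simp: keys_support_part)
    have xy: "x = sum y {..<length L}"
    proof (rule poly_mapping_eqI)
      fix u
      have *: "Poly_Mapping.lookup (sum y {..<length L}) u =
          (\<Sum>i<length L. if Poly_Mapping.keys u \<in> ?V i then Poly_Mapping.lookup x u else 0)"
        unfolding lookup_sum by (intro sum.cong) (auto simp: y_def lookup_support_part)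
      show "Poly_Mapping.lookup x u = Poly_Mapping.lookup (sum y {..<length L}) u"
      proof (cases "u \<in> Poly_Mapping.keys x")
        case True
        then have "Poly_Mapping.keys u \<in> F" using x by (simp add: I_def squarefree_ideal_def)
        then obtain i where i: "i < length L" "Poly_Mapping.keys u \<in> ?V i"
          "\<And>j. j < length L \<and> Poly_Mapping.keys u \<in> ?V j \<Longrightarrow> j = i" using L(2) by blast
        have "(\<Sum>i<length L. if Poly_Mapping.keys u \<in> ?V i then Poly_Mapping.lookup x u else 0) =
            (\<Sum>j<length L. if j = i then Poly_Mapping.lookup x u else 0)"
        proof (rule sum.cong)
          fix j assume "j \<in> {..<length L}"
          then have "Poly_Mapping.keys u \<in> ?V j \<longleftrightarrow> j = i" using i by blast
          then show "(if Poly_Mapping.keys u \<in> ?V j then Poly_Mapping.lookup x u else 0) =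
              (if j = i then Poly_Mapping.lookup x u else 0)" by (simp only:)
        qed simp
        then show ?thesis using i(1) unfolding * by simp
      next
        case False
        then have "Poly_Mapping.lookup x u = 0" by (simp add: in_keys_iff)
        then show ?thesis unfolding * by (simp only: if_cancel sum.neutral_const)
      qed
    qed
    show ?thesis unfolding P
    proof (rule ex1I[of _ y])
      show "y \<in> ?P \<and> x = (\<Oplus>\<^bsub>ideal_module n I\<^esub>i\<in>{..<length D}. y i)"
        using y xy fs[OF y] by metis
      fix z assume z: "z \<in> ?P \<and> x = (\<Oplus>\<^bsub>ideal_module n I\<^esub>i\<in>{..<length D}. z i)"
      then have "sum z {..<length L} = sum y {..<length L}" using fs[of z] xy by metis
      then have "z i = y i" if "i < length L" for i
        using coeff[OF y that] coeff[OF conjunct1[OF z] that] by (intro poly_mapping_eqI) metis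
      then show "z = y" using z y by (intro PiE_ext) auto
    qed
  qed
  have "stanley_decomposition n (ideal_module n I) (ideal_grading I) D"
    unfolding stanley_decomposition_def
  proof (intro conjI ballI uniq)
    fix p assume "p \<in> set D"
    then show "case p of (m, Z) \<Rightarrow> (\<exists>a \<in> Zn n. m \<in> ideal_grading I a) \<and> Z \<subseteq> {1..n} \<and>
        inj_on (\<lambda>u. u \<odot>\<^bsub>ideal_module n I\<^esub> m) (polys Z)"
      unfolding split_beta by (intro hom) simp
  qed
  moreover have "\<forall>(m, Z) \<in> set D. t \<le> card Z" using L(1) by (auto simp: D_def)
  ultimately show ?thesis by blast
qed

text \<open>\<open>Max\<close> dominates the value of one decomposition only if the set of all
  values is finite. The values are at most \<open>n\<close> because a decomposition of a nonzero
  ideal is a nonempty list, so that its \<open>Min\<close> is attained by some \<open>Z\<close>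
  within {1..n}.\<close>

lemma le_sdepth_squarefree_ideal:
  fixes F :: "nat set set"
  assumes I: "ideal (squarefree_ideal n F :: 'a::field mpoly set) (poly_ring n)" and F: "F \<subseteq> Pow {1..n}" "F \<noteq> {}"
    and t: "partitionable t F"
  shows "t \<le> ideal_sdepth n (squarefree_ideal n F :: 'a mpoly set)"
proof -
  let ?I = "squarefree_ideal n F :: 'a mpoly set"
  let ?S = "{D. stanley_decomposition n (ideal_module n ?I) (ideal_grading ?I) D}"
  obtain A where A: "A \<in> F" using F by blast
  then have fA: "finite A" using F finite_subset by blast
  let ?m = "Poly_Mapping.single (squarefree_exp A) (1::'a)"
  have m: "?m \<in> ?I" using A F fA by (auto simp: squarefree_ideal_def polys_def)
  have m0: "?m \<noteq> 0" by (metis lookup_single_eq lookup_zero zero_neq_one)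
  interpret module "poly_ring n" "ideal_module n ?I" by (rule module_ideal_module[OF I])
  have ne: "D \<noteq> []" if D: "D \<in> ?S" for D
  proof
    assume "D = []"
    moreover have "\<exists>y. ?m = (\<Oplus>\<^bsub>ideal_module n ?I\<^esub>i\<in>{..<length D}. y i)"
      using D m unfolding stanley_decomposition_def by auto
    ultimately show False using m0 by simp
  qed
  have "sdepth_decomposition D \<le> n" if D: "D \<in> ?S" for D
  proof -
    have "(\<lambda>(m, Z). card Z) ` set D \<noteq> {}" using ne[OF D] by simp
    then have "sdepth_decomposition D \<in> (\<lambda>(m, Z). card Z) ` set D"
      unfolding sdepth_decomposition_def by (intro Min_in) auto
    then obtain m Z where "(m, Z) \<in> set D" "sdepth_decomposition D = card Z" by auto
    moreover from this have "Z \<subseteq> {1..n}" using D unfolding stanley_decomposition_def by blast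
    ultimately show ?thesis using card_mono[of "{1..n}" Z] by simp
  qed
  then have "sdepth_decomposition ` ?S \<subseteq> {..n}" by blast
  then have fin: "finite (sdepth_decomposition ` ?S)" by (rule finite_subset) simp
  obtain D where D: "D \<in> ?S" "\<forall>(m, Z) \<in> set D. t \<le> card Z"
    using stanley_decomposition_squarefree_ideal[OF I F(1) t] by auto
  have "t \<le> sdepth_decomposition D" unfolding sdepth_decomposition_def
    using D ne[OF D(1)] by (subst Min_ge_iff) auto
  also have "\<dots> \<le> ideal_sdepth n ?I" unfolding ideal_sdepth_def sdepth_def
    using D(1) fin by (intro Max_ge) auto
  finally show ?thesis .
qed

section \<open>Edge ideals described by supports\<close>

lemma squarefree_ideal_add:
  assumes "p \<in> squarefree_ideal n F" "q \<in> squarefree_ideal n F"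
  shows "p + q \<in> squarefree_ideal n F"
  using assms keys_add[of p q] by (auto simp: squarefree_ideal_def intro: polys_add)

lemma squarefree_ideal_mult:
  assumes up: "\<And>A B. A \<in> F \<Longrightarrow> A \<subseteq> B \<Longrightarrow> B \<subseteq> {1..n} \<Longrightarrow> B \<in> F"
    and r: "r \<in> polys {1..n}" and p: "p \<in> squarefree_ideal n F"
  shows "r * p \<in> squarefree_ideal n F"
proof -
  have rp: "r * p \<in> polys {1..n}" using r p by (auto simp: squarefree_ideal_def intro: polys_mult)
  have "Poly_Mapping.keys u \<in> F" if u: "u \<in> Poly_Mapping.keys (r * p)" for u
  proof -
    obtain v w where "u = v + w" "w \<in> Poly_Mapping.keys p" using u keys_mult[of r p] by auto
    moreover from this have "Poly_Mapping.keys w \<in> F" using p by (auto simp: squarefree_ideal_def)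
    moreover have "Poly_Mapping.keys u \<subseteq> {1..n}" using rp u by (auto simp: polys_def)
    ultimately show ?thesis using up by (auto simp: keys_add_nat)
  qed
  then show ?thesis using rp by (simp add: squarefree_ideal_def)
qed

lemma ideal_squarefree_ideal:
  assumes up: "\<And>A B. A \<in> F \<Longrightarrow> A \<subseteq> B \<Longrightarrow> B \<subseteq> {1..n} \<Longrightarrow> B \<in> F"
  shows "ideal (squarefree_ideal n F :: 'a::field mpoly set) (poly_ring n)"
proof (rule idealI)
  let ?I = "squarefree_ideal n F :: 'a mpoly set"
  interpret cring "poly_ring n :: 'a mpoly ring" by (rule cring_poly_ring)
  show "ring (poly_ring n :: 'a mpoly ring)" by (rule ring_axioms)
  show "subgroup ?I (add_monoid (poly_ring n))"
  proof (rule subgroup.intro)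
    fix p assume p: "p \<in> ?I"
    then have "\<ominus>\<^bsub>poly_ring n\<^esub> p = - p"
      by (intro minus_equality) (auto simp: squarefree_ideal_def intro: polys_uminus)
    moreover have "- p \<in> ?I" using p by (auto simp: squarefree_ideal_def polys_uminus)
    ultimately show "inv\<^bsub>add_monoid (poly_ring n)\<^esub> p \<in> ?I" by (simp add: a_inv_def)
  qed (auto simp: squarefree_ideal_add, auto simp: squarefree_ideal_def)
  fix p r :: "'a mpoly" assume "p \<in> ?I" "r \<in> carrier (poly_ring n)"
  then show "r \<otimes>\<^bsub>poly_ring n\<^esub> p \<in> ?I" "p \<otimes>\<^bsub>poly_ring n\<^esub> r \<in> ?I"
    using squarefree_ideal_mult[OF up, where r = r and p = p] by (simp_all add: mult.commute)
qed

lemma genideal_edges: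
  assumes E: "\<And>i j. (i, j) \<in> E \<Longrightarrow> i \<in> {1..n} \<and> j \<in> {1..n} \<and> i \<noteq> j"
  shows "Idl\<^bsub>poly_ring n\<^esub> {var i * var j | i j. (i, j) \<in> E} =
    (squarefree_ideal n {A. A \<subseteq> {1..n} \<and> (\<exists>(i, j)\<in>E. i \<in> A \<and> j \<in> A)} :: 'a::field mpoly set)"
    (is "?I = squarefree_ideal n ?F")
proof -
  interpret cring "poly_ring n :: 'a mpoly ring" by (rule cring_poly_ring)
  let ?G = "{var i * var j | i j. (i, j) \<in> E} :: 'a mpoly set"
  have G: "?G \<subseteq> carrier (poly_ring n)" using E by (force intro!: polys_mult var_in_polys)
  have I: "ideal ?I (poly_ring n)" using G by (rule genideal_ideal)
  note cl = ideal_closed[OF I]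
  have "?G \<subseteq> squarefree_ideal n ?F"
  proof
    fix g assume "g \<in> ?G"
    then obtain i j where ij: "g = var i * var j" "(i, j) \<in> E" by blast
    then have g: "g = Poly_Mapping.single (Poly_Mapping.single i 1 + Poly_Mapping.single j 1) 1"
      by (simp add: var_def mult_single)
    show "g \<in> squarefree_ideal n ?F" unfolding g using ij(2) E[OF ij(2)]
      by (auto simp: squarefree_ideal_def polys_def keys_add_nat)
  qed
  moreover have "ideal (squarefree_ideal n ?F :: 'a mpoly set) (poly_ring n)"
    by (rule ideal_squarefree_ideal) blast
  ultimately have "?I \<subseteq> squarefree_ideal n ?F" by (intro genideal_minimal)
  moreover have "squarefree_ideal n ?F \<subseteq> ?I"
  proof
    fix p :: "'a mpoly" assume p: "p \<in> squarefree_ideal n ?F"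
    have "Poly_Mapping.single u (Poly_Mapping.lookup p u) \<in> ?I" if u: "u \<in> Poly_Mapping.keys p" for u
    proof -
      obtain i j where ij: "(i, j) \<in> E" "i \<in> Poly_Mapping.keys u" "j \<in> Poly_Mapping.keys u"
        using p u by (auto simp: squarefree_ideal_def)
      let ?e = "Poly_Mapping.single i 1 + Poly_Mapping.single j 1 :: nat \<Rightarrow>\<^sub>0 nat"
      \<comment> \<open>Exact despite truncation: \<open>i\<close> and \<open>j\<close> differ and
        both occur in \<open>u\<close>.\<close>
      have e: "(u - ?e) + ?e = u"
        using ij E[OF ij(1)]
        by (intro poly_mapping_eqI) (auto simp: lookup_add lookup_minus lookup_single when_def in_keys_iff)
      have "var i * var j \<in> ?I" using ij(1) G genideal_self[of ?G] by blast
      moreover have "Poly_Mapping.single (u - ?e) (Poly_Mapping.lookup p u) \<in> polys {1..n}"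
      proof -
        have "Poly_Mapping.keys u \<subseteq> {1..n}" using p u by (auto simp: squarefree_ideal_def)
        moreover have "Poly_Mapping.keys (u - ?e) \<subseteq> Poly_Mapping.keys u"
          by (auto simp: in_keys_iff lookup_minus)
        ultimately show ?thesis by (auto simp: polys_def)
      qed
      ultimately have "Poly_Mapping.single (u - ?e) (Poly_Mapping.lookup p u) * (var i * var j) \<in> ?I"
        by (rule cl(5)[rotated])
      then show ?thesis using e by (simp add: var_def mult_single add.assoc)
    qed
    moreover have sum: "sum f A \<in> ?I" if "\<And>u. u \<in> A \<Longrightarrow> f u \<in> ?I" for f and A :: "(nat \<Rightarrow>\<^sub>0 nat) set"
      using that by (induction A rule: infinite_finite_induct) (auto simp: cl)
    ultimately show "p \<in> ?I" by (subst mpoly_eq_sum) (rule sum)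
  qed
  ultimately show ?thesis by blast
qed

lemma path_ideal_eq:
  "path_ideal n = (squarefree_ideal n (path_family [1..<Suc n] {}) :: 'a::field mpoly set)"
proof -
  let ?E = "(\<lambda>i. (i, i + 1)) ` {1..<n}"
  have "{var i * var (i + 1) | i. i \<in> {1..<n}} = {var i * var j | i j. (i, j) \<in> ?E}" by blast
  moreover have "path_family [1..<Suc n] {} = {A. A \<subseteq> {1..n} \<and> (\<exists>(i, j)\<in>?E. i \<in> A \<and> j \<in> A)}"
    unfolding path_family_upt by auto
  ultimately show ?thesis unfolding path_ideal_def
    using genideal_edges[of ?E n] by (simp only:) (auto simp: image_iff)
qed

lemma cycle_ideal_eq:
  assumes "n \<ge> 2"
  shows "cycle_ideal n = (squarefree_ideal n (cycle_family n) :: 'a::field mpoly set)"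
proof -
  let ?P = "path_family [1..<Suc n] {}" and ?E = "{A. A \<subseteq> {1..n} \<and> n \<in> A \<and> 1 \<in> A}"
  have "{var n * var 1} = {var i * var j | i j. (i, j) \<in> {(n, 1)}}" by blast
  moreover have "?E = {A. A \<subseteq> {1..n} \<and> (\<exists>(i, j)\<in>{(n, 1)}. i \<in> A \<and> j \<in> A)}" by auto
  ultimately have E: "Idl\<^bsub>poly_ring n\<^esub> {var n * var 1} = (squarefree_ideal n ?E :: 'a mpoly set)"
    using assms genideal_edges[of "{(n, 1)}" n] by (simp only:) auto
  have F: "cycle_family n = ?P \<union> ?E" unfolding cycle_family_def path_family_def by auto
  have "squarefree_ideal n (cycle_family n) = {p + q | p q. p \<in> squarefree_ideal n ?P \<and> q \<in> (squarefree_ideal n ?E :: 'a mpoly set)}"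
    (is "_ = ?R")
  proof (intro equalityI subsetI)
    fix p :: "'a mpoly" assume p: "p \<in> squarefree_ideal n (cycle_family n)"
    \<comment> \<open>Taking the difference of the families keeps monomials that lie in both from
      being counted twice.\<close>
    let ?q = "support_part p ?P" and ?r = "support_part p (?E - ?P)"
    have "p = ?q + ?r"
    proof (rule poly_mapping_eqI)
      fix u
      show "Poly_Mapping.lookup p u = Poly_Mapping.lookup (?q + ?r) u"
        using p by (cases "u \<in> Poly_Mapping.keys p")
          (auto simp: squarefree_ideal_def F lookup_add lookup_support_part in_keys_iff)
    qed
    moreover have "?q \<in> squarefree_ideal n ?P" "?r \<in> squarefree_ideal n ?E"
      using p by (auto simp: squarefree_ideal_def polys_def in_keys_iff lookup_support_part split: if_splits)
    ultimately show "p \<in> ?R" by blast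
  next
    fix p assume "p \<in> ?R"
    then obtain q r where "p = q + r" "q \<in> squarefree_ideal n ?P" "r \<in> squarefree_ideal n ?E" by blast
    moreover from this have "q \<in> squarefree_ideal n (cycle_family n)" "r \<in> squarefree_ideal n (cycle_family n)"
      unfolding F by (auto simp: squarefree_ideal_def)
    ultimately show "p \<in> squarefree_ideal n (cycle_family n)" by (simp add: squarefree_ideal_add)
  qed
  then show ?thesis
    unfolding cycle_ideal_def path_ideal_eq E set_add_def' poly_ring_simps by blast
qed

section \<open>Power products of a regular sequence\<close>

definition exps :: "nat \<Rightarrow> (nat \<Rightarrow>\<^sub>0 nat) set"
  where "exps k = {b. Poly_Mapping.keys b \<subseteq> {..<k}}"

text \<open>The exponent sets of the monomial ideals in \<open>k\<close> variables; a finite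
  complement in \<open>exps k\<close> means finite colength.\<close>

definition upclosed :: "nat \<Rightarrow> (nat \<Rightarrow>\<^sub>0 nat) set \<Rightarrow> bool"
  where "upclosed k S \<longleftrightarrow> S \<subseteq> exps k \<and> (\<forall>b\<in>S. \<forall>c\<in>exps k. b + c \<in> S)"

definition exp_deg :: "(nat \<Rightarrow>\<^sub>0 nat) \<Rightarrow> nat"
  where "exp_deg b = (\<Sum>i\<in>Poly_Mapping.keys b. Poly_Mapping.lookup b i)"

lemma exps_0: "exps 0 = {0}"
  by (auto simp: exps_def)

lemma zero_in_exps [simp]: "0 \<in> exps k"
  by (simp add: exps_def)

lemma single_eq_0_iff: "Poly_Mapping.single i q = 0 \<longleftrightarrow> q = 0"
  by (metis lookup_single_eq lookup_zero single_zero)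

lemma exps_add: "b \<in> exps k \<Longrightarrow> c \<in> exps k \<Longrightarrow> b + c \<in> exps k"
  by (simp add: exps_def keys_add_nat)

lemma single_in_exps: "l < k \<Longrightarrow> Poly_Mapping.single l q \<in> exps k"
  by (simp add: exps_def)

lemma exps_mono: "b \<in> exps k \<Longrightarrow> k \<le> k' \<Longrightarrow> b \<in> exps k'"
  by (auto simp: exps_def)

lemma exps_Suc_cases:
  assumes "b \<in> exps (Suc k)"
  obtains c q where "c \<in> exps k" "b = c + Poly_Mapping.single k q"
proof
  let ?q = "Poly_Mapping.lookup b k"
  show "b - Poly_Mapping.single k ?q \<in> exps k"
    using assms by (auto simp: exps_def in_keys_iff lookup_minus lookup_single when_def less_Suc_eq subset_iff split: if_splits)
  show "b = b - Poly_Mapping.single k ?q + Poly_Mapping.single k ?q"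
    by (rule poly_mapping_eqI) (simp add: lookup_add lookup_minus lookup_single when_def)
qed

lemma exp_deg_sum: "b \<in> exps k \<Longrightarrow> exp_deg b = (\<Sum>i<k. Poly_Mapping.lookup b i)"
  unfolding exp_deg_def by (rule sum.mono_neutral_left) (auto simp: exps_def in_keys_iff)

lemma exp_deg_add: "exp_deg (b + c) = exp_deg b + exp_deg c"
proof -
  have "finite (Poly_Mapping.keys b \<union> Poly_Mapping.keys c)" by simp
  then obtain k where "\<forall>i\<in>Poly_Mapping.keys b \<union> Poly_Mapping.keys c. i < k"
    unfolding finite_nat_set_iff_bounded by blast
  then have "b \<in> exps k" "c \<in> exps k" by (auto simp: exps_def)
  then show ?thesis using exps_add[of b k c] by (simp add: exp_deg_sum lookup_add sum.distrib)
qed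

lemma exp_deg_pos: "c \<noteq> 0 \<Longrightarrow> 0 < exp_deg c"
proof -
  assume "c \<noteq> 0"
  then obtain i where "i \<in> Poly_Mapping.keys c" by (metis in_keys_iff lookup_zero poly_mapping_eqI)
  then show ?thesis unfolding exp_deg_def by (intro sum_pos2[of _ i]) (auto simp: in_keys_iff)
qed

lemma digits_less: "(\<And>i. i < k \<Longrightarrow> b i < (B::nat)) \<Longrightarrow> (\<Sum>i<k. b i * B ^ i) < B ^ k"
proof (induction k)
  case (Suc k)
  have "(\<Sum>i<Suc k. b i * B ^ i) < B ^ k + b k * B ^ k" using Suc by simp
  also have "\<dots> = (Suc (b k)) * B ^ k" by simp
  also have "\<dots> \<le> B * B ^ k" using Suc.prems[of k] by (intro mult_right_mono) auto
  finally show ?case by simp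
qed simp

lemma digits_unique:
  assumes "(\<Sum>i<k. b i * B ^ i) = (\<Sum>i<k. c i * B ^ i)"
    "\<And>i. i < k \<Longrightarrow> b i < (B::nat)" "\<And>i. i < k \<Longrightarrow> c i < B" "i < k"
  shows "b i = c i"
  using assms
proof (induction k arbitrary: i)
  case (Suc k)
  have b: "(\<Sum>i<k. b i * B ^ i) < B ^ k" and c: "(\<Sum>i<k. c i * B ^ i) < B ^ k"
    using Suc.prems by (auto intro!: digits_less)
  have B: "B ^ k > 0" using b by linarith
  let ?X = "\<Sum>i<k. b i * B ^ i" and ?Y = "\<Sum>i<k. c i * B ^ i"
  have e: "?X + b k * B ^ k = ?Y + c k * B ^ k" using Suc.prems(1) by simp
  have "(?X + b k * B ^ k) div B ^ k = b k" "(?Y + c k * B ^ k) div B ^ k = c k"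
    using b c B by (simp_all add: div_add1_eq)
  then have "b k = c k" using e by simp
  moreover from this have "?X = ?Y" using e by simp
  ultimately show ?case using Suc.IH[of i] Suc.prems by (cases "i = k") auto
qed simp

text \<open>\<open>M\<close> is a subset stable under addition and under the \<open>f i\<close>, so
  that an ideal fits without a type of its own. The set in \<open>regular\<close> is
  \<open>lin i\<close>, which can be named only inside the locale.\<close>

locale regular_on =
  fixes f :: "nat \<Rightarrow> 'r::comm_ring_1" and M :: "'r set" and K :: nat
  assumes M_0: "0 \<in> M" and M_add: "x \<in> M \<Longrightarrow> y \<in> M \<Longrightarrow> x + y \<in> M"
    and M_uminus: "x \<in> M \<Longrightarrow> - x \<in> M"
    and M_mult: "i < K \<Longrightarrow> x \<in> M \<Longrightarrow> f i * x \<in> M"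
    and regular: "\<lbrakk>i < K; x \<in> M; f i * x \<in> {\<Sum>l<i. f l * y l | y. \<forall>l<i. y l \<in> M}\<rbrakk> \<Longrightarrow>
      x \<in> {\<Sum>l<i. f l * y l | y. \<forall>l<i. y l \<in> M}"
begin

definition lin :: "nat \<Rightarrow> 'r set"
  where "lin k = {\<Sum>l<k. f l * y l | y. \<forall>l<k. y l \<in> M}"

definition ev :: "(nat \<Rightarrow>\<^sub>0 nat) \<Rightarrow> 'r"
  where "ev b = (\<Prod>i<K. f i ^ Poly_Mapping.lookup b i)"

text \<open>The sum of the subgroups f^b M over \<open>b\<close> in \<open>S\<close>: a monomial
  ideal evaluated at \<open>f\<close>, times \<open>M\<close>.\<close>

inductive_set mspan :: "(nat \<Rightarrow>\<^sub>0 nat) set \<Rightarrow> 'r set" for S where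
  mspan_0: "0 \<in> mspan S"
| mspan_step: "\<lbrakk>x \<in> mspan S; b \<in> S; m \<in> M\<rbrakk> \<Longrightarrow> ev b * m + x \<in> mspan S"

lemma M_diff: "x \<in> M \<Longrightarrow> y \<in> M \<Longrightarrow> x - y \<in> M"
  using M_add[of x "- y"] M_uminus[of y] by simp

lemma ev_0 [simp]: "ev 0 = 1"
  by (simp add: ev_def)

lemma ev_add: "ev (b + c) = ev b * ev c"
  by (simp add: ev_def lookup_add power_add prod.distrib)

lemma ev_single: "l < K \<Longrightarrow> ev (Poly_Mapping.single l q) = f l ^ q"
proof -
  assume l: "l < K"
  have "ev (Poly_Mapping.single l q) = (\<Prod>i<K. if i = l then f l ^ q else 1)"
    unfolding ev_def by (intro prod.cong) (auto simp: lookup_single when_def)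
  then show ?thesis using l by simp
qed

lemma M_power: "i < K \<Longrightarrow> x \<in> M \<Longrightarrow> f i ^ q * x \<in> M"
  by (induction q) (auto simp: mult.assoc intro: M_mult)

lemma M_ev: "x \<in> M \<Longrightarrow> ev b * x \<in> M"
proof -
  assume x: "x \<in> M"
  have "(\<Prod>i<k. f i ^ Poly_Mapping.lookup b i) * x \<in> M" if "k \<le> K" for k
    using that
  proof (induction k)
    case (Suc k)
    then have "f k ^ Poly_Mapping.lookup b k * ((\<Prod>i<k. f i ^ Poly_Mapping.lookup b i) * x) \<in> M"
      by (intro M_power) auto
    then show ?case by (simp add: mult_ac)
  qed (use x in simp)
  then show ?thesis by (simp add: ev_def)
qed

lemma mspan_subset: "x \<in> mspan S \<Longrightarrow> x \<in> M"
  by (induction rule: mspan.induct) (auto intro: M_0 M_add M_ev)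

lemma mspan_ev: "b \<in> S \<Longrightarrow> m \<in> M \<Longrightarrow> ev b * m \<in> mspan S"
  using mspan_step[OF mspan_0] by fastforce

lemma mspan_add: "x \<in> mspan S \<Longrightarrow> y \<in> mspan S \<Longrightarrow> x + y \<in> mspan S"
  by (induction rule: mspan.induct) (auto simp: add.assoc intro: mspan_step)

lemma mspan_uminus: "x \<in> mspan S \<Longrightarrow> - x \<in> mspan S"
proof (induction rule: mspan.induct)
  case (mspan_step x b m)
  have "ev b * (- m) + (- x) \<in> mspan S"
    using mspan_step by (intro mspan.mspan_step M_uminus) auto
  then show ?case by simp
qed (simp add: mspan_0)

lemma mspan_diff: "x \<in> mspan S \<Longrightarrow> y \<in> mspan S \<Longrightarrow> x - y \<in> mspan S"
  using mspan_add[OF _ mspan_uminus, of x S y] by simp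

lemma mspan_mono: "x \<in> mspan S \<Longrightarrow> S \<subseteq> T \<Longrightarrow> x \<in> mspan T"
  by (induction rule: mspan.induct) (auto intro: mspan.intros)

lemma mspan_empty: "x \<in> mspan {} \<longleftrightarrow> x = 0"
  by (auto intro: mspan_0 elim: mspan.cases)

lemma mspan_mult_ev:
  assumes "x \<in> mspan S" "\<And>b. b \<in> S \<Longrightarrow> b + c \<in> T"
  shows "ev c * x \<in> mspan T"
  using assms(1)
proof induction
  case (mspan_step x b m)
  have "ev (b + c) * m + ev c * x \<in> mspan T" using mspan_step assms by (intro mspan.mspan_step) auto
  then show ?case by (simp add: ev_add algebra_simps)
qed (simp add: mspan_0)

lemma mspan_scale:
  assumes "\<And>m. m \<in> M \<Longrightarrow> s * m \<in> M"
  shows "x \<in> mspan S \<Longrightarrow> s * x \<in> mspan S"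
proof (induction rule: mspan.induct)
  case (mspan_step x b m)
  then have "ev b * (s * m) + s * x \<in> mspan S" by (intro mspan.mspan_step assms) auto
  then show ?case by (simp add: algebra_simps)
qed (simp add: mspan_0)

lemma mspan_mult_power: "x \<in> mspan S \<Longrightarrow> l < K \<Longrightarrow> f l ^ q * x \<in> mspan S"
  by (intro mspan_scale M_power)

lemma mspan_mult: "x \<in> mspan S \<Longrightarrow> l < K \<Longrightarrow> f l * x \<in> mspan S"
  using mspan_mult_power[of x S l 1] by simp

lemma mspan_insert:
  assumes "x \<in> mspan (insert c S)"
  shows "\<exists>m\<in>M. x - ev c * m \<in> mspan S"
  using assms
proof induction
  case mspan_0
  show ?case by (rule bexI[OF _ M_0]) (simp add: mspan.mspan_0)
next
  case (mspan_step x b m)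
  then obtain m' where m': "m' \<in> M" "x - ev c * m' \<in> mspan S" by blast
  show ?case
  proof (cases "b = c")
    case True
    then show ?thesis using m' mspan_step by (intro bexI[of _ "m + m'"] M_add) (auto simp: algebra_simps)
  next
    case False
    then have "ev b * m + (x - ev c * m') \<in> mspan S" using mspan_step m' by (intro mspan.mspan_step) auto
    then show ?thesis using m' by (intro bexI[of _ m']) (auto simp: algebra_simps)
  qed
qed

lemma lin_ev:
  assumes "m \<in> lin k" "\<And>l. l < k \<Longrightarrow> c + Poly_Mapping.single l 1 \<in> S" "k \<le> K"
  shows "ev c * m \<in> mspan S"
proof -
  obtain y where y: "m = (\<Sum>l<k. f l * y l)" "\<forall>l<k. y l \<in> M" using assms(1) by (auto simp: lin_def)
  have "(\<Sum>l<j. ev c * (f l * y l)) \<in> mspan S" if "j \<le> k" for j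
    using that
  proof (induction j)
    case (Suc j)
    have "ev (c + Poly_Mapping.single j 1) * y j + (\<Sum>l<j. ev c * (f l * y l)) \<in> mspan S"
      using Suc y assms(2) by (intro mspan_step) auto
    then show ?case using Suc.prems assms(3) by (simp add: ev_add ev_single algebra_simps)
  qed (simp add: mspan_0)
  then show ?thesis by (simp add: y(1) sum_distrib_left)
qed

lemma lin_Suc:
  assumes "m - f k * s \<in> lin k" "s \<in> M"
  shows "m \<in> lin (Suc k)"
proof -
  obtain y where y: "m - f k * s = (\<Sum>l<k. f l * y l)" "\<forall>l<k. y l \<in> M" using assms(1) by (auto simp: lin_def)
  then have "m = (\<Sum>l<Suc k. f l * (y(k := s)) l)" by (simp add: algebra_simps)
  then show ?thesis using y(2) assms(2) unfolding lin_def by (fastforce simp: less_Suc_eq)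
qed

text \<open>Quasi-regularity of the sequence \<open>f 0, \<dots>, f (k - 1)\<close>, for filtrations finer than that by degree.\<close>
definition detects :: "nat \<Rightarrow> bool"
  where "detects k \<longleftrightarrow> (\<forall>S a m. upclosed k S \<longrightarrow> finite (exps k - S) \<longrightarrow> a \<in> exps k - S \<longrightarrow>
    m \<in> M \<longrightarrow> ev a * m \<in> mspan S \<longrightarrow> m \<in> lin k)"

text \<open>Start from \<open>y\<close> in the span of all exponents and remove those outside
  \<open>S\<close> one at a time. At the removed \<open>c\<close>, write \<open>y\<close> as
  \<open>ev c * z\<close> modulo the smaller span. Then \<open>detects\<close> puts
  \<open>f k * z\<close> in \<open>lin k\<close>, regularity puts \<open>z\<close> there, and so
  \<open>ev c * z\<close> falls into the smaller span. Thus \<open>f k\<close> is a nonzerodivisor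
  modulo \<open>mspan S\<close>.\<close>

lemma detects_cancel:
  assumes d: "detects k" and k: "k < K" and S: "upclosed k S" "finite (exps k - S)"
    and y: "y \<in> M" "f k * y \<in> mspan S"
  shows "y \<in> mspan S"
proof -
  have "y \<in> mspan S" if "upclosed k U" "S \<subseteq> U" "y \<in> mspan U" for U
    using that
  proof (induction "card (U - S)" arbitrary: U)
    case 0
    have "U - S \<subseteq> exps k - S" using 0 by (auto simp: upclosed_def)
    then have "finite (U - S)" using S(2) finite_subset by blast
    then have "U = S" using 0 by auto
    then show ?case using 0 by simp
  next
    case (Suc n)
    have "U - S \<noteq> {}" using Suc.hyps(2) by force
    \<comment> \<open>Minimality of the degree keeps \<open>U - {c}\<close> closed upwards.\<close>
    then obtain c where c: "c \<in> U - S" "\<And>b. b \<in> U - S \<Longrightarrow> exp_deg c \<le> exp_deg b"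
      using ex_has_least_nat[of "\<lambda>b. b \<in> U - S" _ exp_deg] by blast
    let ?U = "U - {c}"
    have U: "U \<subseteq> exps k" "\<And>b d. b \<in> U \<Longrightarrow> d \<in> exps k \<Longrightarrow> b + d \<in> U"
      using Suc.prems(1) by (auto simp: upclosed_def)
    have "b + d \<in> ?U" if b: "b \<in> ?U" and dd: "d \<in> exps k" for b d
    proof -
      have "b + d \<noteq> c"
      proof
        assume bd: "b + d = c"
        then have "b \<notin> S" using c(1) S(1) dd unfolding upclosed_def by blast
        then have "exp_deg c \<le> exp_deg b" using b by (intro c(2)) auto
        moreover have "d \<noteq> 0" using bd b by auto
        then have "exp_deg b < exp_deg c" using exp_deg_pos[of d] bd exp_deg_add[of b d] by simp
        ultimately show False by simp
      qed
      then show ?thesis using U(2)[OF _ dd] b by blast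
    qed
    then have up: "upclosed k ?U" using U by (auto simp: upclosed_def)
    have SU: "S \<subseteq> ?U" using c(1) Suc.prems(2) by blast
    have fin: "finite (exps k - ?U)" using SU S(2) by (rule_tac finite_subset) auto
    have "insert c ?U = U" using c(1) by blast
    then obtain z where z: "z \<in> M" "y - ev c * z \<in> mspan ?U" using mspan_insert[of y c ?U] Suc.prems(3) by auto
    have "f k * y - f k * (y - ev c * z) \<in> mspan ?U"
      using k by (intro mspan_diff mspan_mult z mspan_mono[OF y(2) SU]) auto
    then have "ev c * (f k * z) \<in> mspan ?U" by (simp add: algebra_simps)
    then have "f k * z \<in> lin k"
      using d up fin c(1) U(1) M_mult[OF k z(1)] unfolding detects_def by blast
    then have "z \<in> lin k" using regular[OF k z(1)] by (simp add: lin_def)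
    moreover have "c + Poly_Mapping.single l 1 \<in> ?U" if "l < k" for l
      using single_eq_0_iff[of l "1::nat"] U(2)[of c "Poly_Mapping.single l 1"] c(1) single_in_exps[OF that, of 1] by auto
    ultimately have "ev c * z \<in> mspan ?U" using k by (intro lin_ev) auto
    then have "y \<in> mspan ?U" using mspan_add[OF z(2)] by fastforce
    moreover have "card (?U - S) = n"
    proof -
      have "?U - S = (U - S) - {c}" by blast
      then show ?thesis using Suc.hyps(2) c(1) by simp
    qed
    ultimately show ?case using Suc.hyps(1) up SU by blast
  qed
  moreover have "upclosed k (exps k)" by (auto simp: upclosed_def exps_add)
  moreover have "y \<in> mspan (exps k)" using mspan_ev[OF zero_in_exps y(1)] by simp
  ultimately show ?thesis using S(1) by (auto simp: upclosed_def)
qed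

lemma detects_cancel_power:
  assumes "detects k" "k < K" "upclosed k S" "finite (exps k - S)"
  shows "y \<in> M \<Longrightarrow> f k ^ p * y \<in> mspan S \<Longrightarrow> y \<in> mspan S"
proof (induction p)
  case (Suc p)
  have "f k * (f k ^ p * y) \<in> mspan S" using Suc.prems(2) by (simp add: mult.assoc)
  then have "f k ^ p * y \<in> mspan S" by (rule detects_cancel[OF assms M_power[OF assms(2) Suc.prems(1)]])
  then show ?case using Suc by blast
qed simp

text \<open>Slice \<open>S\<close> at the height \<open>p\<close> of \<open>a\<close> in the last
  variable to get \<open>T\<close>. Cancelling \<open>f k ^ p\<close> leaves
  \<open>ev a' * m - f k * s\<close> in the span of \<open>T\<close>. Once \<open>s\<close> is
  itself a multiple of \<open>ev a'\<close> modulo that span, the induction hypothesis at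
  \<open>a'\<close> places \<open>m\<close> minus a multiple of \<open>f k\<close> in
  \<open>lin k\<close>.\<close>

lemma detects_Suc:
  assumes d: "detects k" and k: "k < K"
  shows "detects (Suc k)"
  unfolding detects_def
proof (intro allI impI)
  fix S a m
  assume S: "upclosed (Suc k) S" "finite (exps (Suc k) - S)" and a: "a \<in> exps (Suc k) - S" and m: "m \<in> M"
    and am: "ev a * m \<in> mspan S"
  obtain a' p where a': "a' \<in> exps k" "a = a' + Poly_Mapping.single k p"
    using exps_Suc_cases[of a k] a by auto
  define T where "T = {b \<in> exps k. b + Poly_Mapping.single k p \<in> S}"
  have Sup: "b + c \<in> S" if "b \<in> S" "c \<in> exps (Suc k)" for b c using S(1) that by (auto simp: upclosed_def)
  have T: "upclosed k T"
    unfolding upclosed_def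
  proof (intro conjI ballI)
    fix b c assume b: "b \<in> T" and c: "c \<in> exps k"
    have "b + Poly_Mapping.single k p + c \<in> S"
      by (rule Sup) (use b exps_mono[OF c] in \<open>simp_all add: T_def\<close>)
    then show "b + c \<in> T" using b c by (auto simp: T_def exps_add add_ac)
  qed (auto simp: T_def)
  have finT: "finite (exps k - T)"
  proof (rule inj_on_finite[OF _ _ S(2)])
    show "inj_on (\<lambda>b. b + Poly_Mapping.single k p) (exps k - T)" by (auto simp: inj_on_def)
    show "(\<lambda>b. b + Poly_Mapping.single k p) ` (exps k - T) \<subseteq> exps (Suc k) - S"
    proof (rule image_subsetI)
      fix b assume "b \<in> exps k - T"
      then show "b + Poly_Mapping.single k p \<in> exps (Suc k) - S"
        using exps_add[OF exps_mono[of b k "Suc k"] single_in_exps[of k "Suc k" p]] by (simp add: T_def)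
    qed
  qed
  have aT: "a' \<notin> T" using a a' by (auto simp: T_def)
  \<comment> \<open>Terms with exponent at most \<open>p\<close> at \<open>k\<close> can be raised
    to height \<open>p\<close> within \<open>S\<close>, so the rest of their exponent lies in
    \<open>T\<close>; all other terms are divisible by \<open>f k ^ Suc p\<close>.\<close>
  have split: "\<exists>s\<in>M. x - f k ^ Suc p * s \<in> mspan T" if "x \<in> mspan S" for x
    using that
  proof induction
    case mspan_0
    show ?case by (rule bexI[OF _ M_0]) (simp add: mspan.mspan_0)
  next
    case (mspan_step x b m)
    then obtain s where s: "s \<in> M" "x - f k ^ Suc p * s \<in> mspan T" by blast
    obtain c q where c: "c \<in> exps k" "b = c + Poly_Mapping.single k q"
      using exps_Suc_cases[of b k] mspan_step S(1) by (auto simp: upclosed_def)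
    have ev: "ev b = ev c * f k ^ q" using c k by (simp add: ev_add ev_single)
    show ?case
    proof (cases "q \<le> p")
      case True
      have "b + Poly_Mapping.single k (p - q) \<in> S" using mspan_step by (intro Sup single_in_exps) auto
      moreover have "b + Poly_Mapping.single k (p - q) = c + Poly_Mapping.single k p"
        using True c by (simp add: add.assoc single_add[symmetric])
      ultimately have "c \<in> T" using c by (simp add: T_def)
      then have "ev c * (f k ^ q * m) + (x - f k ^ Suc p * s) \<in> mspan T"
        using s mspan_step k by (intro mspan.mspan_step M_power) auto
      then show ?thesis using s by (intro bexI[of _ s]) (auto simp: ev algebra_simps)
    next
      case False
      then have "q = Suc p + (q - Suc p)" by simp
      then have "f k ^ q = f k ^ Suc p * f k ^ (q - Suc p)" by (metis power_add)
      then have eq: "ev b * m + x - f k ^ Suc p * (ev c * (f k ^ (q - Suc p) * m) + s) = x - f k ^ Suc p * s"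
        by (simp add: ev algebra_simps)
      have "ev c * (f k ^ (q - Suc p) * m) + s \<in> M" using s mspan_step k by (intro M_add M_ev M_power)
      then show ?thesis using s(2) unfolding eq[symmetric] by blast
    qed
  qed
  obtain s where s: "s \<in> M" "ev a * m - f k ^ Suc p * s \<in> mspan T" using split[OF am] by blast
  have "ev a * m - f k ^ Suc p * s = f k ^ p * (ev a' * m - f k * s)"
    using a' k by (simp add: ev_add ev_single algebra_simps)
  then have "f k ^ p * (ev a' * m - f k * s) \<in> mspan T" using s(2) by metis
  then have v: "ev a' * m - f k * s \<in> mspan T"
    by (rule detects_cancel_power[OF d k T finT, rotated]) (intro M_diff M_ev M_mult m k s(1))
  \<comment> \<open>Adjoining the multiples of \<open>a'\<close> to \<open>T\<close> brings
    \<open>f k * s\<close> into the span; cancelling \<open>f k\<close> then exhibits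
    \<open>s\<close> as a multiple of \<open>ev a'\<close> modulo \<open>mspan T\<close>.\<close>
  define U where "U = T \<union> (\<lambda>c. a' + c) ` exps k"
  have U: "upclosed k U"
    using T a' by (auto simp: U_def upclosed_def exps_add add.assoc)
  have finU: "finite (exps k - U)" using finT by (rule finite_subset[rotated]) (auto simp: U_def)
  have a'U: "a' \<in> U" using imageI[OF zero_in_exps[of k], of "\<lambda>c. a' + c"] by (simp add: U_def)
  have "T \<subseteq> U" by (simp add: U_def)
  have "ev a' * m - (ev a' * m - f k * s) \<in> mspan U"
    by (rule mspan_diff[OF mspan_ev[OF a'U m] mspan_mono[OF v \<open>T \<subseteq> U\<close>]])
  then have "f k * s \<in> mspan U" by simp
  then have "s \<in> mspan U" by (rule detects_cancel[OF d k U finU s(1)])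
  moreover have "\<exists>s1\<in>M. x - ev a' * s1 \<in> mspan T" if "x \<in> mspan U" for x
    using that
  proof induction
    case mspan_0
    show ?case by (rule bexI[OF _ M_0]) (simp add: mspan.mspan_0)
  next
    case (mspan_step x b m)
    then obtain s1 where s1: "s1 \<in> M" "x - ev a' * s1 \<in> mspan T" by blast
    show ?case
    proof (cases "b \<in> T")
      case True
      then have "ev b * m + (x - ev a' * s1) \<in> mspan T" using s1 mspan_step by (intro mspan.mspan_step) auto
      then show ?thesis using s1 by (intro bexI[of _ s1]) (auto simp: algebra_simps)
    next
      case False
      then obtain c where "b = a' + c" using mspan_step by (auto simp: U_def)
      then have eq: "ev b * m + x - ev a' * (ev c * m + s1) = x - ev a' * s1" by (simp add: ev_add algebra_simps)
      have "ev c * m + s1 \<in> M" using s1 mspan_step by (intro M_add M_ev)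
      then show ?thesis using s1(2) unfolding eq[symmetric] by blast
    qed
  qed
  ultimately obtain s1 where s1: "s1 \<in> M" "s - ev a' * s1 \<in> mspan T" by blast
  have "(ev a' * m - f k * s) + f k * (s - ev a' * s1) \<in> mspan T"
    using k by (intro mspan_add mspan_mult v s1) auto
  then have "ev a' * (m - f k * s1) \<in> mspan T" by (simp add: algebra_simps)
  moreover have "m - f k * s1 \<in> M" using m s1 k by (intro M_diff M_mult)
  ultimately have "m - f k * s1 \<in> lin k" using d T finT a' aT unfolding detects_def by blast
  then show "m \<in> lin (Suc k)" using s1 by (intro lin_Suc)
qed

lemma detects: "k \<le> K \<Longrightarrow> detects k"
proof (induction k)
  case 0
  show ?case unfolding detects_def
  proof (intro allI impI)
    fix S a m assume "a \<in> exps 0 - S" "upclosed 0 S" "ev a * m \<in> mspan S"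
    then have "a = 0" "S = {}" "ev a * m \<in> mspan S" by (auto simp: exps_0 upclosed_def)
    then show "m \<in> lin 0" by (simp add: mspan_empty lin_def)
  qed
qed (simp add: detects_Suc)

text \<open>The weight separates exponents of bounded degree while staying additive, so that every graded
  piece of the filtration below is generated by a single power product.\<close>
definition weight :: "nat \<Rightarrow> (nat \<Rightarrow>\<^sub>0 nat) \<Rightarrow> nat"
  where "weight B b = (\<Sum>i<K. Poly_Mapping.lookup b i * (B ^ K + B ^ i))"

definition filt :: "nat \<Rightarrow> nat \<Rightarrow> 'r set"
  where "filt B n = mspan {b \<in> exps K. n \<le> weight B b}"

lemma weight_add: "weight B (b + c) = weight B b + weight B c"
  by (simp add: weight_def lookup_add add_mult_distrib sum.distrib)

lemma weight_eq: "b \<in> exps K \<Longrightarrow> weight B b = exp_deg b * B ^ K + (\<Sum>i<K. Poly_Mapping.lookup b i * B ^ i)"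
  by (simp add: weight_def exp_deg_sum add_mult_distrib2 sum.distrib sum_distrib_right)

lemma weight_le: "b \<in> exps K \<Longrightarrow> 0 < B \<Longrightarrow> weight B b \<le> exp_deg b * (2 * B ^ K)"
  unfolding weight_def exp_deg_sum sum_distrib_right
  by (intro sum_mono mult_left_mono) (auto intro!: power_increasing)

text \<open>A weight below \<open>B ^ Suc K\<close> forces the degree, hence every exponent, below
  \<open>B\<close>; the exponents are then the base \<open>B\<close> digits of the weight modulo
  \<open>B ^ K\<close>.\<close>

lemma weight_unique:
  assumes b: "b \<in> exps K" and c: "c \<in> exps K" and e: "weight B b = weight B c"
    and lt: "weight B b < B ^ Suc K"
  shows "b = c"
proof -
  have B: "B > 0" using lt by (cases "B = 0") auto
  have small: "Poly_Mapping.lookup d i < B" if d: "d \<in> exps K" "weight B d < B ^ Suc K" for d i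
  proof -
    have "exp_deg d * B ^ K < B * B ^ K" using d(2) unfolding weight_eq[OF d(1)] power_Suc by linarith
    then have "exp_deg d < B" using B by simp
    moreover have "Poly_Mapping.lookup d i \<le> exp_deg d"
      unfolding exp_deg_def using member_le_sum[of i "Poly_Mapping.keys d" "Poly_Mapping.lookup d"]
      by (cases "i \<in> Poly_Mapping.keys d") (auto simp: in_keys_iff)
    ultimately show ?thesis by simp
  qed
  let ?X = "\<Sum>i<K. Poly_Mapping.lookup b i * B ^ i" and ?Y = "\<Sum>i<K. Poly_Mapping.lookup c i * B ^ i"
  have sb: "\<And>i. Poly_Mapping.lookup b i < B" using small[OF b lt] .
  have sc: "\<And>i. Poly_Mapping.lookup c i < B" using small[OF c] lt e by simp
  have "?X < B ^ K" "?Y < B ^ K" using sb sc by (auto intro!: digits_less)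
  then have "weight B b mod B ^ K = ?X" "weight B c mod B ^ K = ?Y"
    by (simp_all add: weight_eq b c)
  then have "?X = ?Y" using e by simp
  then have "Poly_Mapping.lookup b i = Poly_Mapping.lookup c i" if "i < K" for i
    using digits_unique[of _ B K _ i] sb sc that by blast
  moreover have "Poly_Mapping.lookup b i = 0" "Poly_Mapping.lookup c i = 0" if "\<not> i < K" for i
    using b c that by (auto simp: exps_def in_keys_iff)
  ultimately show ?thesis by (intro poly_mapping_eqI) metis
qed

lemma filt_0: "x \<in> M \<Longrightarrow> x \<in> filt B 0"
  unfolding filt_def using mspan_ev[of 0 "{b \<in> exps K. 0 \<le> weight B b}" x] by simp

lemma filt_subset: "x \<in> filt B n \<Longrightarrow> x \<in> M"
  unfolding filt_def by (rule mspan_subset)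

lemma filt_mono: "x \<in> filt B n \<Longrightarrow> m \<le> n \<Longrightarrow> x \<in> filt B m"
  unfolding filt_def by (erule mspan_mono) auto

lemma filt_scale: "(\<And>m. m \<in> M \<Longrightarrow> s * m \<in> M) \<Longrightarrow> x \<in> filt B n \<Longrightarrow> s * x \<in> filt B n"
  unfolding filt_def by (rule mspan_scale)

lemma filt_sum: "(\<And>i. i \<in> A \<Longrightarrow> h i \<in> filt B n) \<Longrightarrow> sum h A \<in> filt B n"
  unfolding filt_def by (induction A rule: infinite_finite_induct) (auto intro: mspan_add mspan_0)

lemmas filt_add = mspan_add[of _ "{b \<in> exps K. n \<le> weight B b}" for n B, folded filt_def]
lemmas filt_diff = mspan_diff[of _ "{b \<in> exps K. n \<le> weight B b}" for n B, folded filt_def]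

lemma filt_ev: "x \<in> filt B n \<Longrightarrow> c \<in> exps K \<Longrightarrow> ev c * x \<in> filt B (n + weight B c)"
  unfolding filt_def by (erule mspan_mult_ev) (auto simp: weight_add exps_add)

lemma filt_ev_M: "m \<in> M \<Longrightarrow> c \<in> exps K \<Longrightarrow> ev c * m \<in> filt B (weight B c)"
  using filt_ev[OF filt_0, of m c B] by simp

lemma filt_ev_lin:
  assumes "m \<in> lin K" "c \<in> exps K" "0 < B"
  shows "ev c * m \<in> filt B (Suc (weight B c))"
  unfolding filt_def
proof (rule lin_ev[OF assms(1)])
  fix l assume l: "l < K"
  have "1 \<le> exp_deg (Poly_Mapping.single l (1::nat))"
    using exp_deg_pos[of "Poly_Mapping.single l (1::nat)"] by (simp add: single_eq_0_iff)
  then have "1 * B ^ K \<le> exp_deg (Poly_Mapping.single l (1::nat)) * B ^ K" by (intro mult_right_mono) auto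
  then have "B ^ K \<le> weight B (Poly_Mapping.single l 1)"
    using weight_eq[OF single_in_exps[OF l], of B 1] by linarith
  moreover have "B ^ K > 0" using assms(3) by simp
  ultimately have "0 < weight B (Poly_Mapping.single l 1)" by linarith
  then have "Suc (weight B c) \<le> weight B (c + Poly_Mapping.single l 1)" by (simp add: weight_add)
  then show "c + Poly_Mapping.single l 1 \<in> {b \<in> exps K. Suc (weight B c) \<le> weight B b}"
    using assms(2) l by (simp add: exps_add single_in_exps)
qed simp

text \<open>Every variable has positive weight, so only finitely many exponents are at most as heavy
  as \<open>c\<close>, and \<open>detects\<close> applies to the set of the heavier ones.\<close>

lemma filt_detects:
  assumes "ev c * m \<in> filt B (Suc (weight B c))" "c \<in> exps K" "m \<in> M" "0 < B"
  shows "m \<in> lin K"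
proof -
  let ?S = "{b \<in> exps K. Suc (weight B c) \<le> weight B b}"
  have "upclosed K ?S" by (auto simp: upclosed_def exps_add weight_add)
  moreover have "finite (exps K - ?S)"
  proof -
    have "exps K - ?S \<subseteq> {b \<in> exps K. weight B b < Suc (weight B c)}" by auto
    moreover have "finite {b \<in> exps K. weight B b < Suc (weight B c)}" (is "finite ?T")
    proof (rule inj_on_finite)
      let ?n = "Suc (weight B c)"
      show "inj_on (\<lambda>b. \<lambda>i\<in>{..<K}. Poly_Mapping.lookup b i) ?T"
      proof (rule inj_onI)
        fix b d assume bd: "b \<in> ?T" "d \<in> ?T"
          "(\<lambda>i\<in>{..<K}. Poly_Mapping.lookup b i) = (\<lambda>i\<in>{..<K}. Poly_Mapping.lookup d i)"
        have "Poly_Mapping.lookup b i = Poly_Mapping.lookup d i" for i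
        proof (cases "i < K")
          case True
          then show ?thesis using fun_cong[OF bd(3), of i] by simp
        next
          case False
          then have "Poly_Mapping.lookup b i = 0" "Poly_Mapping.lookup d i = 0"
            using bd(1,2) by (auto simp: exps_def in_keys_iff)
          then show ?thesis by simp
        qed
        then show "b = d" by (rule poly_mapping_eqI)
      qed
      show "(\<lambda>b. \<lambda>i\<in>{..<K}. Poly_Mapping.lookup b i) ` ?T \<subseteq> {..<K} \<rightarrow>\<^sub>E {..<?n}"
      proof (intro image_subsetI PiE_I)
        fix b i assume b: "b \<in> ?T" and i: "i \<in> {..<K}"
        have "Poly_Mapping.lookup b i * 1 \<le> Poly_Mapping.lookup b i * (B ^ K + B ^ i)"
          using assms(4) by (intro mult_left_mono) (auto simp: Suc_le_eq)
        also have "\<dots> \<le> weight B b"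
          unfolding weight_def by (rule member_le_sum[OF i]) auto
        finally show "(\<lambda>i\<in>{..<K}. Poly_Mapping.lookup b i) i \<in> {..<?n}" using b i by simp
      qed auto
      show "finite ({..<K} \<rightarrow>\<^sub>E {..<?n})" by (intro finite_PiE) auto
    qed
    ultimately show ?thesis by (rule finite_subset)
  qed
  moreover have "c \<in> exps K - ?S" using assms(2) by simp
  ultimately show ?thesis
    using detects[OF order_refl] assms unfolding detects_def filt_def by blast
qed

text \<open>Below \<open>B ^ Suc K\<close> at most one exponent has a given weight, so two
  consecutive terms of the filtration differ by multiples of one power product or not at
  all.\<close>

lemma filt_leading:
  assumes x: "x \<in> filt B n" and n: "n < B ^ Suc K" and nx: "x \<notin> filt B (Suc n)"
  obtains c m where "c \<in> exps K" "weight B c = n" "m \<in> M" "x - ev c * m \<in> filt B (Suc n)"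
proof -
  let ?S = "\<lambda>n. {b \<in> exps K. n \<le> weight B b}"
  have "?S n \<noteq> ?S (Suc n)" using x nx unfolding filt_def by metis
  then obtain c where c: "c \<in> exps K" "weight B c = n" by (auto simp: Suc_le_eq le_less)
  have "?S n = insert c (?S (Suc n))"
  proof -
    have "b \<in> insert c (?S (Suc n))" if b: "b \<in> ?S n" for b
    proof (cases "weight B b = n")
      case True
      then show ?thesis using weight_unique[of b c B] b c n by simp
    next
      case False
      then show ?thesis using b by simp
    qed
    then show ?thesis using c by auto
  qed
  then obtain m where "m \<in> M" "x - ev c * m \<in> filt B (Suc n)"
    using mspan_insert[of x c "?S (Suc n)"] x unfolding filt_def by auto
  then show thesis using that c by blast
qed

text \<open>If the \<open>g i\<close> have leading power products without a common variable, then elements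
  proportional to the \<open>g i\<close> are, to any finite order, multiples of the \<open>g i\<close> by one element of \<open>M\<close>.\<close>
lemma common_quotient:
  fixes g a :: "nat \<Rightarrow> 'r" and e :: "nat \<Rightarrow> nat \<Rightarrow>\<^sub>0 nat"
  assumes B: "0 < B"
    and e: "\<And>i. i < K \<Longrightarrow> e i \<in> exps K" "\<And>i. i < K \<Longrightarrow> Poly_Mapping.lookup (e i) i = 0"
      "\<And>i. i < K \<Longrightarrow> weight B (e i) \<le> \<Delta>"
    and g: "\<And>i x n. i < K \<Longrightarrow> x \<in> filt B n \<Longrightarrow> (g i - ev (e i)) * x \<in> filt B (Suc (n + weight B (e i)))"
    and a: "\<And>i. i < K \<Longrightarrow> a i \<in> M" "\<And>i j. i < K \<Longrightarrow> j < K \<Longrightarrow> g i * a j = g j * a i"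
    and N: "N + \<Delta> < B ^ Suc K"
  shows "\<exists>c\<in>M. \<forall>i<K. a i - g i * c \<in> filt B (N + weight B (e i) - \<Delta>)"
  using N
proof (induction N)
  case 0
  \<comment> \<open>The weights are at most \<Delta>, so the truncated order is 0 at the start and
    the quotient 0 will do.\<close>
  have "a i - g i * 0 \<in> filt B (0 + weight B (e i) - \<Delta>)" if "i < K" for i
    using e(3)[OF that] a(1)[OF that] by (simp add: filt_0)
  then show ?case using M_0 by blast
next
  case (Suc n)
  let ?d = "\<lambda>i. weight B (e i)"
  obtain c where c: "c \<in> M" "\<And>i. i < K \<Longrightarrow> a i - g i * c \<in> filt B (n + ?d i - \<Delta>)"
    using Suc by auto
  define r where "r i = a i - g i * c" for i
  have r: "r i \<in> filt B (n + ?d i - \<Delta>)" if "i < K" for i using c(2)[OF that] by (simp add: r_def)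
  have gr: "g i * r j = g j * r i" if "i < K" "j < K" for i j
    using a(2)[OF that] by (simp add: r_def algebra_simps)
  have gfilt: "g i * x \<in> filt B (m + ?d i)" if "i < K" "x \<in> filt B m" for i x m
  proof -
    have "(g i - ev (e i)) * x + ev (e i) * x \<in> filt B (m + ?d i)"
      using that e(1) by (intro filt_add filt_ev filt_mono[OF g[OF that]]) auto
    then show ?thesis by (simp add: algebra_simps)
  qed
  have gev: "g i * x - ev (e i + b) * m \<in> filt B (Suc (?d i + k))"
    if i: "i < K" and x: "x \<in> filt B k" "x - ev b * m \<in> filt B (Suc k)" for i x b m k
  proof -
    have "(g i - ev (e i)) * x + ev (e i) * (x - ev b * m) \<in> filt B (Suc (?d i + k))"
      using g[OF i x(1)] filt_ev[OF x(2) e(1)[OF i]] by (intro filt_add) (auto simp: add_ac)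
    then show ?thesis by (simp add: algebra_simps ev_add)
  qed
  show ?case
  proof (cases "\<forall>i<K. r i \<in> filt B (Suc n + ?d i - \<Delta>)")
    case True
    then show ?thesis using c(1) unfolding r_def by blast
  next
    case False
    then obtain j where j: "j < K" "r j \<notin> filt B (Suc n + ?d j - \<Delta>)" by blast
    \<comment> \<open>Otherwise the order demanded of \<open>r j\<close> would be truncated to 0 and
      hold trivially.\<close>
    have act: "\<Delta> \<le> n + ?d j"
    proof (rule ccontr)
      assume "\<not> \<Delta> \<le> n + ?d j"
      then show False using j r[OF j(1)] by (auto dest!: filt_subset filt_0[of _ B])
    qed
    define k where "k i = n + ?d i - \<Delta>" for i
    have kj: "Suc n + ?d j - \<Delta> = Suc (k j)" "k j + \<Delta> = n + ?d j" using act by (simp_all add: k_def Suc_diff_le)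
    have klt: "k i < B ^ Suc K" if "i < K" for i using Suc.prems e(3)[OF that] by (simp add: k_def)
    obtain b m where b: "b \<in> exps K" "weight B b = k j" and m: "m \<in> M" "r j - ev b * m \<in> filt B (Suc (k j))"
      using filt_leading[of "r j" B "k j"] r[OF j(1)] klt[OF j(1)] j kj by (auto simp: k_def)
    have mlin: "m \<notin> lin K"
    proof
      assume "m \<in> lin K"
      then have "ev b * m \<in> filt B (Suc (k j))" using filt_ev_lin[of m b B] b B by simp
      then have "(r j - ev b * m) + ev b * m \<in> filt B (Suc (k j))" using m by (intro filt_add)
      then show False using j kj by simp
    qed
    \<comment> \<open>\<open>g j * r i\<close> equals \<open>g i * r j\<close>, whose leading term
      \<open>ev (e i + b) * m\<close> has its coefficient \<open>m\<close> outside
      \<open>lin K\<close>.\<close>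
    have not_higher: "g j * r i \<notin> filt B (Suc (?d i + k j))" if i: "i < K" for i
    proof
      assume h: "g j * r i \<in> filt B (Suc (?d i + k j))"
      have "g i * r j - ev (e i + b) * m \<in> filt B (Suc (?d i + k j))"
        using r[OF j(1)] m(2) by (intro gev i) (simp_all add: k_def)
      with h have "g j * r i - (g i * r j - ev (e i + b) * m) \<in> filt B (Suc (?d i + k j))"
        by (rule filt_diff)
      then have "ev (e i + b) * m \<in> filt B (Suc (weight B (e i + b)))"
        using gr[OF i j(1)] b by (simp add: weight_add)
      then have "m \<in> lin K"
        using e(1)[OF i] b m B by (intro filt_detects[of "e i + b"]) (auto simp: exps_add)
      then show False using mlin by contradiction
    qed
    \<comment> \<open>Hence every \<open>r i\<close> has a leading term of the expected weight; as
      the weight determines the exponent, \<open>e i + b = e j + b'\<close>.\<close>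
    have lead: "\<exists>b' m'. b' \<in> exps K \<and> weight B b' = k i \<and> m' \<in> M \<and> r i - ev b' * m' \<in> filt B (Suc (k i)) \<and>
        e i + b = e j + b' \<and> Suc n + ?d i - \<Delta> = Suc (k i)" if i: "i < K" for i
    proof -
      have ai: "\<Delta> \<le> n + ?d i"
      proof (rule ccontr)
        assume "\<not> \<Delta> \<le> n + ?d i"
        then have "Suc (?d i + k j) \<le> 0 + ?d j" using kj by linarith
        moreover have "g j * r i \<in> filt B (0 + ?d j)"
          using r[OF i] by (intro gfilt j) (auto intro: filt_0 filt_subset)
        ultimately show False using not_higher[OF i] filt_mono by blast
      qed
      have eq: "?d i + k j = ?d j + k i" using ai act by (simp add: k_def)
      have "r i \<notin> filt B (Suc (k i))"
      proof
        assume "r i \<in> filt B (Suc (k i))"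
        then have "g j * r i \<in> filt B (Suc (k i) + ?d j)" by (intro gfilt j)
        then show False using not_higher[OF i] eq by (simp add: add_ac)
      qed
      then obtain b' m' where b': "b' \<in> exps K" "weight B b' = k i" "m' \<in> M" "r i - ev b' * m' \<in> filt B (Suc (k i))"
        using filt_leading[of "r i" B "k i"] r[OF i] klt[OF i] by (auto simp: k_def)
      have "?d i + k j < B ^ Suc K" using Suc.prems e(3)[OF i] e(3)[OF j(1)] kj by linarith
      then have "e i + b = e j + b'"
        using e(1) i j(1) b b' eq by (intro weight_unique[of _ _ B]) (auto simp: weight_add exps_add)
      then show ?thesis using b' ai by (auto simp: k_def Suc_diff_le)
    qed
    \<comment> \<open>The variable \<open>i\<close> is absent from \<open>e i\<close>, so comparing
      its exponents in \<open>e i + b = e j + b'\<close> bounds that of \<open>e j\<close> by that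
      of \<open>b\<close>. Over all \<open>i\<close> this says that the power product of
      \<open>e j\<close> divides that of \<open>b\<close>.\<close>
    have le: "Poly_Mapping.lookup (e j) i \<le> Poly_Mapping.lookup b i" for i
    proof (cases "i < K")
      case True
      then obtain b' where "e i + b = e j + b'" using lead by blast
      then have "Poly_Mapping.lookup (e i + b) i = Poly_Mapping.lookup (e j + b') i" by simp
      then show ?thesis using e(2)[OF True] by (simp add: lookup_add)
    next
      case False
      then have "Poly_Mapping.lookup (e j) i = 0" using e(1)[OF j(1)] by (auto simp: exps_def in_keys_iff)
      then show ?thesis by simp
    qed
    define q where "q = b - e j"
    have q: "b = e j + q"
      by (rule poly_mapping_eqI) (use le in \<open>simp add: q_def lookup_add lookup_minus\<close>)
    have qK: "q \<in> exps K" using b(1) q by (simp add: exps_def keys_add_nat)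
    have "a i - g i * (c + ev q * m) \<in> filt B (Suc n + ?d i - \<Delta>)" if i: "i < K" for i
    proof -
      obtain b' m' where b': "b' \<in> exps K" "weight B b' = k i" "m' \<in> M" "r i - ev b' * m' \<in> filt B (Suc (k i))"
        and eb: "e i + b = e j + b'" and S: "Suc n + ?d i - \<Delta> = Suc (k i)" using lead[OF i] by blast
      have b'q: "b' = e i + q" using eb q by (metis add.left_commute add_left_cancel)
      have w: "weight B (e i + b) = ?d i + k j" "weight B (e i + b) = ?d j + k i"
        using b by (simp add: weight_add) (use b' in \<open>simp add: eb weight_add\<close>)
      have "g i * r j - ev (e i + b) * m \<in> filt B (Suc (?d i + k j))"
        using r[OF j(1)] m(2) by (intro gev i) (simp_all add: k_def)
      moreover have "g j * r i - ev (e j + b') * m' \<in> filt B (Suc (?d j + k i))"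
        using r[OF i] b'(4) by (intro gev j) (simp_all add: k_def)
      ultimately have "(g j * r i - ev (e j + b') * m') - (g i * r j - ev (e i + b) * m) \<in>
          filt B (Suc (weight B (e i + b)))" unfolding w(1) w(2)[symmetric, unfolded w(1)] by (rule filt_diff[rotated])
      then have "ev (e i + b) * (m - m') \<in> filt B (Suc (weight B (e i + b)))"
        using gr[OF i j(1)] eb by (simp add: algebra_simps)
      \<comment> \<open>The leading coefficients agree modulo \<open>lin K\<close>, so one
        correction \<open>ev q * m\<close> raises the order for all \<open>i\<close> at
        once.\<close>
      then have "m - m' \<in> lin K"
        using e(1)[OF i] b m b' B by (intro filt_detects[of "e i + b"]) (auto simp: exps_add M_diff)
      then have "ev b' * (m - m') \<in> filt B (Suc (k i))" using filt_ev_lin[of _ b' B] b' B by simp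
      moreover have "(g i - ev (e i)) * (ev q * m) \<in> filt B (Suc (k i))"
        using g[OF i filt_ev_M[OF m(1) qK, of B]] b'(2) b'q by (simp add: weight_add add_ac)
      ultimately have "(r i - ev b' * m') - ev b' * (m - m') - (g i - ev (e i)) * (ev q * m) \<in> filt B (Suc (k i))"
        by (rule filt_diff[OF filt_diff[OF b'(4)]])
      also have "(r i - ev b' * m') - ev b' * (m - m') - (g i - ev (e i)) * (ev q * m) = a i - g i * (c + ev q * m)"
        by (simp add: b'q r_def ev_add algebra_simps)
      finally show ?thesis using S by simp
    qed
    then show ?thesis using c(1) m(1) by (intro bexI[of _ "c + ev q * m"]) (auto intro: M_add M_ev)
  qed
qed

end

section \<open>Depth of squarefree monomial ideals\<close>

lemma homogeneous_system_nontrivial: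
  fixes a :: "'b \<Rightarrow> 't \<Rightarrow> 'a::field"
  assumes "finite T" "finite X" "card T < card X"
  shows "\<exists>c. (\<exists>b\<in>X. c b \<noteq> 0) \<and> (\<forall>u\<in>T. (\<Sum>b\<in>X. c b * a b u) = 0)"
  using assms
proof (induction T arbitrary: X a)
  case empty
  then obtain b where "b \<in> X" by fastforce
  then show ?case by (intro exI[of _ "\<lambda>_. 1"]) auto
next
  case (insert t T)
  show ?case
  proof (cases "\<forall>b\<in>X. a b t = 0")
    case True
    obtain c where "\<exists>b\<in>X. c b \<noteq> 0" "\<forall>u\<in>T. (\<Sum>b\<in>X. c b * a b u) = 0"
      using insert.IH[of X a] insert.prems insert.hyps by auto
    then show ?thesis using True by (intro exI[of _ c]) auto
  next
    case False
    then obtain p where p: "p \<in> X" "a p t \<noteq> 0" by blast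
    \<comment> \<open>Gaussian elimination: the equation \<open>t\<close> is used to eliminate the
      unknown \<open>p\<close>, whose value is restored in \<open>c'\<close>.\<close>
    let ?X = "X - {p}" and ?a = "\<lambda>b u. a b u - a b t / a p t * a p u"
    have "finite ?X" "card T < card ?X" using insert.prems insert.hyps p by auto
    from insert.IH[OF this, of ?a]
    obtain c where c: "\<exists>b\<in>?X. c b \<noteq> 0" "\<forall>u\<in>T. (\<Sum>b\<in>?X. c b * ?a b u) = 0" by blast
    define s where "s = (\<Sum>b\<in>?X. c b * a b t)"
    define c' where "c' = c(p := - s / a p t)"
    have sum: "(\<Sum>b\<in>X. c' b * a b u) = (\<Sum>b\<in>?X. c b * a b u) - s / a p t * a p u" for u
    proof -
      have "(\<Sum>b\<in>X. c' b * a b u) = c' p * a p u + (\<Sum>b\<in>?X. c' b * a b u)"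
        using insert.prems(1) p(1) by (simp add: sum.remove)
      moreover have "(\<Sum>b\<in>?X. c' b * a b u) = (\<Sum>b\<in>?X. c b * a b u)"
        by (rule sum.cong) (auto simp: c'_def)
      ultimately show ?thesis by (simp add: c'_def)
    qed
    have "(\<Sum>b\<in>X. c' b * a b u) = 0" if u: "u \<in> insert t T" for u
    proof (cases "u = t")
      case True
      then show ?thesis using p(2) unfolding sum by (simp add: s_def)
    next
      case False
      have "(\<Sum>b\<in>?X. c b * ?a b u) = (\<Sum>b\<in>?X. c b * a b u - c b * a b t * (a p u / a p t))"
        by (rule sum.cong) (auto simp: algebra_simps)
      also have "\<dots> = (\<Sum>b\<in>?X. c b * a b u) - s * (a p u / a p t)"
        by (simp add: sum_subtractf sum_distrib_right sum_divide_distrib s_def)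
      finally show ?thesis using c(2) u False unfolding sum by (simp add: algebra_simps)
    qed
    moreover have "\<exists>b\<in>X. c' b \<noteq> 0" using c(1) by (auto simp: c'_def)
    ultimately show ?thesis by blast
  qed
qed

lemma bij_betw_bounded_exps:
  assumes A: "finite A" and L: "0 < L"
  shows "bij_betw (\<lambda>u. restrict (Poly_Mapping.lookup u) A)
    {u. Poly_Mapping.keys u \<subseteq> A \<and> (\<forall>v. Poly_Mapping.lookup u v < L)} (A \<rightarrow>\<^sub>E {..<L::nat})"
proof (rule bij_betw_imageI)
  let ?T = "{u. Poly_Mapping.keys u \<subseteq> A \<and> (\<forall>v. Poly_Mapping.lookup u v < L)}"
  let ?r = "\<lambda>u. restrict (Poly_Mapping.lookup u) A"
  show "inj_on ?r ?T"
  proof (rule inj_onI)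
    fix u v assume uv: "u \<in> ?T" "v \<in> ?T" "?r u = ?r v"
    have "Poly_Mapping.lookup u i = Poly_Mapping.lookup v i" for i
    proof (cases "i \<in> A")
      case True
      then show ?thesis using fun_cong[OF uv(3), of i] by simp
    next
      case False
      then have "i \<notin> Poly_Mapping.keys u" "i \<notin> Poly_Mapping.keys v" using uv by auto
      then show ?thesis by (simp add: in_keys_iff)
    qed
    then show "u = v" by (rule poly_mapping_eqI)
  qed
  show "?r ` ?T = A \<rightarrow>\<^sub>E {..<L}"
  proof (intro equalityI subsetI)
    fix g assume g: "g \<in> A \<rightarrow>\<^sub>E {..<L}"
    let ?u = "\<Sum>i\<in>A. Poly_Mapping.single i (g i)"
    have l: "Poly_Mapping.lookup ?u v = (if v \<in> A then g v else 0)" for v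
      using A by (simp add: lookup_sum lookup_single when_def)
    have "g = ?r ?u"
    proof
      fix v
      show "g v = ?r ?u v" using g l[of v] by (cases "v \<in> A") (auto simp: PiE_iff extensional_def)
    qed
    moreover have "?u \<in> ?T" using g L by (auto simp: in_keys_iff l split: if_splits)
    ultimately show "g \<in> ?r ` ?T" by blast
  qed auto
qed

lemma bounded_exps:
  assumes "finite A" "0 < L"
  shows "finite {u. Poly_Mapping.keys u \<subseteq> A \<and> (\<forall>v. Poly_Mapping.lookup u v < (L::nat))}"
    "card {u. Poly_Mapping.keys u \<subseteq> A \<and> (\<forall>v. Poly_Mapping.lookup u v < L)} = L ^ card A"
  using bij_betw_finite[OF bij_betw_bounded_exps[OF assms]] bij_betw_same_card[OF bij_betw_bounded_exps[OF assms]]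
    assms by (simp_all add: finite_PiE card_PiE)

lemma keys_mult_cases:
  assumes "u \<in> Poly_Mapping.keys (p * q)"
  obtains v w where "v \<in> Poly_Mapping.keys p" "w \<in> Poly_Mapping.keys q" "u = v + w"
  using assms keys_mult[of p q] by blast

lemma lookup_keys_power_product_le:
  fixes f :: "nat \<Rightarrow> 'a::field mpoly"
  assumes f: "\<And>i u v. i < K \<Longrightarrow> u \<in> Poly_Mapping.keys (f i) \<Longrightarrow> Poly_Mapping.lookup u v \<le> D"
    and u: "u \<in> Poly_Mapping.keys (\<Prod>i<K. f i ^ b i)"
  shows "Poly_Mapping.lookup u v \<le> D * (\<Sum>i<K. b i)"
  using assms
proof (induction K arbitrary: u)
  case (Suc K)
  note bound = Suc.prems(1)
  have pow: "Poly_Mapping.lookup w v \<le> D * q" if "w \<in> Poly_Mapping.keys (f K ^ q)" for w q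
    using that
  proof (induction q arbitrary: w)
    case (Suc q)
    then obtain w1 w2 where "w1 \<in> Poly_Mapping.keys (f K)" "w2 \<in> Poly_Mapping.keys (f K ^ q)" "w = w1 + w2"
      by (auto elim: keys_mult_cases)
    then show ?case using Suc.IH[of w2] bound[of K w1 v] by (simp add: lookup_add)
  qed (simp add: lookup_one split: if_splits)
  obtain w1 w2 where w: "w1 \<in> Poly_Mapping.keys (\<Prod>i<K. f i ^ b i)" "w2 \<in> Poly_Mapping.keys (f K ^ b K)" "u = w1 + w2"
    using Suc.prems(2) by (auto elim: keys_mult_cases)
  have "Poly_Mapping.lookup w1 v \<le> D * (\<Sum>i<K. b i)" 
    by (rule Suc.IH[OF _ w(1)]) (rule bound, simp_all)
  then show ?case using pow[OF w(2)] w(3) by (simp add: lookup_add distrib_left)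
qed (simp split: if_splits)

text \<open>A dimension count: for large \<open>L\<close>, the power products with exponents below \<open>L\<close> in the
  \<open>card A + 1\<close> polynomials \<open>f i\<close> with \<open>i \<noteq> j\<close> outnumber the monomials in the variables from \<open>A\<close> that
  can occur in them.\<close>
lemma algebraic_relations:
  fixes f :: "nat \<Rightarrow> 'a::field mpoly"
  assumes A: "finite A" and K: "K = card A + 2"
  shows "\<exists>d0. \<forall>j<K. \<exists>X c. finite X \<and> X \<subseteq> exps K \<and> (\<exists>b\<in>X. c b \<noteq> 0) \<and>
    (\<forall>b\<in>X. Poly_Mapping.lookup b j = 0 \<and> exp_deg b \<le> d0) \<and>
    (\<forall>u. Poly_Mapping.keys u \<subseteq> A \<longrightarrow>
      Poly_Mapping.lookup (\<Sum>b\<in>X. Poly_Mapping.single 0 (c b) * (\<Prod>i<K. f i ^ Poly_Mapping.lookup b i)) u = 0)"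
proof -
  let ?ev = "\<lambda>b. \<Prod>i<K. f i ^ Poly_Mapping.lookup b i"
  let ?W = "(\<lambda>(u, v). Poly_Mapping.lookup u v) `
      (\<Union>i<K. \<Union>u\<in>Poly_Mapping.keys (f i). {u} \<times> Poly_Mapping.keys u)"
  define D where "D = Max (insert 0 ?W)"
  have fW: "finite ?W" by auto
  have D: "Poly_Mapping.lookup u v \<le> D" if "i < K" "u \<in> Poly_Mapping.keys (f i)" for i u v
  proof (cases "v \<in> Poly_Mapping.keys u")
    case True
    then have "Poly_Mapping.lookup u v \<in> ?W" using that by force
    then show ?thesis unfolding D_def using fW by (intro Max_ge) auto
  qed (simp add: in_keys_iff)
  \<comment> \<open>The power products number L^(card A + 1), the possible monomials at most (L (D K
    + 1))^(card A); cancelling L^(card A) leaves the condition that \<open>L\<close> exceeds (D K +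
    1)^(card A).\<close>
  define L where "L = Suc ((D * K + 1) ^ card A)"
  have L: "0 < L" by (simp add: L_def)
  let ?T = "{u. Poly_Mapping.keys u \<subseteq> A \<and> (\<forall>v. Poly_Mapping.lookup u v < D * (K * L) + 1)}"
  have T: "finite ?T" "card ?T = (D * (K * L) + 1) ^ card A" using bounded_exps[OF A, of "D * (K * L) + 1"] by simp_all
  have "\<exists>X c. finite X \<and> X \<subseteq> exps K \<and> (\<exists>b\<in>X. c b \<noteq> 0) \<and>
      (\<forall>b\<in>X. Poly_Mapping.lookup b j = 0 \<and> exp_deg b \<le> K * L) \<and>
      (\<forall>u. Poly_Mapping.keys u \<subseteq> A \<longrightarrow>
        Poly_Mapping.lookup (\<Sum>b\<in>X. Poly_Mapping.single 0 (c b) * ?ev b) u = 0)" if j: "j < K" for j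
  proof -
    let ?X = "{b. Poly_Mapping.keys b \<subseteq> {..<K} - {j} \<and> (\<forall>v. Poly_Mapping.lookup b v < L)}"
    have X: "finite ?X" "card ?X = L ^ Suc (card A)"
      using bounded_exps[of "{..<K} - {j}" L] L j K by simp_all
    have XK: "b \<in> exps K" "Poly_Mapping.lookup b j = 0" "exp_deg b \<le> K * L" if "b \<in> ?X" for b
    proof -
      show b: "b \<in> exps K" using that by (auto simp: exps_def)
      have "j \<notin> Poly_Mapping.keys b" using that by blast
      then show "Poly_Mapping.lookup b j = 0" by (simp add: in_keys_iff)
      have "exp_deg b \<le> (\<Sum>i<K. L)" unfolding exp_deg_sum[OF b] using that by (intro sum_mono) (simp add: less_imp_le)
      then show "exp_deg b \<le> K * L" by simp
    qed
    have "D * (K * L) + 1 \<le> L * (D * K + 1)" using L by (simp add: algebra_simps)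
    then have "card ?T \<le> (L * (D * K + 1)) ^ card A" unfolding T(2) by (rule power_mono) simp
    also have "\<dots> = L ^ card A * (D * K + 1) ^ card A" by (rule power_mult_distrib)
    also have "\<dots> < L ^ card A * L" using L by (intro mult_strict_left_mono) (simp_all add: L_def)
    also have "\<dots> = card ?X" by (simp only: X(2) power_Suc mult.commute)
    finally have less: "card ?T < card ?X" .
    obtain c where c: "\<exists>b\<in>?X. c b \<noteq> 0" "\<forall>u\<in>?T. (\<Sum>b\<in>?X. c b * Poly_Mapping.lookup (?ev b) u) = 0"
      using homogeneous_system_nontrivial[OF T(1) X(1) less, of "\<lambda>b u. Poly_Mapping.lookup (?ev b) u"] by blast
    have "Poly_Mapping.lookup (\<Sum>b\<in>?X. Poly_Mapping.single 0 (c b) * ?ev b) u = 0"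
      if u: "Poly_Mapping.keys u \<subseteq> A" for u
    proof -
      have scale: "Poly_Mapping.lookup (Poly_Mapping.single 0 s * p) u = s * Poly_Mapping.lookup p u"
        for s and p :: "'a mpoly"
        by (simp add: mult_map_scale_conv_mult[symmetric] Poly_Mapping.map.rep_eq when_def)
      show ?thesis
      proof (cases "u \<in> ?T")
        case True
        then show ?thesis using c(2) by (simp add: lookup_sum scale)
      next
        case False
        then obtain v where v: "D * (K * L) < Poly_Mapping.lookup u v" using u by (auto simp: not_less Suc_le_eq)
        have "Poly_Mapping.lookup (?ev b) u = 0" if b: "b \<in> ?X" for b
        proof (rule ccontr)
          assume "Poly_Mapping.lookup (?ev b) u \<noteq> 0"
          then have "u \<in> Poly_Mapping.keys (?ev b)" by (simp add: in_keys_iff)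
          then have "Poly_Mapping.lookup u v \<le> D * exp_deg b"
            using lookup_keys_power_product_le[of K f D u] D exp_deg_sum[OF XK(1)[OF b]] by simp
          also have "\<dots> \<le> D * (K * L)" using XK(3)[OF b] by (intro mult_left_mono) auto
          finally show False using v by simp
        qed
        then show ?thesis by (simp add: lookup_sum scale)
      qed
    qed
    then show ?thesis using X(1) XK c(1) by (intro exI[of _ ?X] exI[of _ c]) blast
  qed
  then show ?thesis by blast
qed

section \<open>The length of a regular sequence\<close>

definition degree_part :: "'a::field mpoly \<Rightarrow> nat \<Rightarrow> 'a mpoly"
  where "degree_part p r = (\<Sum>u\<in>{u \<in> Poly_Mapping.keys p. exp_deg u = r}. Poly_Mapping.single u (Poly_Mapping.lookup p u))"

lemma lookup_degree_part:
  "Poly_Mapping.lookup (degree_part p r) u = (if exp_deg u = r then Poly_Mapping.lookup p u else 0)"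
  by (auto simp: degree_part_def lookup_sum lookup_single when_def in_keys_iff sum.delta')

text \<open>The lowest homogeneous parts have a nonzero product, since there are no zero divisors;
  the remaining products have higher degree and cannot cancel it.\<close>

lemma keys_mult_low_degree:
  fixes p q :: "'a::field mpoly"
  assumes "u \<in> Poly_Mapping.keys p" "v \<in> Poly_Mapping.keys q"
  shows "\<exists>w\<in>Poly_Mapping.keys (p * q). exp_deg w \<le> exp_deg u + exp_deg v"
proof -
  obtain u0 where u0: "u0 \<in> Poly_Mapping.keys p" "\<And>u. u \<in> Poly_Mapping.keys p \<Longrightarrow> exp_deg u0 \<le> exp_deg u"
    using ex_has_least_nat[of "\<lambda>u. u \<in> Poly_Mapping.keys p" u exp_deg] assms(1) by blast
  obtain v0 where v0: "v0 \<in> Poly_Mapping.keys q" "\<And>v. v \<in> Poly_Mapping.keys q \<Longrightarrow> exp_deg v0 \<le> exp_deg v"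
    using ex_has_least_nat[of "\<lambda>v. v \<in> Poly_Mapping.keys q" v exp_deg] assms(2) by blast
  let ?p = "degree_part p (exp_deg u0)" and ?q = "degree_part q (exp_deg v0)"
  have "?p \<noteq> 0" "?q \<noteq> 0"
    using u0(1) v0(1) lookup_degree_part[of p "exp_deg u0" u0] lookup_degree_part[of q "exp_deg v0" v0]
    by (auto simp: in_keys_iff)
  then have "?p * ?q \<noteq> 0" by simp
  then obtain w where w: "w \<in> Poly_Mapping.keys (?p * ?q)" by (metis in_keys_iff lookup_zero poly_mapping_eqI)
  have dw: "exp_deg w = exp_deg u0 + exp_deg v0"
    using w by (elim keys_mult_cases) (auto simp: in_keys_iff lookup_degree_part exp_deg_add split: if_splits)
  have hp: "exp_deg u0 < exp_deg a" if "a \<in> Poly_Mapping.keys (p - ?p)" for a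
    using that u0(2)[of a] by (auto simp: in_keys_iff lookup_minus lookup_degree_part le_less split: if_splits)
  have hq: "exp_deg v0 < exp_deg a" if "a \<in> Poly_Mapping.keys (q - ?q)" for a
    using that v0(2)[of a] by (auto simp: in_keys_iff lookup_minus lookup_degree_part le_less split: if_splits)
  have "w \<notin> Poly_Mapping.keys (?p * (q - ?q))"
  proof
    assume "w \<in> Poly_Mapping.keys (?p * (q - ?q))"
    then show False using hq dw
      by (elim keys_mult_cases) (fastforce simp: in_keys_iff lookup_degree_part exp_deg_add split: if_splits)
  qed
  moreover have "w \<notin> Poly_Mapping.keys ((p - ?p) * q)"
  proof
    assume "w \<in> Poly_Mapping.keys ((p - ?p) * q)"
    then obtain a b where "a \<in> Poly_Mapping.keys (p - ?p)" "b \<in> Poly_Mapping.keys q" "w = a + b"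
      by (rule keys_mult_cases)
    then show False using hp[of a] v0(2)[of b] dw by (simp add: exp_deg_add)
  qed
  moreover have "p * q = ?p * ?q + ?p * (q - ?q) + (p - ?p) * q" by (simp add: algebra_simps)
  then have "Poly_Mapping.lookup (p * q) w = Poly_Mapping.lookup (?p * ?q) w +
      Poly_Mapping.lookup (?p * (q - ?q)) w + Poly_Mapping.lookup ((p - ?p) * q) w"
    by (metis lookup_add)
  ultimately have "Poly_Mapping.lookup (p * q) w = Poly_Mapping.lookup (?p * ?q) w"
    by (simp add: in_keys_iff)
  then have "w \<in> Poly_Mapping.keys (p * q)" using w by (simp add: in_keys_iff)
  moreover have "exp_deg w \<le> exp_deg u + exp_deg v" using dw u0(2)[OF assms(1)] v0(2)[OF assms(2)] by simp
  ultimately show ?thesis by blast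
qed

lemma max_ideal_subset:
  "(max_ideal n :: 'a::field mpoly set) \<subseteq> squarefree_ideal n {A. A \<subseteq> {1..n} \<and> A \<noteq> {}}"
proof -
  interpret cring "poly_ring n :: 'a mpoly ring" by (rule cring_poly_ring)
  have "ideal (squarefree_ideal n {A. A \<subseteq> {1..n} \<and> A \<noteq> {}} :: 'a mpoly set) (poly_ring n)"
    by (rule ideal_squarefree_ideal) auto
  moreover have "var ` {1..n} \<subseteq> (squarefree_ideal n {A. A \<subseteq> {1..n} \<and> A \<noteq> {}} :: 'a mpoly set)"
    by (auto simp: squarefree_ideal_def polys_def var_def single_eq_0_iff)
  ultimately show ?thesis unfolding max_ideal_def by (rule genideal_minimal)
qed

lemma seq_smult_ideal_module:
  fixes I :: "'a::field mpoly set"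
  assumes I: "ideal I (poly_ring n)" and fs: "set fs \<subseteq> polys {1..n}"
  shows "seq_smult (ideal_module n I) fs = {\<Sum>l<length fs. fs ! l * y l | y. \<forall>l<length fs. y l \<in> I}"
proof -
  have "(\<Oplus>\<^bsub>ideal_module n I\<^esub>i\<in>{..<length fs}. fs ! i \<odot>\<^bsub>ideal_module n I\<^esub> y i) = (\<Sum>l<length fs. fs ! l * y l)"
    if y: "\<forall>l<length fs. y l \<in> I" for y
  proof -
    have "(\<lambda>i. fs ! i * y i) \<in> {..<length fs} \<rightarrow> I"
    proof
      fix i assume "i \<in> {..<length fs}"
      then have "fs ! i \<in> polys {1..n}" "y i \<in> I" using fs nth_mem y by blast+
      then show "fs ! i * y i \<in> I" by (rule ideal_closed(5)[OF I])
    qed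
    from finsum_ideal_module[OF I this] show ?thesis by simp
  qed
  then show ?thesis unfolding seq_smult_def by (fastforce simp: Pi_iff)
qed

lemma scalar_in_polys: "Poly_Mapping.single 0 c \<in> polys Z"
  by (simp add: polys_def)

lemma keys_scalar_mult:
  "c \<noteq> 0 \<Longrightarrow> Poly_Mapping.keys (Poly_Mapping.single 0 c * p) = Poly_Mapping.keys (p :: 'a::field mpoly)"
  by (auto simp: in_keys_iff mult_map_scale_conv_mult[symmetric] Poly_Mapping.map.rep_eq when_def)

text \<open>Suppose that \<open>card A + 2\<close> elements \<open>f i\<close> form a regular sequence on the ideal. For every \<open>j\<close>, the
  images of the \<open>f i\<close> with \<open>i \<noteq> j\<close> modulo the variables outside \<open>A\<close> are algebraically dependent, so some
  nonzero polynomial expression \<open>p j\<close> in them has no monomial supported in \<open>A\<close>; hence \<open>p j\<close> times the squarefree monomial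
  \<open>x\<close> with support \<open>A\<close> lies in the ideal. By \<open>common_quotient\<close> these products have a common
  approximate quotient in the ideal, which is incompatible with \<open>x\<close> lying outside.\<close>
lemma length_regular_sequence_le:
  fixes fs :: "'a::field mpoly list"
  defines "I \<equiv> \<lambda>n F. squarefree_ideal n F :: 'a mpoly set"
  assumes up: "\<And>A B. A \<in> F \<Longrightarrow> A \<subseteq> B \<Longrightarrow> B \<subseteq> {1..n} \<Longrightarrow> B \<in> F"
    and A: "A \<subseteq> {1..n}" "A \<notin> F" "\<And>j. j \<in> {1..n} - A \<Longrightarrow> insert j A \<in> F"
    and fs: "set fs \<subseteq> max_ideal n" "regular_sequence (poly_ring n) (ideal_module n (I n F)) fs"
  shows "length fs \<le> card A + 1"
proof (rule ccontr)
  assume "\<not> length fs \<le> card A + 1"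
  define K where "K = card A + 2"
  have K: "K \<le> length fs" using \<open>\<not> length fs \<le> card A + 1\<close> by (simp add: K_def)
  define f where "f i = fs ! i" for i
  let ?M = "I n F"
  have I: "ideal ?M (poly_ring n)" unfolding I_def by (rule ideal_squarefree_ideal[OF up])
  note cl = ideal_closed[OF I]
  have finA: "finite A" using A(1) finite_subset by blast
  have fsp: "set fs \<subseteq> polys {1..n}" using fs(1) max_ideal_subset[of n] by (auto simp: squarefree_ideal_def)
  have f: "f i \<in> polys {1..n}" "\<And>u. u \<in> Poly_Mapping.keys (f i) \<Longrightarrow> 1 \<le> exp_deg u" if "i < K" for i
  proof -
    have "f i \<in> set fs" using that K by (simp add: f_def)
    then have fi: "f i \<in> squarefree_ideal n {A. A \<subseteq> {1..n} \<and> A \<noteq> {}}" using fs(1) max_ideal_subset by blast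
    then show "f i \<in> polys {1..n}" by (simp add: squarefree_ideal_def)
    fix u assume "u \<in> Poly_Mapping.keys (f i)"
    then have "Poly_Mapping.keys u \<noteq> {}" using fi unfolding squarefree_ideal_def by blast
    then have "u \<noteq> 0" by auto
    then show "1 \<le> exp_deg u" using exp_deg_pos[of u] by simp
  qed
  have smult: "seq_smult (ideal_module n ?M) (take i fs) = {\<Sum>l<i. f l * y l | y. \<forall>l<i. y l \<in> ?M}"
    if "i \<le> length fs" for i
  proof -
    have "set (take i fs) \<subseteq> polys {1..n}" using fsp set_take_subset[of i fs] by blast
    from seq_smult_ideal_module[OF I this] show ?thesis using that by (simp add: f_def)
  qed
  interpret regular_on f ?M K
  proof
    fix i x assume i: "i < K" and x: "x \<in> ?M" and h: "f i * x \<in> {\<Sum>l<i. f l * y l | y. \<forall>l<i. y l \<in> ?M}"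
    have "i < length fs" using i K by simp
    then have "fs ! i \<odot>\<^bsub>ideal_module n ?M\<^esub> x \<in> seq_smult (ideal_module n ?M) (take i fs) \<longrightarrow>
        x \<in> seq_smult (ideal_module n ?M) (take i fs)"
      using fs(2) x unfolding regular_sequence_def by simp
    then show "x \<in> {\<Sum>l<i. f l * y l | y. \<forall>l<i. y l \<in> ?M}"
      using h smult[of i] \<open>i < length fs\<close> by (simp add: f_def)
  next
    show "f i * x \<in> ?M" if "i < K" "x \<in> ?M" for i x using cl(5)[OF f(1)[OF that(1)] that(2)] .
  qed (fact cl(2), fact cl(3), fact cl(4))
  have scal: "Poly_Mapping.single 0 s * m \<in> ?M" if "m \<in> ?M" for s m
    using that by (intro cl scalar_in_polys)
  \<comment> \<open>Properness of the regular sequence enters here; \<open>m0\<close> later shows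
    that \<open>g 0\<close> is nonzero.\<close>
  obtain m0 where m0: "m0 \<in> ?M" "m0 \<notin> lin K"
  proof -
    have "lin K \<subseteq> seq_smult (ideal_module n ?M) fs"
    proof
      fix z assume "z \<in> lin K"
      then obtain y where y: "z = (\<Sum>l<K. f l * y l)" "\<forall>l<K. y l \<in> ?M" by (auto simp: lin_def)
      let ?y = "\<lambda>l. if l < K then y l else 0"
      have "z = (\<Sum>l<length fs. f l * ?y l)"
        unfolding y(1) using K by (intro sum.mono_neutral_cong_left) auto
      moreover have "\<forall>l<length fs. ?y l \<in> ?M" using y(2) cl(2) by simp
      ultimately have "z \<in> {\<Sum>l<length fs. f l * y l | y. \<forall>l<length fs. y l \<in> ?M}"
        by (intro CollectI exI[of _ ?y] conjI)
      then show "z \<in> seq_smult (ideal_module n ?M) fs" using smult[OF order_refl] by simp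
    qed
    moreover have "seq_smult (ideal_module n ?M) fs \<subseteq> ?M"
    proof
      fix z assume "z \<in> seq_smult (ideal_module n ?M) fs"
      then obtain y where y: "z = (\<Sum>l<length fs. f l * y l)" "\<forall>l<length fs. y l \<in> ?M"
        using smult[of "length fs"] by auto
      have "(\<Sum>l<k. f l * y l) \<in> ?M" if "k \<le> length fs" for k
        using that
      proof (induction k)
        case (Suc k)
        moreover have "f k \<in> polys {1..n}" using fsp nth_mem[of k fs] Suc.prems by (auto simp: f_def)
        ultimately show ?case using y(2) by (auto intro!: cl)
      qed (simp add: cl)
      then show "z \<in> ?M" using y(1) by simp
    qed
    moreover have "seq_smult (ideal_module n ?M) fs \<noteq> ?M" using fs(2) by (simp add: regular_sequence_def)
    ultimately have "\<not> ?M \<subseteq> lin K" by blast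
    then show ?thesis using that by blast
  qed
  from algebraic_relations[OF finA K_def, of f, folded ev_def]
  obtain d0 where d0: "\<forall>j<K. \<exists>X c. finite X \<and> X \<subseteq> exps K \<and> (\<exists>b\<in>X. c b \<noteq> 0) \<and>
      (\<forall>b\<in>X. Poly_Mapping.lookup b j = 0 \<and> exp_deg b \<le> d0) \<and>
      (\<forall>u. Poly_Mapping.keys u \<subseteq> A \<longrightarrow>
        Poly_Mapping.lookup (\<Sum>b\<in>X. Poly_Mapping.single 0 (c b) * ev b) u = 0)" ..
  define R where "R j X c \<longleftrightarrow> finite X \<and> X \<subseteq> exps K \<and> (\<exists>b\<in>X. c b \<noteq> (0::'a)) \<and>
      (\<forall>b\<in>X. Poly_Mapping.lookup b j = 0 \<and> exp_deg b \<le> d0) \<and>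
      (\<forall>u. Poly_Mapping.keys u \<subseteq> A \<longrightarrow>
        Poly_Mapping.lookup (\<Sum>b\<in>X. Poly_Mapping.single 0 (c b) * ev b) u = 0)" for j X c
  have "\<forall>j<K. \<exists>X c. R j X c" using d0 unfolding R_def .
  then obtain X c where "\<And>j. j < K \<Longrightarrow> R j (X j) (c j)" by metis
  note Xc = this[unfolded R_def]
  \<comment> \<open>Zero coefficients are dropped, so that the lightest exponent carries a nonzero
    one and can lead.\<close>
  define Y where "Y j = {b \<in> X j. c j b \<noteq> 0}" for j
  define p where "p j = (\<Sum>b\<in>Y j. Poly_Mapping.single 0 (c j b) * ev b)" for j
  have Y: "finite (Y j)" "Y j \<subseteq> exps K" "Y j \<noteq> {}" "\<And>b. b \<in> Y j \<Longrightarrow> Poly_Mapping.lookup b j = 0"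
    "\<And>b. b \<in> Y j \<Longrightarrow> exp_deg b \<le> d0" "\<And>b. b \<in> Y j \<Longrightarrow> c j b \<noteq> 0" if "j < K" for j
    using Xc[OF that] by (auto simp: Y_def)
  have pA: "Poly_Mapping.lookup (p j) u = 0" if "j < K" "Poly_Mapping.keys u \<subseteq> A" for j u
  proof -
    have "p j = (\<Sum>b\<in>X j. Poly_Mapping.single 0 (c j b) * ev b)"
      unfolding p_def Y_def using Xc[OF that(1)] by (intro sum.mono_neutral_left) auto
    then show ?thesis using Xc[OF that(1)] that(2) by simp
  qed
  have pow_polys: "q \<in> polys {1..n} \<Longrightarrow> q ^ k \<in> polys {1..n}" for q :: "'a mpoly" and k
    by (induction k) (auto intro: polys_mult)
  have ev_polys: "ev b \<in> polys {1..n}" for b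
  proof -
    have "(\<Prod>i<k. f i ^ Poly_Mapping.lookup b i) \<in> polys {1..n}" if "k \<le> K" for k
      using that
    proof (induction k)
      case (Suc k)
      then have "f k \<in> polys {1..n}" "(\<Prod>i<k. f i ^ Poly_Mapping.lookup b i) \<in> polys {1..n}"
        using f(1)[of k] by simp_all
      then show ?case unfolding prod.lessThan_Suc by (intro polys_mult pow_polys)
    qed simp
    then show ?thesis by (simp add: ev_def)
  qed
  have p_polys: "p j \<in> polys {1..n}" for j
  proof -
    have sum_polys: "sum h Z \<in> polys {1..n}" if "\<And>b. b \<in> Z \<Longrightarrow> h b \<in> (polys {1..n} :: 'a mpoly set)" for h and Z :: "(nat \<Rightarrow>\<^sub>0 nat) set"
      using that by (induction Z rule: infinite_finite_induct) (auto intro: polys_add)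
    then show ?thesis unfolding p_def by (intro sum_polys polys_mult scalar_in_polys ev_polys)
  qed
  define x where "x = Poly_Mapping.single (squarefree_exp A) (1::'a)"
  have px: "p j * x \<in> ?M" if j: "j < K" for j
  proof -
    have "x \<in> polys {1..n}" using A(1) finA by (simp add: x_def polys_def)
    then have "p j * x \<in> polys {1..n}" by (intro polys_mult p_polys)
    moreover have "Poly_Mapping.keys u \<in> F" if u: "u \<in> Poly_Mapping.keys (p j * x)" for u
    proof -
      obtain v where v: "v \<in> Poly_Mapping.keys (p j)" "u = v + squarefree_exp A"
        using u by (auto simp: x_def elim: keys_mult_cases)
      then have "\<not> Poly_Mapping.keys v \<subseteq> A" using pA[OF j] by (auto simp: in_keys_iff)
      then obtain i where i: "i \<in> Poly_Mapping.keys v" "i \<notin> A" by blast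
      have v1: "Poly_Mapping.keys v \<subseteq> {1..n}" using p_polys[of j] v(1) unfolding polys_def by blast
      have "insert i A \<in> F" using A(3)[of i] i v1 by blast
      moreover have "insert i A \<subseteq> Poly_Mapping.keys u" using i v(2) finA by (auto simp: keys_add_nat)
      moreover have "Poly_Mapping.keys u \<subseteq> {1..n}" using v1 v(2) finA A(1) by (simp add: keys_add_nat)
      ultimately show ?thesis by (rule up)
    qed
    ultimately show ?thesis unfolding I_def squarefree_ideal_def by blast
  qed
  \<comment> \<open>Chosen before \<open>p 0\<close> is known to be nonzero: \<open>B\<close>
    depends on the degree of \<open>u0\<close>, while nonvanishing is proved later with the
    filtration for this \<open>B\<close>.\<close>
  define u0 where "u0 = (SOME u. u \<in> Poly_Mapping.keys (p 0))"
  \<comment> \<open>One more than the degree that \<open>keys_mult_low_degree\<close> allows for a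
    lowest monomial of \<open>g 0 * (x - q)\<close>.\<close>
  define N0 where "N0 = exp_deg (squarefree_exp A) + exp_deg u0 + 1"
  \<comment> \<open>By \<open>weight_le\<close>, \<Delta> bounds the weight of exponents of degree
    at most \<open>d0\<close>, and weight at least N - \<Delta> forces degree at least
    \<open>N0\<close>. Since N + \<Delta> is (2 N0 + 4 d0) B^K, this \<open>B\<close> keeps it below
    B^(K + 1).\<close>
  define B where "B = 2 * N0 + 4 * d0 + 1"
  define \<Delta> where "\<Delta> = d0 * (2 * B ^ K)"
  define N where "N = N0 * (2 * B ^ K) + \<Delta>"
  have B: "0 < B" by (simp add: B_def)
  have N: "N + \<Delta> < B ^ Suc K"
  proof -
    have "N + \<Delta> = (2 * N0 + 4 * d0) * B ^ K" by (simp add: N_def \<Delta>_def algebra_simps)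
    also have "\<dots> < B * B ^ K" using B by (intro mult_strict_right_mono) (simp_all add: B_def)
    finally show ?thesis by simp
  qed
  have wY: "weight B b \<le> \<Delta>" if "j < K" "b \<in> Y j" for j b
  proof -
    have "weight B b \<le> exp_deg b * (2 * B ^ K)" using Y(2) that B by (intro weight_le) auto
    also have "\<dots> \<le> \<Delta>" unfolding \<Delta>_def using Y(5)[OF that] by (rule mult_right_mono) simp
    finally show ?thesis .
  qed
  have "\<exists>b. b \<in> Y j \<and> (\<forall>d\<in>Y j. weight B b \<le> weight B d)" if "j < K" for j
    using Y(3)[OF that] ex_has_least_nat[of "\<lambda>b. b \<in> Y j" _ "weight B"] by blast
  then obtain e where e: "\<And>j. j < K \<Longrightarrow> e j \<in> Y j" "\<And>j d. j < K \<Longrightarrow> d \<in> Y j \<Longrightarrow> weight B (e j) \<le> weight B d"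
    by metis
  have e_exps: "e j \<in> exps K" if "j < K" for j using e(1)[OF that] Y(2)[OF that] by blast
  \<comment> \<open>Dividing by the coefficient at \<open>e j\<close> makes \<open>ev (e j)\<close>
    itself the leading term of \<open>g j\<close>.\<close>
  define s where "s j = Poly_Mapping.single (0 :: nat \<Rightarrow>\<^sub>0 nat) (inverse (c j (e j)))" for j
  define g where "g j = s j * p j" for j
  have g: "(g j - ev (e j)) * y \<in> filt B (Suc (k + weight B (e j)))" if j: "j < K" and y: "y \<in> filt B k" for j y k
  proof -
    have ce: "c j (e j) \<noteq> 0" using Y(6) e(1) j by blast
    have "p j = Poly_Mapping.single 0 (c j (e j)) * ev (e j) +
        (\<Sum>b\<in>Y j - {e j}. Poly_Mapping.single 0 (c j b) * ev b)"
      unfolding p_def using Y(1)[OF j] e(1)[OF j] by (rule sum.remove)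
    moreover have "s j * Poly_Mapping.single 0 (c j (e j)) = 1" using ce by (simp add: s_def mult_single)
    ultimately have "g j = ev (e j) + s j * (\<Sum>b\<in>Y j - {e j}. Poly_Mapping.single 0 (c j b) * ev b)"
      unfolding g_def by (simp add: distrib_left flip: mult.assoc)
    then have "(g j - ev (e j)) * y = s j * (\<Sum>b\<in>Y j - {e j}. Poly_Mapping.single 0 (c j b) * (ev b * y))"
      by (simp add: sum_distrib_right mult.assoc)
    moreover have "\<dots> \<in> filt B (Suc (k + weight B (e j)))"
      unfolding s_def
    proof (rule filt_scale[OF scal], assumption, rule filt_sum, rule filt_scale[OF scal], assumption)
      fix b assume b: "b \<in> Y j - {e j}"
      then have bK: "b \<in> exps K" using Y(2)[OF j] by blast
      have "weight B (e j) \<noteq> weight B b"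
      proof
        assume "weight B (e j) = weight B b"
        moreover have "weight B (e j) < B ^ Suc K" using wY[OF j e(1)[OF j]] N by simp
        ultimately have "e j = b" using e_exps[OF j] bK by (intro weight_unique)
        then show False using b by blast
      qed
      then have "Suc (weight B (e j)) \<le> weight B b" using e(2)[OF j, of b] b by simp
      then show "ev b * y \<in> filt B (Suc (k + weight B (e j)))"
        using filt_ev[OF y bK] by (rule_tac filt_mono) auto
    qed
    ultimately show ?thesis by simp
  qed
  have K0: "0 < K" by (simp add: K_def)
  have s0: "inverse (c 0 (e 0)) \<noteq> 0" using Y(6)[OF K0 e(1)[OF K0]] by simp
  have keys_g: "Poly_Mapping.keys (g 0) = Poly_Mapping.keys (p 0)"
    unfolding g_def s_def by (rule keys_scalar_mult[OF s0])
  \<comment> \<open>If \<open>g 0\<close> vanished, \<open>ev (e 0) * m0\<close> would lie one step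
    higher in the filtration, and \<open>filt_detects\<close> would put \<open>m0\<close> in
    \<open>lin K\<close>.\<close>
  have "g 0 \<noteq> 0"
  proof
    assume "g 0 = 0"
    then have "(g 0 - ev (e 0)) * (- m0) = ev (e 0) * m0" by simp
    moreover have "(g 0 - ev (e 0)) * (- m0) \<in> filt B (Suc (0 + weight B (e 0)))"
      using m0(1) by (intro g K0 filt_0 cl)
    ultimately have "m0 \<in> lin K" using e_exps[OF K0] m0(1) B by (intro filt_detects[of "e 0"]) auto
    then show False using m0(2) by contradiction
  qed
  then have "\<exists>u. u \<in> Poly_Mapping.keys (p 0)" unfolding keys_g[symmetric]
    by (metis in_keys_iff lookup_zero poly_mapping_eqI)
  then have u0: "u0 \<in> Poly_Mapping.keys (g 0)" unfolding u0_def keys_g by (rule someI_ex)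
  \<comment> \<open>The products \<open>g i * x\<close> lie in the ideal although \<open>x\<close>
    does not, and they are proportional to the \<open>g i\<close>.\<close>
  have "\<exists>q\<in>?M. \<forall>i<K. g i * x - g i * q \<in> filt B (N + weight B (e i) - \<Delta>)"
  proof (rule common_quotient[OF B _ _ _ g _ _ N])
    show "Poly_Mapping.lookup (e i) i = 0" if "i < K" for i using Y(4)[OF that e(1)[OF that]] .
    show "weight B (e i) \<le> \<Delta>" if "i < K" for i using wY[OF that e(1)[OF that]] .
    show "g i * x \<in> ?M" if "i < K" for i
      using scal[OF px[OF that]] by (simp add: g_def s_def mult.assoc)
  qed (use e_exps in \<open>auto simp: algebra_simps\<close>)
  then obtain q where q: "q \<in> ?M" "g 0 * x - g 0 * q \<in> filt B (N + weight B (e 0) - \<Delta>)" using K0 by blast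
  have deg_mult: "a + b \<le> exp_deg u"
    if "u \<in> Poly_Mapping.keys (y * z)" "\<forall>u\<in>Poly_Mapping.keys y. a \<le> exp_deg u" "\<forall>u\<in>Poly_Mapping.keys z. b \<le> exp_deg u"
    for u a b and y z :: "'a mpoly"
    using that by (elim keys_mult_cases) (auto simp: exp_deg_add intro!: add_mono)
  have deg_pow: "\<forall>u\<in>Poly_Mapping.keys (f i ^ k). k \<le> exp_deg u" if "i < K" for i k
  proof (induction k)
    case (Suc k)
    then show ?case using deg_mult[of _ "f i" "f i ^ k" 1 k] f(2)[OF that] by auto
  qed simp
  have deg_ev: "\<forall>u\<in>Poly_Mapping.keys (ev b). exp_deg b \<le> exp_deg u" if b: "b \<in> exps K" for b
  proof -
    have "\<forall>u\<in>Poly_Mapping.keys (\<Prod>i<k. f i ^ Poly_Mapping.lookup b i). (\<Sum>i<k. Poly_Mapping.lookup b i) \<le> exp_deg u"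
      if "k \<le> K" for k
      using that
    proof (induction k)
      case (Suc k)
      then show ?case using deg_mult deg_pow[of k "Poly_Mapping.lookup b k"] by (simp add: Suc_le_eq)
    qed simp
    then show ?thesis by (simp add: ev_def exp_deg_sum[OF b])
  qed
  \<comment> \<open>Heavy power products have high degree, and the \<open>f i\<close> have no
    constant terms.\<close>
  have low: "\<forall>u\<in>Poly_Mapping.keys y. N0 \<le> exp_deg u" if "y \<in> filt B (N0 * (2 * B ^ K))" for y
    using that unfolding filt_def
  proof induction
    case (mspan_step y b m)
    then have b: "b \<in> exps K" "N0 * (2 * B ^ K) \<le> weight B b" by auto
    then have "N0 * (2 * B ^ K) \<le> exp_deg b * (2 * B ^ K)" using weight_le[OF b(1) B] by linarith
    then have "N0 \<le> exp_deg b" using B by simp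
    then have "N0 \<le> exp_deg u" if "u \<in> Poly_Mapping.keys (ev b * m)" for u
      using deg_mult[OF that, of "exp_deg b" 0] deg_ev[OF b(1)] by auto
    then show ?case using mspan_step.IH keys_add[of "ev b * m" y] by blast
  qed simp
  \<comment> \<open>The monomial \<open>x\<close> is missing from \<open>q\<close>, so it survives
    in \<open>x - q\<close> and gives \<open>g 0 * (x - q)\<close> a monomial of degree below
    \<open>N0\<close>.\<close>
  have "squarefree_exp A \<notin> Poly_Mapping.keys q"
    using q(1) A(2) finA by (auto simp: I_def squarefree_ideal_def)
  then have "squarefree_exp A \<in> Poly_Mapping.keys (x - q)"
    by (simp add: in_keys_iff lookup_minus x_def)
  then obtain w where w: "w \<in> Poly_Mapping.keys (g 0 * (x - q))" "exp_deg w \<le> exp_deg u0 + exp_deg (squarefree_exp A)"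
    using keys_mult_low_degree[OF u0] by blast
  have "g 0 * (x - q) \<in> filt B (N0 * (2 * B ^ K))"
    using filt_mono[OF q(2), of "N0 * (2 * B ^ K)"] by (simp add: N_def algebra_simps)
  then have "N0 \<le> exp_deg w" using low w(1) by blast
  then show False using w(2) by (simp add: N0_def)
qed

lemma ideal_depth_squarefree_ideal_le:
  assumes up: "\<And>A B. A \<in> F \<Longrightarrow> A \<subseteq> B \<Longrightarrow> B \<subseteq> {1..n} \<Longrightarrow> B \<in> F"
    and A: "A \<subseteq> {1..n}" "A \<notin> F" "\<And>j. j \<in> {1..n} - A \<Longrightarrow> insert j A \<in> F"
  shows "ideal_depth n (squarefree_ideal n F :: 'a::field mpoly set) \<le> enat (card A + 1)"
  unfolding ideal_depth_def module_depth_def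
  using length_regular_sequence_le[OF up A] by (intro SUP_least) auto

section \<open>A small maximal independent set\<close>

text \<open>The vertices 2, 5, 8, ..., and also \<open>n\<close> when n mod 3 = 1, since then n - 1
  is not chosen and \<open>n\<close> would have no chosen neighbour on the path. For n \<ge> 2 the
  vertex 1 is not chosen, so the set is independent in the cycle too.\<close>

definition dominating :: "nat \<Rightarrow> nat set"
  where "dominating n = {i \<in> {1..n}. i mod 3 = 2 \<or> i = n \<and> n mod 3 = 1}"

lemma card_dominating: "card (dominating n) \<le> (n + 2) div 3"
proof -
  have "inj_on (\<lambda>i. i div 3) (dominating n)"
  proof (rule inj_onI)
    fix i j assume ij: "i \<in> dominating n" "j \<in> dominating n" "i div 3 = j div 3"
    have "i = 3 * (i div 3) + i mod 3" "j = 3 * (j div 3) + j mod 3" by simp_all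
    then show "i = j" using ij unfolding dominating_def by auto presburger+
  qed
  moreover have "(\<lambda>i. i div 3) ` dominating n \<subseteq> {..<(n + 2) div 3}"
  proof (rule image_subsetI)
    fix i assume "i \<in> dominating n"
    then have "i \<le> n" "i mod 3 = 2 \<or> i mod 3 = 1" by (auto simp: dominating_def)
    then have "i div 3 < (n + 2) div 3" by presburger
    then show "i div 3 \<in> {..<(n + 2) div 3}" by simp
  qed
  ultimately show ?thesis using card_inj_on_le[of "\<lambda>i. i div 3" "dominating n" "{..<(n + 2) div 3}"] by simp
qed

lemma path_family_upclosed:
  "A \<in> path_family [1..<Suc n] {} \<Longrightarrow> A \<subseteq> B \<Longrightarrow> B \<subseteq> {1..n} \<Longrightarrow> B \<in> path_family [1..<Suc n] {}"
  unfolding path_family_upt by blast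

lemma cycle_family_upclosed:
  "A \<in> cycle_family n \<Longrightarrow> A \<subseteq> B \<Longrightarrow> B \<subseteq> {1..n} \<Longrightarrow> B \<in> cycle_family n"
  unfolding cycle_family_eq by blast

lemma path_family_subset_cycle_family: "path_family [1..<Suc n] {} \<subseteq> cycle_family n"
  unfolding path_family_upt cycle_family_eq by blast

lemma dominating_notin:
  assumes "n \<ge> 2"
  shows "dominating n \<notin> cycle_family n"
proof
  assume "dominating n \<in> cycle_family n"
  then consider i where "i \<in> dominating n" "i + 1 \<in> dominating n" | "1 \<in> dominating n"
    unfolding cycle_family_eq by blast
  then show False
  proof cases
    case 1
    then show False unfolding dominating_def by auto presburger+
  qed (use assms in \<open>auto simp: dominating_def\<close>)
qed

text \<open>A multiple of 3 has its predecessor chosen, and an unchosen vertex that is 1 modulo 3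
  has its successor chosen. Path edges alone thus give maximality, which serves for the path and the
  cycle.\<close>

lemma insert_dominating:
  assumes "j \<in> {1..n} - dominating n"
  shows "insert j (dominating n) \<in> path_family [1..<Suc n] {}"
proof -
  have j: "1 \<le> j" "j \<le> n" "j mod 3 \<noteq> 2" "\<not> (j = n \<and> n mod 3 = 1)" using assms by (auto simp: dominating_def)
  have sub: "insert j (dominating n) \<subseteq> {1..n}" using assms by (auto simp: dominating_def)
  consider "j mod 3 = 0" | "j mod 3 = 1" using j(3) by linarith
  then show ?thesis
  proof cases
    case 1
    then obtain q where "j = 3 * q" by auto
    moreover from this j(1) obtain q' where "q = Suc q'" by (cases q) auto
    ultimately have "j - 1 = 3 * q' + 2" by simp
    then have "(j - 1) mod 3 = 2" "1 < j" by presburger+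
    then have "j - 1 \<in> dominating n" "j - 1 \<in> {1..<n}" using j by (auto simp: dominating_def)
    moreover have "j - 1 + 1 = j" using j by simp
    ultimately show ?thesis unfolding path_family_upt using sub by blast
  next
    case 2
    have "(j + 1) mod 3 = 2" using 2 by presburger
    moreover have "j < n" using 2 j by (cases "j = n") auto
    ultimately have "j + 1 \<in> dominating n" "j \<in> {1..<n}" using j by (auto simp: dominating_def)
    then show ?thesis unfolding path_family_upt using sub by blast
  qed
qed

theorem corollary1p5:
  fixes n :: nat
  assumes "n \<ge> 3"
  shows "real (ideal_sdepth n (path_ideal n :: 'a::field mpoly set)) \<ge> 1 + (real n - 1) / 2 \<and>
    real (ideal_sdepth n (cycle_ideal n :: 'a mpoly set)) \<ge> real n / 2 \<and>
    enat (ideal_sdepth n (path_ideal n :: 'a mpoly set)) \<ge> ideal_depth n (path_ideal n :: 'a mpoly set) \<and>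
    enat (ideal_sdepth n (cycle_ideal n :: 'a mpoly set)) \<ge> ideal_depth n (cycle_ideal n :: 'a mpoly set)"
proof -
  let ?P = "path_family [1..<Suc n] {}" and ?C = "cycle_family n"
  let ?sP = "ideal_sdepth n (path_ideal n :: 'a mpoly set)" and ?sC = "ideal_sdepth n (cycle_ideal n :: 'a mpoly set)"
  have P: "path_ideal n = (squarefree_ideal n ?P :: 'a mpoly set)" by (rule path_ideal_eq)
  have C: "cycle_ideal n = (squarefree_ideal n ?C :: 'a mpoly set)" using assms by (intro cycle_ideal_eq) simp
  have iP: "ideal (squarefree_ideal n ?P :: 'a mpoly set) (poly_ring n)"
    by (rule ideal_squarefree_ideal[OF path_family_upclosed])
  have iC: "ideal (squarefree_ideal n ?C :: 'a mpoly set) (poly_ring n)"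
    by (rule ideal_squarefree_ideal[OF cycle_family_upclosed])
  have "{1, 2} \<in> ?P" using assms unfolding path_family_upt by auto
  then have ne: "?P \<noteq> {}" "?C \<noteq> {}" using path_family_subset_cycle_family by blast+
  have sub: "?P \<subseteq> Pow {1..n}" "?C \<subseteq> Pow {1..n}" unfolding path_family_upt cycle_family_eq by blast+
  have "length [1..<Suc n] = n" by simp
  moreover have "partitionable ((length [1..<Suc n] + 2) div 2) ?P" by (rule partitionable_path_family_empty) simp
  ultimately have "partitionable ((n + 2) div 2) ?P" by (simp only:)
  then have sP: "(n + 2) div 2 \<le> ?sP" unfolding P by (intro le_sdepth_squarefree_ideal iP ne sub)
  have sC: "(n + 1) div 2 \<le> ?sC" unfolding C
    by (intro le_sdepth_squarefree_ideal iC ne sub partitionable_cycle_family assms)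
  have sC4: "3 \<le> ?sC" if "n = 4" unfolding C
    by (intro le_sdepth_squarefree_ideal iC ne sub) (use partitionable_cycle_family_4 that in simp)
  have dom: "dominating n \<subseteq> {1..n}" by (auto simp: dominating_def)
  have nC: "dominating n \<notin> ?C" using assms by (intro dominating_notin) simp
  then have nP: "dominating n \<notin> ?P" using path_family_subset_cycle_family by blast
  have dP: "ideal_depth n (path_ideal n :: 'a mpoly set) \<le> enat (card (dominating n) + 1)" unfolding P
    by (rule ideal_depth_squarefree_ideal_le[OF path_family_upclosed dom nP insert_dominating])
  have dC: "ideal_depth n (cycle_ideal n :: 'a mpoly set) \<le> enat (card (dominating n) + 1)" unfolding C
    by (rule ideal_depth_squarefree_ideal_le[OF cycle_family_upclosed dom nC
          subsetD[OF path_family_subset_cycle_family insert_dominating]])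
  have cP: "card (dominating n) + 1 \<le> ?sP"
  proof -
    have "(n + 2) div 3 + 1 \<le> (n + 2) div 2" using assms by presburger
    then show ?thesis using card_dominating[of n] sP by linarith
  qed
  have cC: "card (dominating n) + 1 \<le> ?sC"
  proof (cases "n = 4")
    case True
    then show ?thesis using card_dominating[of n] sC4 by simp
  next
    case False
    then have "(n + 2) div 3 + 1 \<le> (n + 1) div 2" using assms by presburger
    then show ?thesis using card_dominating[of n] sC by linarith
  qed
  have "n + 1 \<le> 2 * ?sP" "n \<le> 2 * ?sC" using sP sC by presburger+
  then have "real (n + 1) \<le> real (2 * ?sP)" "real n \<le> real (2 * ?sC)" by (simp_all only: of_nat_le_iff)
  then have "1 + (real n - 1) / 2 \<le> real ?sP" "real n / 2 \<le> real ?sC" by (simp_all add: field_simps)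
  moreover have "ideal_depth n (path_ideal n :: 'a mpoly set) \<le> enat ?sP"
    using order_trans[OF dP, of "enat ?sP"] cP by simp
  moreover have "ideal_depth n (cycle_ideal n :: 'a mpoly set) \<le> enat ?sC"
    using order_trans[OF dC, of "enat ?sC"] cC by simp
  ultimately show ?thesis by blast
qed

end
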